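(* Let $n,p$ be positive integers. For $x,y\in\widehat{B}_p$ the polyharmonic Bergman kernel $R_p$ for $\widehat{B}_p$ is given by $$R_p(x,y)=\frac{1-|x|^{2p}|\overline{y}|^{2p}}{1-|x|^2|\overline{y}|^{2}}\, R(x,y)+\frac{1}{n\Omega_n}\sum_{k=0}^{p-1}4k|x|^{2k}|\overline{y}|^{2k}P(x,y),$$ where $R$ is the harmonic Bergman kernel and $P$ is the harmonic Poisson kernel, both extended to $\widehat{B}_p\times\widehat{B}_p$.
   Context: Notation: for complex vectors $z,w\in\mathbb{C}^n$, $zw=\sum_j z_jw_j$ (bilinear), $\overline{y}$ is the componentwise conjugate, and $|z|=(\sum_j z_j^2)^{1/2}$ is the complex extension of the Euclidean norm (principal square root), so $|x|^{2k}=(\sum_jx_j^2)^k$ and $|\overline{y}|^{2k}=(\sum_j\overline{y_j}^2)^k$. Non-integer powers are principal branches. Sets: $B$ is the open unit ball of $\mathbb{R}^n$ centred at $0$ and $\widehat{B}_p=\bigcup_{k=0}^{p-1}e^{k\pi i/p}B\subset\mathbb{C}^n$. $\Omega_n=\pi^{n/2}/\Gamma(n/2+1)$ is the volume of $B$. Polyharmonic functions: a complex-valued analytic function $u$ on $B$ is polyharmonic of order $p$ if $\Delta^p u=0$ on $B$; the space of these is $\mathcal{A}_{\Delta^p}(B)$. Each such $u$ has an expansion $u=\sum_{m\ge 0} q_m$ into homogeneous polynomials $q_m$ of degree $m$, converging on $B$, and is extended holomorphically to rotated balls by $u(e^{i\psi}x)=\sum_m e^{im\psi}q_m(x)$ ($\psi\in\mathbb{R}$,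 $x\in B$). In this way $u$ is regarded as a function on $\widehat{B}_p$. Bergman space: $b_p^2(\widehat{B}_p)$ is the space of $u\in\mathcal{A}_{\Delta^p}(B)$ (extended to $\widehat{B}_p$) with $\langle u,u\rangle_{b_p^2}<\infty$, where $\langle u,v\rangle_{b_p^2}=\frac1p\sum_{k=0}^{p-1}\int_B u(e^{k\pi i/p}y)\overline{v(e^{k\pi i/p}y)}\,dy$. It is a Hilbert space on which point evaluations at points of $\widehat{B}_p$ are bounded. Bergman kernel: $R_p:\widehat{B}_p\times\widehat{B}_p\to\mathbb{C}$ is the unique function such that for every $x\in\widehat{B}_p$ one has $R_p(\cdot,x)\in b_p^2(\widehat{B}_p)$ and $u(x)=\langle u,R_p(\cdot,x)\rangle_{b_p^2}$ for all $u\in b_p^2(\widehat{B}_p)$. Harmonic kernels: for $x,y\in B$, $R(x,y)$ is the (real, symmetric) reproducing kernel of the harmonic Bergman space of harmonic functions in $L^2(B,dy)$ (the case $p=1$). It is extended to $\widehat{B}_p\times\widehat{B}_p$ by applying to $R$ in the first variable $x$ the holomorphic extension $u(e^{i\psi}x)=\sum_m e^{im\psi}q_m(x)$ (for a function $u=\sum_m q_m$ on $B$ with $q_m$ homogeneous polynomials of degree $m$), and in the second variable $y$ its complex conjugate (antiholomorphic) version $u(e^{i\psi}y)=\sum_m e^{-im\psi}q_m(y)$; explicitly, $R(x,y)=\frac{1}{n\Omega_n}\sum_{m\ge0}(n+2m)Z_m(x,y)$, where $Z_m(x,y)$ are the zonal harmonics on $B\times B$ (homogeneous of degree $m$ in each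 variable; on $S\times S$, with $S$ the unit sphere carrying normalized surface measure, $Z_m$ is the reproducing kernel of spherical harmonics of degree $m$), extended by $Z_m(e^{j\pi i/p}x,e^{l\pi i/p}y)=e^{m(j-l)\pi i/p}Z_m(x,y)$ for $x,y\in B$, $0\le j,l\le p-1$. The extended harmonic Poisson kernel is $P(x,y)=\sum_{m\ge0}Z_m(x,y)=\dfrac{1-|x|^{2}|\overline{y}|^{2}}{(1-2x\overline{y}+|x|^2|\overline{y}|^2)^{n/2}}$ on $\widehat{B}_p\times\widehat{B}_p$. *)

theory Defs
  imports "HOL-Analysis.Analysis"
begin

text \<open>Throughout, the dimension of the underlying space is \<open>n = CARD('n)\<close>.\<close>

text \<open>Multi-indices are functions \<open>'n \<Rightarrow> nat\<close>.\<close>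

definition multi_power :: "real^'n \<Rightarrow> ('n::finite \<Rightarrow> nat) \<Rightarrow> complex"
  where "multi_power x \<alpha> = (\<Prod>i\<in>UNIV. complex_of_real (x $ i) ^ \<alpha> i)"

definition real_analytic_on :: "(real^'n::finite \<Rightarrow> complex) \<Rightarrow> (real^'n) set \<Rightarrow> bool"
  where "real_analytic_on u S \<longleftrightarrow>
    (\<forall>a\<in>S. \<exists>r>0. \<exists>c. \<forall>x\<in>ball a r.
      ((\<lambda>\<alpha>. c \<alpha> * multi_power (x - a) \<alpha>) has_sum u x) UNIV)"

definition partial_derivative ::
    "'n::finite \<Rightarrow> (real^'n \<Rightarrow> complex) \<Rightarrow> real^'n \<Rightarrow> complex"
  where "partial_derivative i u x =
    vector_derivative (\<lambda>t. u (x + t *\<^sub>R axis i 1)) (at 0)"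

definition laplacian :: "(real^'n::finite \<Rightarrow> complex) \<Rightarrow> real^'n \<Rightarrow> complex"
  where "laplacian u x =
    (\<Sum>i\<in>UNIV. partial_derivative i (partial_derivative i u) x)"

text \<open>Functions on the ball are represented by functions on the whole space, whose
  values outside the ball play no role.\<close>

definition polyharmonic :: "nat \<Rightarrow> (real^'n::finite \<Rightarrow> complex) set"
  where "polyharmonic p = {u. real_analytic_on u (ball 0 1) \<and>
    (\<forall>x\<in>ball 0 1. (laplacian ^^ p) u x = 0)}"

text \<open>The index set of the sum below is finite, so this is a genuine polynomial.\<close>

lemma finite_multi_indices: "finite {\<alpha> :: 'n::finite \<Rightarrow> nat. sum \<alpha> UNIV = m}"
proof (rule finite_subset)
  show "{\<alpha> :: 'n \<Rightarrow> nat. sum \<alpha> UNIV = m} \<subseteq> (\<Pi>\<^sub>E i\<in>UNIV. {..m})"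
    by (auto simp: PiE_UNIV_domain intro: member_le_sum)
qed (intro finite_PiE; simp)

definition homogeneous_polynomial :: "nat \<Rightarrow> (real^'n::finite \<Rightarrow> complex) \<Rightarrow> bool"
  where "homogeneous_polynomial m q \<longleftrightarrow>
    (\<exists>c. \<forall>x. q x = (\<Sum>\<alpha> | sum \<alpha> UNIV = m. c \<alpha> * multi_power x \<alpha>))"

text \<open>The sequence of homogeneous components is uniquely determined by the function
  on the ball whenever such an expansion exists.\<close>

definition homogeneous_components ::
    "(real^'n::finite \<Rightarrow> complex) \<Rightarrow> nat \<Rightarrow> real^'n \<Rightarrow> complex"
  where "homogeneous_components u =
    (THE q. (\<forall>m. homogeneous_polynomial m (q m)) \<and>
            (\<forall>x\<in>ball 0 1. (\<lambda>m. q m x) sums u x))"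

definition complex_vec :: "real^'n \<Rightarrow> complex^'n"
  where "complex_vec x = (\<chi> i. complex_of_real (x $ i))"

definition rotate_vec :: "real \<Rightarrow> real^'n \<Rightarrow> complex^'n"
  where "rotate_vec \<psi> x = cis \<psi> *s complex_vec x"

definition rotated_balls :: "nat \<Rightarrow> (complex^'n::finite) set"
  where "rotated_balls p = (\<Union>k<p. rotate_vec (real k * pi / real p) ` ball 0 1)"

text \<open>The representation \<open>z = e\<^sup>i\<^sup>\<psi>x\<close> of a point of a rotated ball is not unique, but
  homogeneity makes the value of the series independent of it: two representations of a
  nonzero \<open>z\<close> differ by a sign of \<open>x\<close>.\<close>

definition holomorphic_extension ::
    "(real^'n::finite \<Rightarrow> complex) \<Rightarrow> complex^'n \<Rightarrow> complex"
  where "holomorphic_extension u z =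
    (THE w. \<exists>\<psi>. \<exists>x\<in>ball 0 1. z = rotate_vec \<psi> x \<and>
      w = (\<Sum>m. cis (real m * \<psi>) * homogeneous_components u m x))"

definition antiholomorphic_extension ::
    "(real^'n::finite \<Rightarrow> complex) \<Rightarrow> complex^'n \<Rightarrow> complex"
  where "antiholomorphic_extension u z =
    (THE w. \<exists>\<psi>. \<exists>x\<in>ball 0 1. z = rotate_vec \<psi> x \<and>
      w = (\<Sum>m. cis (- (real m * \<psi>)) * homogeneous_components u m x))"

definition bergman_inner ::
    "nat \<Rightarrow> (complex^'n::finite \<Rightarrow> complex) \<Rightarrow> (complex^'n \<Rightarrow> complex) \<Rightarrow> complex"
  where "bergman_inner p u v = 1 / of_nat p *
    (\<Sum>k<p. LINT y:ball 0 1|lborel.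
      u (rotate_vec (real k * pi / real p) y) * cnj (v (rotate_vec (real k * pi / real p) y)))"

text \<open>Finiteness of the norm has to be expressed by integrability, since the Bochner
  integral of a non-integrable function is \<open>0\<close>. Values outside \<open>rotated_balls p\<close> are
  irrelevant.\<close>

definition bergman_space :: "nat \<Rightarrow> (complex^'n::finite \<Rightarrow> complex) set"
  where "bergman_space p = {U.
    (\<exists>u\<in>polyharmonic p. \<forall>z\<in>rotated_balls p. U z = holomorphic_extension u z) \<and>
    (\<forall>k<p. set_integrable lborel (ball 0 1)
      (\<lambda>y. (cmod (U (rotate_vec (real k * pi / real p) y)))\<^sup>2))}"

text \<open>The kernel is set to \<open>0\<close> off its domain to make it unique as a total function.\<close>

definition bergman_kernel :: "nat \<Rightarrow> complex^'n::finite \<Rightarrow> complex^'n \<Rightarrow> complex"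
  where "bergman_kernel p = (THE K.
    (\<forall>x\<in>rotated_balls p. (\<lambda>y. K y x) \<in> bergman_space p \<and>
      (\<forall>u\<in>bergman_space p. u x = bergman_inner p u (\<lambda>y. K y x))) \<and>
    (\<forall>x y. x \<notin> rotated_balls p \<or> y \<notin> rotated_balls p \<longrightarrow> K x y = 0))"

text \<open>The harmonic Bergman kernel is the case \<open>p = 1\<close>, where \<open>rotated_balls 1\<close> is the
  real unit ball.\<close>

definition harmonic_bergman_kernel :: "real^'n::finite \<Rightarrow> real^'n \<Rightarrow> complex"
  where "harmonic_bergman_kernel x y = bergman_kernel 1 (complex_vec x) (complex_vec y)"

definition extended_harmonic_bergman_kernel ::
    "complex^'n::finite \<Rightarrow> complex^'n \<Rightarrow> complex"
  where "extended_harmonic_bergman_kernel z w =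
    antiholomorphic_extension
      (\<lambda>y. holomorphic_extension (\<lambda>x. harmonic_bergman_kernel x y) z) w"

definition bilinear_dot :: "complex^'n::finite \<Rightarrow> complex^'n \<Rightarrow> complex"
  where "bilinear_dot z w = (\<Sum>j\<in>UNIV. z $ j * w $ j)"

definition conj_vec :: "complex^'n \<Rightarrow> complex^'n"
  where "conj_vec y = (\<chi> j. cnj (y $ j))"

text \<open>This is the complex-valued extension of the Euclidean norm, not the Hermitian norm.\<close>

definition complex_norm :: "complex^'n::finite \<Rightarrow> complex"
  where "complex_norm z = csqrt (\<Sum>j\<in>UNIV. (z $ j)\<^sup>2)"

text \<open>On \<open>rotated_balls p\<close> the base of the power is a product
  \<open>(1 - t r e\<^sup>i\<^sup>\<theta>) (1 - t r e\<^sup>-\<^sup>i\<^sup>\<theta>)\<close> with \<open>|t| = 1\<close> and \<open>0 \<le> r < 1\<close>, hence avoids the branch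
  cut of the principal power.\<close>

definition poisson_kernel :: "complex^'n::finite \<Rightarrow> complex^'n \<Rightarrow> complex"
  where "poisson_kernel x y =
    (1 - complex_norm x ^ 2 * complex_norm (conj_vec y) ^ 2) /
    (1 - 2 * bilinear_dot x (conj_vec y)
       + complex_norm x ^ 2 * complex_norm (conj_vec y) ^ 2) powr (of_nat CARD('n) / 2)"

end

theory Submission
  imports Defs "HOL-Complex_Analysis.Complex_Analysis" "HOL-Probability.Distributions"
begin

text \<open>
  Write \<open>q = |x|\<^sup>2 |cnj y|\<^sup>2\<close> for the product of squared complex norms,
  with the second vector conjugated, and \<open>\<Omega>\<close> for the volume of the unit ball.

  By the Almansi decomposition, a polyharmonic function of order \<open>p\<close> is a sum of terms
  \<open>|x|^(2j) h(x)\<close> with \<open>j < p\<close> and \<open>h\<close> a harmonic homogeneous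
  polynomial of some degree \<open>l\<close>. On a single ball, terms with different
  \<open>l\<close> are orthogonal, but terms with equal \<open>l\<close> and different
  \<open>j\<close> are not. Averaging over the rotations by \<open>cis (k\<pi> / p)\<close> repairs
  this: the product of terms of equal \<open>l\<close> with exponents \<open>i\<close> and
  \<open>j\<close> acquires the phases \<open>cis (2\<pi>k(i - j) / p)\<close>, whose mean over
  \<open>k < p\<close> vanishes unless \<open>i = j\<close> (\<open>roots_of_unity_sum\<close>). The
  Bergman space therefore splits orthogonally, and its kernel is the sum of the kernels of the
  pieces,
  \<open>1 / (n \<Omega>) \<Sum>_(j<p) q\<^sup>j \<Sum>\<^sub>l (n + 2l + 4j) Z\<^sub>l(x, y)\<close>,
  where the weight is the reciprocal of the radial integral of \<open>r^(n-1+2l+4j)\<close>.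
  Splitting it as \<open>(n + 2l) + 4j\<close> gives the formula: the first part is a geometric sum
  in \<open>q\<close> times the harmonic Bergman kernel, and in the second part
  \<open>\<Sum>\<^sub>l Z\<^sub>l\<close> is the Poisson kernel.

  Two ingredients require work. The first is the theory of zonal harmonics. They are given here by
  explicit coefficients, chosen so that the Poisson kernel is their generating function
  (\<open>zonal_generating\<close>). That they are harmonic and reproduce harmonic polynomials
  (\<open>harm_zonal_harmonic\<close>, \<open>bint_zonal_harmonic\<close>) is proved with integrals
  against the Gaussian weight, where integration by parts has no boundary terms
  (\<open>gint_by_parts\<close>); homogeneity transfers the results to the ball
  (\<open>gint_eq_Gamma_times_bint\<close>).

  The second is the expansion of a polyharmonic function on the whole ball
  (\<open>polyharmonic_expansion\<close>). Real analyticity gives it only near the origin. But the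
  moments \<open>\<integral> Z\<^sub>l(b, y) u(\<rho>y) dy\<close> are analytic in
  \<open>\<rho>\<close> and equal an explicit polynomial for small \<open>\<rho>\<close>, so they do
  for all \<open>\<rho> < 1\<close> (\<open>radial_moment\<close>). Bounding the coefficients of
  this polynomial bounds the harmonic components of \<open>u\<close>
  (\<open>hom_part_growth\<close>), which makes the expansion converge on the ball; the identity
  theorem on rays shows that it converges to \<open>u\<close>.

  Termwise integration of the kernel series then yields the reproducing property
  (\<open>bkernel_reproducing\<close>), and the usual argument shows that the kernel is unique
  (\<open>bergman_kernel_eq\<close>).
\<close>

section \<open>Homogeneous polynomials\<close>

abbreviation hp :: "nat \<Rightarrow> (real^'n::finite \<Rightarrow> complex) \<Rightarrow> bool"
  where "hp \<equiv> homogeneous_polynomial"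

lemma multi_power_add: "multi_power x (\<lambda>i. \<alpha> i + \<beta> i) = multi_power x \<alpha> * multi_power x \<beta>"
  by (simp add: multi_power_def power_add prod.distrib)

lemma hp_monomial:
  assumes "sum \<alpha> UNIV = m"
  shows "hp m (\<lambda>x::real^'n::finite. multi_power x \<alpha>)"
  unfolding homogeneous_polynomial_def
proof (intro exI allI)
  fix x :: "real^'n"
  show "multi_power x \<alpha> = (\<Sum>\<beta> | sum \<beta> UNIV = m. of_bool (\<beta> = \<alpha>) * multi_power x \<beta>)"
    using assms by (subst sum.remove[OF finite_multi_indices, of \<alpha>]) auto
qed

lemma hp_zero [simp]: "hp m (\<lambda>x::real^'n::finite. 0)"
  unfolding homogeneous_polynomial_def by (rule exI[of _ "\<lambda>_. 0"]) simp

lemma hp_add: "hp m f \<Longrightarrow> hp m g \<Longrightarrow> hp m (\<lambda>x::real^'n::finite. f x + g x)"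
  unfolding homogeneous_polynomial_def
proof (elim exE)
  fix c d assume "\<forall>x. f x = (\<Sum>\<alpha> | sum \<alpha> UNIV = m. c \<alpha> * multi_power x \<alpha>)"
    "\<forall>x. g x = (\<Sum>\<alpha> | sum \<alpha> UNIV = m. d \<alpha> * multi_power x \<alpha>)"
  then show "\<exists>c. \<forall>x. f x + g x = (\<Sum>\<alpha> | sum \<alpha> UNIV = m. c \<alpha> * multi_power x \<alpha>)"
    by (intro exI[of _ "\<lambda>\<alpha>. c \<alpha> + d \<alpha>"]) (simp add: algebra_simps sum.distrib)
qed

lemma hp_cmult: "hp m f \<Longrightarrow> hp m (\<lambda>x::real^'n::finite. k * f x)"
  unfolding homogeneous_polynomial_def
proof (elim exE)
  fix c assume "\<forall>x. f x = (\<Sum>\<alpha> | sum \<alpha> UNIV = m. c \<alpha> * multi_power x \<alpha>)"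
  then show "\<exists>c. \<forall>x. k * f x = (\<Sum>\<alpha> | sum \<alpha> UNIV = m. c \<alpha> * multi_power x \<alpha>)"
    by (intro exI[of _ "\<lambda>\<alpha>. k * c \<alpha>"]) (simp add: algebra_simps sum_distrib_left)
qed

lemma hp_sum: "(\<And>i. i \<in> I \<Longrightarrow> hp m (f i)) \<Longrightarrow> hp m (\<lambda>x::real^'n::finite. \<Sum>i\<in>I. f i x)"
  by (induction I rule: infinite_finite_induct) (auto intro: hp_add)

lemma hp_induct [consumes 1, case_names monomial zero add cmult]:
  fixes q :: "real^'n::finite \<Rightarrow> complex"
  assumes q: "hp m q"
    and mon: "\<And>\<alpha>. sum \<alpha> UNIV = m \<Longrightarrow> P (\<lambda>x. multi_power x \<alpha>)"
    and zero: "P (\<lambda>x. 0)"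
    and add: "\<And>f g. hp m f \<Longrightarrow> hp m g \<Longrightarrow> P f \<Longrightarrow> P g \<Longrightarrow> P (\<lambda>x. f x + g x)"
    and cmult: "\<And>f k. hp m f \<Longrightarrow> P f \<Longrightarrow> P (\<lambda>x. k * f x)"
  shows "P q"
proof -
  obtain c where c: "\<And>x. q x = (\<Sum>\<alpha> | sum \<alpha> UNIV = m. c \<alpha> * multi_power x \<alpha>)"
    using q unfolding homogeneous_polynomial_def by blast
  have "P (\<lambda>x. \<Sum>\<alpha>\<in>A. c \<alpha> * multi_power x \<alpha>) \<and> hp m (\<lambda>x. \<Sum>\<alpha>\<in>A. c \<alpha> * multi_power x \<alpha>)"
    if "finite A" "A \<subseteq> {\<alpha>. sum \<alpha> UNIV = m}" for A
    using that by (induction A) (auto intro!: zero add cmult mon hp_add hp_cmult hp_monomial)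
  from this[OF finite_multi_indices order_refl] show ?thesis
    using c by (metis (no_types, lifting) ext)
qed

lemma hp_mult:
  assumes "hp m f" "hp k g"
  shows "hp (m + k) (\<lambda>x::real^'n::finite. f x * g x)"
  using assms(1)
proof (induction rule: hp_induct)
  case (monomial \<alpha>)
  from assms(2) show ?case
  proof (induction rule: hp_induct)
    case (monomial \<beta>)
    then show ?case
      using hp_monomial[of "\<lambda>i. \<alpha> i + \<beta> i" "m + k"] \<open>sum \<alpha> UNIV = m\<close>
      by (simp add: multi_power_add sum.distrib)
  next
    case (cmult f c)
    then show ?case using hp_cmult[of _ _ c] by (simp add: mult.left_commute)
  qed (auto simp: algebra_simps intro: hp_add)
next
  case (cmult f c)
  then show ?case using hp_cmult[of _ _ c] by (simp add: mult.assoc)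
qed (auto simp: algebra_simps intro: hp_add)

lemma hp_const [simp]: "hp 0 (\<lambda>x::real^'n::finite. c)"
  using hp_cmult[OF hp_monomial[of "\<lambda>_. 0" 0], of c] by (simp add: multi_power_def)

lemma hp_power: "hp m f \<Longrightarrow> hp (k * m) (\<lambda>x::real^'n::finite. f x ^ k)"
  by (induction k) (auto intro: hp_mult)

lemma multi_power_unit: "multi_power x (\<lambda>j. of_bool (j = i)) = of_real (x $ i)"
  unfolding multi_power_def by (subst prod.remove[of _ i]) auto

lemma hp_coord [simp]: "hp 1 (\<lambda>x::real^'n::finite. of_real (x $ i))"
  using hp_monomial[of "\<lambda>j. of_bool (j = i)" 1] by (simp add: multi_power_unit)

lemma hp_scale:
  assumes "hp m q" shows "q (s *\<^sub>R x) = of_real s ^ m * q (x::real^'n::finite)"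
  using assms
proof (induction rule: hp_induct)
  case (monomial \<alpha>)
  then show ?case by (auto simp: multi_power_def power_mult_distrib prod.distrib simp flip: power_sum)
qed (auto simp: algebra_simps)

lemma continuous_on_hp:
  assumes "hp m q" shows "continuous_on A (q :: real^'n::finite \<Rightarrow> complex)"
  using assms
  by (induction rule: hp_induct) (auto simp: multi_power_def intro!: continuous_intros)

subsection \<open>Partial derivatives\<close>

definition has_partial :: "'n::finite \<Rightarrow> (real^'n \<Rightarrow> complex) \<Rightarrow> complex \<Rightarrow> real^'n \<Rightarrow> bool"
  where "has_partial i u d x \<longleftrightarrow> ((\<lambda>t. u (x + t *\<^sub>R axis i 1)) has_vector_derivative d) (at 0)"

lemma partial_derivative_eqI: "has_partial i u d x \<Longrightarrow> partial_derivative i u x = d"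
  unfolding has_partial_def partial_derivative_def by (rule vector_derivative_at)

lemma has_partial_add: "has_partial i f a x \<Longrightarrow> has_partial i g b x \<Longrightarrow> has_partial i (\<lambda>x. f x + g x) (a + b) x"
  unfolding has_partial_def by (rule has_vector_derivative_add)

lemma has_partial_cmult: "has_partial i f a x \<Longrightarrow> has_partial i (\<lambda>x. k * f x) (k * a) x"
  unfolding has_partial_def by (rule has_vector_derivative_mult_right)

lemma has_partial_mult: "has_partial i f a x \<Longrightarrow> has_partial i g b x \<Longrightarrow>
    has_partial i (\<lambda>x. f x * g x) (a * g x + f x * b) x"
  unfolding has_partial_def
  by (drule (1) has_vector_derivative_mult) (simp add: add.commute)

lemma has_partial_const [simp]: "has_partial i (\<lambda>x. c) 0 x"
  unfolding has_partial_def by simp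

lemma has_partial_sum: "(\<And>k. k \<in> A \<Longrightarrow> has_partial i (f k) (f' k) x) \<Longrightarrow>
    has_partial i (\<lambda>x. \<Sum>k\<in>A. f k x) (\<Sum>k\<in>A. f' k) x"
  unfolding has_partial_def by (rule has_vector_derivative_sum)

lemma multi_power_shift:
  "multi_power (x + t *\<^sub>R axis i 1) \<alpha> =
     (\<Prod>j\<in>UNIV - {i}. of_real (x $ j) ^ \<alpha> j) * (of_real (x $ i) + of_real t) ^ \<alpha> i"
proof -
  have "multi_power (x + t *\<^sub>R axis i 1) \<alpha> =
     (of_real (x $ i + t)) ^ \<alpha> i * (\<Prod>j\<in>UNIV - {i}. of_real ((x + t *\<^sub>R axis i 1) $ j) ^ \<alpha> j)"
    unfolding multi_power_def by (subst prod.remove[of _ i]) (auto simp: axis_def)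
  also have "(\<Prod>j\<in>UNIV - {i}. complex_of_real ((x + t *\<^sub>R axis i 1) $ j) ^ \<alpha> j) =
      (\<Prod>j\<in>UNIV - {i}. of_real (x $ j) ^ \<alpha> j)"
    by (intro prod.cong) (auto simp: axis_def)
  finally show ?thesis by (simp add: mult.commute)
qed

lemma has_partial_monomial:
  "has_partial i (\<lambda>x. multi_power x \<alpha>) (of_nat (\<alpha> i) * multi_power x (\<alpha>(i := \<alpha> i - 1))) x"
proof -
  let ?C = "\<Prod>j\<in>UNIV - {i}. complex_of_real (x $ j) ^ \<alpha> j"
  have "((\<lambda>z. ?C * (of_real (x $ i) + z) ^ \<alpha> i) has_field_derivative
          ?C * (of_nat (\<alpha> i) * of_real (x $ i) ^ (\<alpha> i - 1))) (at (of_real 0))"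
    by (auto intro!: derivative_eq_intros)
  from has_vector_derivative_real_field[OF this]
  have "((\<lambda>t. multi_power (x + t *\<^sub>R axis i 1) \<alpha>) has_vector_derivative
      ?C * (of_nat (\<alpha> i) * of_real (x $ i) ^ (\<alpha> i - 1))) (at 0)"
    by (simp add: multi_power_shift)
  also have "?C * (of_nat (\<alpha> i) * of_real (x $ i) ^ (\<alpha> i - 1)) =
      of_nat (\<alpha> i) * multi_power x (\<alpha>(i := \<alpha> i - 1))"
    unfolding multi_power_def by (subst (2) prod.remove[of _ i]) auto
  finally show ?thesis unfolding has_partial_def .
qed

lemma partial_monomial:
  "partial_derivative i (\<lambda>x. multi_power x \<alpha>) = (\<lambda>x. of_nat (\<alpha> i) * multi_power x (\<alpha>(i := \<alpha> i - 1)))"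
  using partial_derivative_eqI[OF has_partial_monomial] by blast

lemma has_partial_hp:
  assumes "hp m q" shows "has_partial i q (partial_derivative i q x) x"
proof -
  have "\<exists>d. has_partial i q d x"
    using assms by (induction rule: hp_induct)
      (blast intro: has_partial_monomial has_partial_const has_partial_add has_partial_cmult)+
  then show ?thesis using partial_derivative_eqI by metis
qed

lemma partial_add: "hp m f \<Longrightarrow> hp k g \<Longrightarrow>
    partial_derivative i (\<lambda>x. f x + g x) = (\<lambda>x. partial_derivative i f x + partial_derivative i g x)"
  by (rule ext, rule partial_derivative_eqI, rule has_partial_add) (auto intro: has_partial_hp)

lemma partial_cmult: "hp m f \<Longrightarrow>
    partial_derivative i (\<lambda>x. c * f x) = (\<lambda>x. c * partial_derivative i f x)"
  by (rule ext, rule partial_derivative_eqI, rule has_partial_cmult) (auto intro: has_partial_hp)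

lemma partial_mult: "hp m f \<Longrightarrow> hp k g \<Longrightarrow> partial_derivative i (\<lambda>x. f x * g x) =
    (\<lambda>x. partial_derivative i f x * g x + f x * partial_derivative i g x)"
  by (rule ext, rule partial_derivative_eqI, rule has_partial_mult) (auto intro: has_partial_hp)

lemma partial_const [simp]: "partial_derivative i (\<lambda>x. c) = (\<lambda>x. 0)"
  by (rule ext, rule partial_derivative_eqI) simp

lemma partial_sum: "(\<And>k. k \<in> A \<Longrightarrow> hp m (f k)) \<Longrightarrow> partial_derivative i (\<lambda>x. \<Sum>k\<in>A. f k x) =
    (\<lambda>x. \<Sum>k\<in>A. partial_derivative i (f k) x)"
  by (rule ext, rule partial_derivative_eqI, rule has_partial_sum) (auto intro: has_partial_hp)

lemma partial_coord: "partial_derivative i (\<lambda>x. of_real (x $ j)) = (\<lambda>x. of_bool (i = j))"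
  using partial_monomial[of i "\<lambda>k. of_bool (k = j)"]
  by (auto simp: multi_power_unit fun_eq_iff multi_power_def intro!: prod.neutral)

lemma partial_hp_0: "hp 0 q \<Longrightarrow> partial_derivative i q = (\<lambda>x. 0)"
proof (induction rule: hp_induct)
  case (monomial \<alpha>)
  then show ?case by (simp add: partial_monomial)
qed (simp_all add: partial_add partial_cmult)

lemma sum_update_pred:
  fixes \<alpha> :: "'n::finite \<Rightarrow> nat"
  assumes "sum \<alpha> UNIV = m" "\<alpha> i \<noteq> 0"
  shows "sum (\<alpha>(i := \<alpha> i - 1)) UNIV = m - 1"
  using assms by (subst (asm) sum.remove[of _ i], simp, simp, subst sum.remove[of _ i]) auto

lemma hp_partial: "hp m q \<Longrightarrow> hp (m - 1) (partial_derivative i q)"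
proof (induction rule: hp_induct)
  case (monomial \<alpha>)
  show ?case
  proof (cases "\<alpha> i = 0")
    case False
    then show ?thesis unfolding partial_monomial
      by (intro hp_cmult hp_monomial sum_update_pred monomial)
  qed (simp add: partial_monomial)
qed (auto simp: partial_add partial_cmult intro: hp_add hp_cmult)

lemma partial_commute:
  assumes "hp m q"
  shows "partial_derivative i (partial_derivative j q) = partial_derivative j (partial_derivative i q)"
  using assms
proof (induction rule: hp_induct)
  case (monomial \<alpha>)
  show ?case
    by (cases "i = j") (auto simp: partial_monomial partial_cmult[OF hp_monomial[OF refl]] fun_upd_twist)
qed (simp_all add: partial_add[OF hp_partial hp_partial] partial_add partial_cmult[OF hp_partial] partial_cmult)

lemma euler_identity:
  assumes "hp m q"
  shows "(\<Sum>i\<in>UNIV. of_real (x $ i) * partial_derivative i q x) = of_nat m * q (x::real^'n::finite)"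
  using assms
proof (induction rule: hp_induct)
  case (monomial \<alpha>)
  have "of_real (x $ i) * partial_derivative i (\<lambda>x. multi_power x \<alpha>) x = of_nat (\<alpha> i) * multi_power x \<alpha>" for i
  proof (cases "\<alpha> i")
    case (Suc k)
    have "of_real (x $ i) * multi_power x (\<alpha>(i := \<alpha> i - 1)) = multi_power x \<alpha>"
      unfolding multi_power_def using Suc
      by (subst (1 2) prod.remove[of _ i]) auto
    then show ?thesis by (simp add: partial_monomial mult.left_commute)
  qed (simp add: partial_monomial)
  then show ?case using monomial
    by (simp flip: sum_distrib_right of_nat_sum)
qed (simp_all add: partial_add partial_cmult algebra_simps sum.distrib flip: sum_distrib_left)

subsection \<open>The Laplacian of polynomials\<close>

lemma hp_partial2: "hp m q \<Longrightarrow> hp (m - 2) (partial_derivative i (partial_derivative j q))"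
  using hp_partial[OF hp_partial, of m q i j] by (simp add: numeral_2_eq_2)

lemma hp_laplacian: "hp m q \<Longrightarrow> hp (m - 2) (laplacian q)"
  unfolding laplacian_def[abs_def] by (intro hp_sum hp_partial2)

lemma laplacian_hp_low:
  assumes "hp m q" "m < 2" shows "laplacian q = (\<lambda>x. 0)"
proof -
  have "hp 0 (partial_derivative i q)" for i
    using hp_partial[OF assms(1), of i] assms(2) by (cases m) auto
  then show ?thesis unfolding laplacian_def[abs_def] by (simp add: partial_hp_0)
qed

lemma laplacian_add: "hp m f \<Longrightarrow> hp k g \<Longrightarrow>
    laplacian (\<lambda>x. f x + g x) = (\<lambda>x. laplacian f x + laplacian g x)"
  by (simp add: laplacian_def[abs_def] partial_add partial_add[OF hp_partial hp_partial] sum.distrib)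

lemma laplacian_cmult: "hp m f \<Longrightarrow> laplacian (\<lambda>x. c * f x) = (\<lambda>x. c * laplacian f x)"
  by (simp add: laplacian_def[abs_def] partial_cmult partial_cmult[OF hp_partial] sum_distrib_left)

lemma laplacian_zero [simp]: "laplacian (\<lambda>x. c) = (\<lambda>x. 0)"
  by (simp add: laplacian_def[abs_def])

lemma laplacian_mult:
  assumes "hp m f" "hp k g"
  shows "laplacian (\<lambda>x. f x * g x) = (\<lambda>x. laplacian f x * g x + f x * laplacian g x +
           2 * (\<Sum>i\<in>UNIV. partial_derivative i f x * partial_derivative i g x))"
proof -
  note [simp] = assms hp_partial[OF assms(1)] hp_partial[OF assms(2)]
  have "partial_derivative i (partial_derivative i (\<lambda>x. f x * g x)) =
    (\<lambda>x. partial_derivative i (partial_derivative i f) x * g x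
      + f x * partial_derivative i (partial_derivative i g) x
      + 2 * (partial_derivative i f x * partial_derivative i g x))" for i
  proof -
    have "partial_derivative i (partial_derivative i (\<lambda>x. f x * g x)) =
       partial_derivative i (\<lambda>x. partial_derivative i f x * g x + f x * partial_derivative i g x)"
      by (subst partial_mult[OF assms]) simp
    also have "\<dots> = (\<lambda>x. partial_derivative i (\<lambda>x. partial_derivative i f x * g x) x +
        partial_derivative i (\<lambda>x. f x * partial_derivative i g x) x)"
      by (rule partial_add[OF hp_mult[OF hp_partial[OF assms(1)] assms(2)]
            hp_mult[OF assms(1) hp_partial[OF assms(2)]]])
    finally show ?thesis
      unfolding partial_mult[OF hp_partial[OF assms(1)] assms(2)]
        partial_mult[OF assms(1) hp_partial[OF assms(2)]] by (simp add: fun_eq_iff algebra_simps)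
  qed
  then show ?thesis
    by (simp add: laplacian_def[abs_def] sum.distrib sum_distrib_left sum_distrib_right)
qed

definition sqnorm :: "real^'n::finite \<Rightarrow> complex" where "sqnorm x = of_real ((norm x)\<^sup>2)"

lemma sqnorm_eq: "sqnorm x = (\<Sum>i\<in>UNIV. of_real (x $ i) * of_real (x $ i))"
  by (simp add: sqnorm_def norm_vec_def L2_set_def sum_nonneg power2_eq_square)

lemma hp_sqnorm [simp]: "hp 2 sqnorm"
  unfolding sqnorm_eq[abs_def] using hp_mult[OF hp_coord hp_coord] by (intro hp_sum) (simp add: numeral_2_eq_2)

lemma hp_sqnorm_power: "hp m f \<Longrightarrow> hp (m + 2 * k) (\<lambda>x. sqnorm x ^ k * f x)"
  using hp_mult[OF hp_power[OF hp_sqnorm, of k]] by (simp add: mult.commute add.commute)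

lemma partial_sqnorm: "partial_derivative i sqnorm = (\<lambda>x. 2 * of_real (x $ i))"
proof -
  have "partial_derivative i sqnorm =
      (\<lambda>x. \<Sum>j\<in>UNIV. partial_derivative i (\<lambda>x. of_real (x $ j) * of_real (x $ j)) x)"
    unfolding sqnorm_eq[abs_def] using hp_mult[OF hp_coord hp_coord] by (rule partial_sum)
  then show ?thesis
    by (simp add: partial_mult[OF hp_coord hp_coord] partial_coord fun_eq_iff sum.distrib
        of_bool_def if_distrib if_distribR cong: if_cong)
qed

lemma laplacian_sqnorm: "laplacian (sqnorm :: real^'n::finite \<Rightarrow> _) = (\<lambda>x. 2 * of_nat CARD('n))"
  by (simp add: laplacian_def[abs_def] partial_sqnorm partial_cmult[OF hp_coord] partial_coord mult.commute)

text \<open>The cross term of the product rule is \<open>4 x \<cdot> \<nabla>f\<close>, which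
  Euler's identity evaluates.\<close>

lemma laplacian_sqnorm_mult:
  fixes f :: "real^'n::finite \<Rightarrow> complex"
  assumes "hp d f"
  shows "laplacian (\<lambda>x. sqnorm x * f x) =
           (\<lambda>x. (2 * of_nat CARD('n) + 4 * of_nat d) * f x + sqnorm x * laplacian f x)"
proof
  fix x
  have "(\<Sum>i\<in>UNIV. 2 * of_real (x $ i) * partial_derivative i f x) = 2 * (of_nat d * f x)"
    unfolding euler_identity[OF assms, symmetric] by (simp add: sum_distrib_left mult.assoc)
  then show "laplacian (\<lambda>x. sqnorm x * f x) x =
     (2 * of_nat CARD('n) + 4 * of_nat d) * f x + sqnorm x * laplacian f x"
    unfolding laplacian_mult[OF hp_sqnorm assms]
    by (simp add: laplacian_sqnorm partial_sqnorm algebra_simps)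
qed

definition harm :: "nat \<Rightarrow> (real^'n::finite \<Rightarrow> complex) \<Rightarrow> bool"
  where "harm m h \<longleftrightarrow> hp m h \<and> laplacian h = (\<lambda>x. 0)"

lemma harm_zero [simp]: "harm m (\<lambda>x. 0)"
  by (simp add: harm_def)

lemma harm_cmult: "harm m f \<Longrightarrow> harm m (\<lambda>x. c * f x)"
  by (auto simp: harm_def hp_cmult laplacian_cmult)

lemma laplacian_sqnorm_power:
  fixes g :: "real^'n::finite \<Rightarrow> complex"
  assumes "hp d g"
  shows "laplacian (\<lambda>x. sqnorm x ^ k * g x) =
    (\<lambda>x. of_real (2 * real k * (real CARD('n) + 2 * real k + 2 * real d - 2)) * (sqnorm x ^ (k - 1) * g x)
       + sqnorm x ^ k * laplacian g x)"
proof (induction k)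
  case (Suc k)
  have g: "hp (d + 2 * k) (\<lambda>x. sqnorm x ^ k * g x)"
    using assms by (rule hp_sqnorm_power)
  show ?case
  proof
    fix x :: "real^'n"
    have *: "of_nat k * (sqnorm x * sqnorm x ^ (k - 1)) = of_nat k * sqnorm x ^ k"
      by (cases k) auto
    have "laplacian (\<lambda>x. sqnorm x ^ Suc k * g x) x = laplacian (\<lambda>x. sqnorm x * (sqnorm x ^ k * g x)) x"
      by (simp add: mult.assoc)
    also have "\<dots> = (2 * of_nat CARD('n) + 4 * of_nat (d + 2 * k)) * (sqnorm x ^ k * g x) +
        (of_nat k * (sqnorm x * sqnorm x ^ (k - 1))) * (2 * (of_nat CARD('n) + 2 * of_nat k + 2 * of_nat d - 2) * g x)
          + sqnorm x ^ Suc k * laplacian g x"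
      unfolding laplacian_sqnorm_mult[OF g] Suc by (simp add: algebra_simps)
    also have "\<dots> = of_real (2 * real (Suc k) * (real CARD('n) + 2 * real (Suc k) + 2 * real d - 2)) *
        (sqnorm x ^ (Suc k - 1) * g x) + sqnorm x ^ Suc k * laplacian g x"
      unfolding * by (simp add: algebra_simps)
    finally show "laplacian (\<lambda>x. sqnorm x ^ Suc k * g x) x =
        of_real (2 * real (Suc k) * (real CARD('n) + 2 * real (Suc k) + 2 * real d - 2)) * (sqnorm x ^ (Suc k - 1) * g x)
          + sqnorm x ^ Suc k * laplacian g x" .
  qed
qed simp

lemma laplacian_sqnorm_power_harm:
  fixes g :: "real^'n::finite \<Rightarrow> complex"
  assumes "harm d g"
  shows "laplacian (\<lambda>x. sqnorm x ^ k * g x) =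
    (\<lambda>x. of_real (2 * real k * (real CARD('n) + 2 * real k + 2 * real d - 2)) * (sqnorm x ^ (k - 1) * g x))"
  using laplacian_sqnorm_power[of d g k] assms by (simp add: harm_def)

lemma hp_laplacian_iter: "hp m q \<Longrightarrow> hp (m - 2 * k) ((laplacian ^^ k) q)"
proof (induction k)
  case (Suc k)
  then show ?case using hp_laplacian[of "m - 2 * k" "(laplacian ^^ k) q"] by simp
qed simp

lemma laplacian_iter_add: "hp m f \<Longrightarrow> hp k g \<Longrightarrow>
    (laplacian ^^ p) (\<lambda>x. f x + g x) = (\<lambda>x. (laplacian ^^ p) f x + (laplacian ^^ p) g x)"
  by (induction p) (simp_all add: laplacian_add[OF hp_laplacian_iter hp_laplacian_iter])

lemma laplacian_iter_cmult: "hp m f \<Longrightarrow>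
    (laplacian ^^ p) (\<lambda>x. c * f x) = (\<lambda>x. c * (laplacian ^^ p) f x)"
  by (induction p) (simp_all add: laplacian_cmult[OF hp_laplacian_iter])

lemma laplacian_iter_zero [simp]: "(laplacian ^^ p) (\<lambda>x. 0) = (\<lambda>x. 0)"
  by (induction p) simp_all

lemma laplacian_iter_sum: "(\<And>i. i \<in> I \<Longrightarrow> hp m (f i)) \<Longrightarrow>
    (laplacian ^^ p) (\<lambda>x. \<Sum>i\<in>I. f i x) = (\<lambda>x. \<Sum>i\<in>I. (laplacian ^^ p) (f i) x)"
proof (induction I rule: infinite_finite_induct)
  case (insert i I)
  then show ?case by (simp add: laplacian_iter_add[of m _ m] hp_sum)
qed simp_all

text \<open>Each Laplacian removes one factor \<open>|x|\<^sup>2\<close> at the price of a positive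
  constant. That the constants do not vanish lets the Almansi decomposition divide by them.\<close>

lemma laplacian_iter_sqnorm_power:
  fixes g :: "real^'n::finite \<Rightarrow> complex"
  assumes "harm d g"
  shows "\<exists>C. C \<noteq> 0 \<and> (laplacian ^^ k) (\<lambda>x. sqnorm x ^ k * g x) = (\<lambda>x. C * g x)"
proof (induction k)
  case 0
  show ?case by (intro exI[of _ 1]) simp
next
  case (Suc k)
  then obtain C where C: "C \<noteq> 0" "(laplacian ^^ k) (\<lambda>x. sqnorm x ^ k * g x) = (\<lambda>x. C * g x)" by blast
  let ?c = "of_real (2 * real (Suc k) * (real CARD('n) + 2 * real (Suc k) + 2 * real d - 2)) :: complex"
  have "real CARD('n) > 0" by simp
  then have "real CARD('n) + 2 * real (Suc k) + 2 * real d - 2 > 0" by (simp del: zero_less_card_finite)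
  then have "?c \<noteq> 0" unfolding of_real_eq_0_iff by simp
  moreover have "(laplacian ^^ Suc k) (\<lambda>x. sqnorm x ^ Suc k * g x) = (\<lambda>x. (?c * C) * g x)"
    unfolding funpow_Suc_right comp_def laplacian_sqnorm_power_harm[OF assms] diff_Suc_1
    using C assms
    by (subst laplacian_iter_cmult) (auto simp: harm_def intro: hp_sqnorm_power)
  ultimately show ?case using C(1) by (intro exI[of _ "?c * C"]) auto
qed

lemma laplacian_iter_sqnorm_power_eq_0:
  fixes g :: "real^'n::finite \<Rightarrow> complex"
  assumes "harm d g" "k < p"
  shows "(laplacian ^^ p) (\<lambda>x. sqnorm x ^ k * g x) = (\<lambda>x. 0)"
proof -
  obtain C where C: "(laplacian ^^ k) (\<lambda>x. sqnorm x ^ k * g x) = (\<lambda>x. C * g x)"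
    using laplacian_iter_sqnorm_power[OF assms(1)] by blast
  have "(laplacian ^^ p) (\<lambda>x. sqnorm x ^ k * g x) =
      (laplacian ^^ (p - Suc k)) (laplacian ((laplacian ^^ k) (\<lambda>x. sqnorm x ^ k * g x)))"
    using assms(2) funpow_add[of "p - Suc k" "Suc k" "laplacian :: _ \<Rightarrow> real^'n \<Rightarrow> complex"]
    by (simp add: fun_eq_iff)
  then show ?thesis
    using assms(1) unfolding C by (simp add: laplacian_cmult[of d] harm_def)
qed

text \<open>The polynomial \<open>g = \<Delta>\<^sup>p q\<close> is harmonic when
  \<open>\<Delta>^(p+1) q = 0\<close>, and \<open>\<Delta>\<^sup>p\<close> maps
  \<open>|x|^(2p) g\<close> to a nonzero multiple of \<open>g\<close>. Subtracting a multiple of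
  \<open>|x|^(2p) g\<close> from \<open>q\<close> leaves a polynomial killed by
  \<open>\<Delta>\<^sup>p\<close>, to which induction on \<open>p\<close> applies.\<close>

lemma almansi_decomposition:
  fixes q :: "real^'n::finite \<Rightarrow> complex"
  assumes "hp m q" "(laplacian ^^ p) q = (\<lambda>x. 0)"
  shows "\<exists>h. (\<forall>j. harm (m - 2 * j) (h j)) \<and> q = (\<lambda>x. \<Sum>j | j < p \<and> 2 * j \<le> m. sqnorm x ^ j * h j x)"
  using assms
proof (induction p arbitrary: q)
  case 0
  then show ?case by (intro exI[of _ "\<lambda>_ _. 0"]) simp
next
  case (Suc p)
  let ?g = "(laplacian ^^ p) q"
  have g: "harm (m - 2 * p) ?g"
    using Suc.prems hp_laplacian_iter[of m q p] by (simp add: harm_def)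
  show ?case
  proof (cases "2 * p \<le> m")
    case True
    obtain C where C: "C \<noteq> 0" "(laplacian ^^ p) (\<lambda>x. sqnorm x ^ p * ?g x) = (\<lambda>x. C * ?g x)"
      using laplacian_iter_sqnorm_power[OF g] by blast
    let ?r = "\<lambda>x. q x + (- 1 / C) * (sqnorm x ^ p * ?g x)"
    have G: "hp m (\<lambda>x. sqnorm x ^ p * ?g x)"
      using hp_sqnorm_power[of "m - 2 * p" ?g p] g True by (simp add: harm_def)
    have "(laplacian ^^ p) ?r = (\<lambda>x. 0)"
      unfolding laplacian_iter_add[OF Suc.prems(1) hp_cmult[OF G]] laplacian_iter_cmult[OF G] C(2)
      using C(1) by simp
    moreover have "hp m ?r" by (intro hp_add hp_cmult G Suc.prems)
    ultimately obtain h where h: "\<And>j. harm (m - 2 * j) (h j)"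
      "?r = (\<lambda>x. \<Sum>j | j < p \<and> 2 * j \<le> m. sqnorm x ^ j * h j x)"
      using Suc.IH[of ?r] by blast
    have S: "{j. j < Suc p \<and> 2 * j \<le> m} = insert p {j. j < p \<and> 2 * j \<le> m}"
      using True by auto
    have "q x = (\<Sum>j | j < Suc p \<and> 2 * j \<le> m. sqnorm x ^ j * (h(p := \<lambda>x. (1 / C) * ?g x)) j x)" for x
    proof -
      have "q x = ?r x + (1 / C) * (sqnorm x ^ p * ?g x)" by simp
      also have "?r x = (\<Sum>j | j < p \<and> 2 * j \<le> m. sqnorm x ^ j * (h(p := \<lambda>x. (1 / C) * ?g x)) j x)"
        using fun_cong[OF h(2), of x] by (auto intro!: sum.cong)
      finally show ?thesis unfolding S by simp
    qed
    moreover have "harm (m - 2 * j) ((h(p := \<lambda>x. (1 / C) * ?g x)) j)" for j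
      by (cases "j = p") (use h(1) harm_cmult[OF g, of "1 / C"] in auto)
    ultimately show ?thesis by (intro exI[of _ "h(p := \<lambda>x. (1 / C) * ?g x)"]) blast
  next
    case False
    \<comment> \<open>there is no room for a factor \<open>|x|^(2p)\<close>, but then
      \<open>\<Delta>\<^sup>p q\<close> vanishes for reasons of degree\<close>
    have "?g = (\<lambda>x. 0)"
    proof (cases p)
      case (Suc p')
      have "hp (m - 2 * p') ((laplacian ^^ p') q)" using Suc.prems hp_laplacian_iter by blast
      then show ?thesis using False Suc laplacian_hp_low by force
    qed (use False in simp)
    then obtain h where h: "\<And>j. harm (m - 2 * j) (h j)"
      "q = (\<lambda>x. \<Sum>j | j < p \<and> 2 * j \<le> m. sqnorm x ^ j * h j x)"
      using Suc.IH[of q] Suc.prems by blast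
    moreover have "{j. j < Suc p \<and> 2 * j \<le> m} = {j. j < p \<and> 2 * j \<le> m}"
      using False less_Suc_eq by auto
    ultimately show ?thesis by (intro exI[of _ h]) simp
  qed
qed

section \<open>Integrals of polynomials over the ball\<close>

lemma gaussian_moments:
  fixes k :: nat
  shows "has_bochner_integral lborel (\<lambda>x::real. exp (- x\<^sup>2) * x ^ (2 * k))
            (sqrt pi * (fact (2 * k) / (2 ^ (2 * k) * fact k)))"
    and "has_bochner_integral lborel (\<lambda>x::real. exp (- x\<^sup>2) * x ^ (2 * k + 1)) 0"
  using has_bochner_integral_even_function[OF gaussian_moment_even_pos[of k]]
    has_bochner_integral_odd_function[OF gaussian_moment_odd_pos[of k]]
  by simp_all

definition gmoment :: "nat \<Rightarrow> real" where "gmoment a = (LINT x|lborel. exp (- x\<^sup>2) * x ^ a)"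

lemma integrable_gmoment: "integrable lborel (\<lambda>x::real. exp (- x\<^sup>2) * x ^ a)"
proof (cases "even a")
  case True
  then obtain k where "a = 2 * k" by (elim evenE)
  then show ?thesis using gaussian_moments(1)[of k] by (simp add: has_bochner_integral_iff)
next
  case False
  then obtain k where "a = 2 * k + 1" by (elim oddE)
  then show ?thesis using gaussian_moments(2)[of k] by (simp add: has_bochner_integral_iff)
qed

lemma gmoment_0: "gmoment 0 = sqrt pi"
  using gaussian_moments(1)[of 0] by (simp add: has_bochner_integral_iff gmoment_def)

lemma gmoment_Suc: "gmoment (Suc a) = of_nat a / 2 * gmoment (a - 1)"
proof (cases "even a")
  case True
  then obtain k where a: "a = 2 * k" by (elim evenE)
  have "gmoment (Suc a) = 0"
    using gaussian_moments(2)[of k] by (simp add: has_bochner_integral_iff gmoment_def a)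
  moreover have "of_nat a * gmoment (a - 1) = 0"
  proof (cases k)
    case (Suc j)
    then have "a - 1 = 2 * j + 1" using a by simp
    then show ?thesis using gaussian_moments(2)[of j] by (simp add: has_bochner_integral_iff gmoment_def)
  qed (simp add: a)
  ultimately show ?thesis by simp
next
  case False
  then obtain k where a: "a = 2 * k + 1" by (elim oddE)
  have "gmoment (2 * j) = sqrt pi * (fact (2 * j) / (2 ^ (2 * j) * fact j))" for j
    using gaussian_moments(1)[of j] by (simp add: has_bochner_integral_iff gmoment_def)
  note even = this
  have "gmoment (2 * Suc k) = sqrt pi * (2 * (1 + real k) * (2 * k + 1) * fact (2 * k) / (4 * 2 ^ (2 * k) * ((1 + real k) * fact k)))"
    unfolding even by (simp add: algebra_simps)
  also have "\<dots> = (2 * k + 1) / 2 * gmoment (2 * k)"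
  proof -
    have "sqrt pi * (2 * K * c * A / (4 * B * (K * C))) = c / 2 * (sqrt pi * (A / (B * C)))"
      if "K \<noteq> 0" for K c A B C :: real using that by simp
    from this[of "1 + real k" "2 * k + 1" "fact (2 * k)" "2 ^ (2 * k)" "fact k"] show ?thesis
      unfolding even by simp
  qed
  finally show ?thesis by (simp add: a)
qed

text \<open>Lebesgue measure on a Euclidean space is the product measure over its basis, and the
  basis of \<open>real^'n\<close> is indexed by \<open>'n\<close> through \<open>axis\<close>.\<close>

lemma lborel_integral_coord_prod:
  fixes f :: "'n::finite \<Rightarrow> real \<Rightarrow> complex"
  assumes f: "\<And>i. integrable lborel (f i)"
  shows "integrable lborel (\<lambda>x::real^'n. \<Prod>i\<in>UNIV. f i (x $ i))" (is ?A)
    and "(LINT x|lborel. (\<Prod>i\<in>UNIV. f i ((x::real^'n) $ i))) = (\<Prod>i\<in>UNIV. LINT t|lborel. f i t)" (is ?B)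
proof -
  interpret product_sigma_finite "\<lambda>_::real^'n. lborel::real measure" by standard
  define ax where "ax = (\<lambda>i. axis i 1 :: real^'n)"
  have inj: "inj ax" by (auto simp: ax_def inj_def axis_eq_axis)
  have B: "Basis = range ax" by (auto simp: ax_def Basis_vec_def)
  define F where "F = (\<lambda>b. f (inv ax b))"
  have F: "F (ax i) = f i" for i using inj by (simp add: F_def)
  let ?P = "\<Pi>\<^sub>M b\<in>(Basis :: (real^'n) set). (lborel :: real measure)"
  let ?g = "\<lambda>h. \<Sum>b\<in>(Basis :: (real^'n) set). h b *\<^sub>R b"
  have [measurable]: "f i \<in> borel_measurable borel" for i using f[of i] by simp
  have m: "(\<lambda>x::real^'n. \<Prod>i\<in>UNIV. f i (x $ i)) \<in> borel_measurable borel"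
    by measurable
  have g: "?g \<in> ?P \<rightarrow>\<^sub>M borel" by measurable
  have eq: "(\<Prod>i\<in>UNIV. f i (?g h $ i)) = (\<Prod>b\<in>Basis. F b (h b))" for h
  proof -
    have "?g h $ i = h (ax i)" for i
    proof -
      have "?g h $ i = ?g h \<bullet> ax i" by (simp add: ax_def inner_axis)
      also have "\<dots> = h (ax i)" by (rule inner_sum_left_Basis) (simp add: B)
      finally show ?thesis .
    qed
    then have "(\<Prod>i\<in>UNIV. f i (?g h $ i)) = (\<Prod>i\<in>UNIV. F (ax i) (h (ax i)))" by (simp add: F)
    also have "\<dots> = (\<Prod>b\<in>Basis. F b (h b))"
      unfolding B using inj by (subst prod.reindex) auto
    finally show ?thesis .
  qed
  have Fi: "integrable lborel (F b)" if "b \<in> Basis" for b using that f by (auto simp: B F)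
  show ?A
    by (subst lborel_eq, unfold integrable_distr_eq[OF g m] eq)
       (rule product_integrable_prod[OF finite_Basis Fi])
  show ?B
  proof -
    have "(LINT x|lborel. (\<Prod>i\<in>UNIV. f i ((x::real^'n) $ i))) = (LINT h|?P. (\<Prod>b\<in>Basis. F b (h b)))"
      by (subst lborel_eq, unfold integral_distr[OF g m] eq) (rule refl)
    also have "\<dots> = (\<Prod>b\<in>Basis. LINT t|lborel. F b t)"
      by (rule product_integral_prod[OF finite_Basis]) (rule Fi)
    finally show ?thesis by (simp add: B prod.reindex[OF inj] F)
  qed
qed

text \<open>Integration against the Gaussian weight \<open>exp (-|x|\<^sup>2)\<close>: all
  polynomials are integrable on the whole space, so there are no boundary terms. On homogeneous
  polynomials of a fixed degree the functional is a multiple of integration over the unit ball.\<close>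

definition gint :: "(real^'n::finite \<Rightarrow> complex) \<Rightarrow> complex"
  where "gint q = (LINT x|lborel. of_real (exp (- (norm x)\<^sup>2)) * q x)"

lemma gauss_monomial_prod:
  "of_real (exp (- (norm x)\<^sup>2)) * multi_power x \<alpha> =
     (\<Prod>i\<in>UNIV. complex_of_real (exp (- (x $ i)\<^sup>2) * (x $ i) ^ \<alpha> i))"
proof -
  have "exp (- (norm x)\<^sup>2) = (\<Prod>i\<in>UNIV. exp (- (x $ i)\<^sup>2))"
    by (simp add: norm_vec_def L2_set_def sum_nonneg exp_sum flip: sum_negf)
  then show ?thesis by (simp add: multi_power_def prod.distrib)
qed

lemma gint_monomial: "gint (\<lambda>x. multi_power x \<alpha>) = (\<Prod>i\<in>UNIV. of_real (gmoment (\<alpha> i)))"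
  unfolding gint_def gauss_monomial_prod
  by (subst lborel_integral_coord_prod)
     (simp_all only: complex_of_real_integrable_eq integrable_gmoment integral_complex_of_real gmoment_def)

lemma integrable_gint:
  assumes "hp m q" shows "integrable lborel (\<lambda>x. of_real (exp (- (norm x)\<^sup>2)) * q x)"
  using assms
proof (induction rule: hp_induct)
  case (monomial \<alpha>)
  show ?case unfolding gauss_monomial_prod
    by (rule lborel_integral_coord_prod) (simp only: complex_of_real_integrable_eq integrable_gmoment)
qed (simp_all add: algebra_simps mult.left_commute)

lemma gint_add: "hp m f \<Longrightarrow> hp k g \<Longrightarrow> gint (\<lambda>x. f x + g x) = gint f + gint g"
  by (simp add: gint_def distrib_left integrable_gint)

lemma gint_cmult: "gint (\<lambda>x. c * f x) = c * gint f"
  by (simp add: gint_def mult.left_commute[of _ c])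

lemma gint_zero [simp]: "gint (\<lambda>x. 0) = 0"
  by (simp add: gint_def)

lemma gint_sum: "(\<And>i. i \<in> I \<Longrightarrow> hp m (f i)) \<Longrightarrow> gint (\<lambda>x. \<Sum>i\<in>I. f i x) = (\<Sum>i\<in>I. gint (f i))"
  by (induction I rule: infinite_finite_induct) (simp_all add: gint_add[of m _ m] hp_sum)

text \<open>The gradient of the weight is \<open>-2x\<close> times the weight. On monomials the
  identity is the recursion of the one-dimensional moments.\<close>

lemma gint_by_parts:
  assumes "hp m q"
  shows "gint (\<lambda>x. of_real (x $ i) * q x) = 1 / 2 * gint (partial_derivative i q)"
  using assms
proof (induction rule: hp_induct)
  case (monomial \<alpha>)
  have "multi_power x (\<lambda>j. of_bool (j = i) + \<alpha> j) = of_real (x $ i) * multi_power x \<alpha>" for x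
    using multi_power_add[of x "\<lambda>j. of_bool (j = i)" \<alpha>] by (simp add: multi_power_unit)
  then have "gint (\<lambda>x. of_real (x $ i) * multi_power x \<alpha>) =
      (\<Prod>j\<in>UNIV. of_real (gmoment (of_bool (j = i) + \<alpha> j)))"
    using gint_monomial[of "\<lambda>j. of_bool (j = i) + \<alpha> j"] by simp
  also have "\<dots> = of_real (gmoment (Suc (\<alpha> i))) * (\<Prod>j\<in>UNIV - {i}. of_real (gmoment (\<alpha> j)))"
    by (subst prod.remove[of _ i]) auto
  also have "\<dots> = 1 / 2 * (of_nat (\<alpha> i) * (of_real (gmoment (\<alpha> i - 1)) * (\<Prod>j\<in>UNIV - {i}. of_real (gmoment (\<alpha> j)))))"
    by (simp add: gmoment_Suc)
  also have "of_real (gmoment (\<alpha> i - 1)) * (\<Prod>j\<in>UNIV - {i}. of_real (gmoment (\<alpha> j))) =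
      (\<Prod>j\<in>UNIV. complex_of_real (gmoment ((\<alpha>(i := \<alpha> i - 1)) j)))"
    by (subst (2) prod.remove[of _ i]) auto
  finally show ?case
    by (simp add: partial_monomial gint_cmult gint_monomial)
next
  case (add f g)
  show ?case
    unfolding partial_add[OF add.hyps] distrib_left gint_add[OF hp_mult[OF hp_coord add.hyps(1)] hp_mult[OF hp_coord add.hyps(2)]]
      gint_add[OF hp_partial[OF add.hyps(1)] hp_partial[OF add.hyps(2)]] add.IH ..
next
  case (cmult f k)
  then show ?case by (simp add: partial_cmult gint_cmult mult.left_commute[of _ k])
qed simp

subsection \<open>From Gaussian integrals to integrals over the unit ball\<close>

lemma lborel_integral_scale:
  fixes f :: "'a::euclidean_space \<Rightarrow> complex"
  assumes "f \<in> borel_measurable borel" "c > 0"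
  shows "(LINT x|lborel. f x) = of_real (c ^ DIM('a)) * (LINT x|lborel. f (c *\<^sub>R x))"
  using assms
  by (subst lborel_affine[of c 0]) (simp_all add: integral_density integral_distr scaleR_conv_of_real)

definition bint :: "(real^'n::finite \<Rightarrow> complex) \<Rightarrow> complex"
  where "bint f = (LINT x:ball 0 1|lborel. f x)"

lemma set_integrable_cball:
  fixes f :: "'a::euclidean_space \<Rightarrow> complex"
  assumes "continuous_on (cball 0 1) f" shows "set_integrable lborel (ball 0 1) f"
  by (rule set_integrable_subset[OF borel_integrable_compact[OF compact_cball assms, folded set_integrable_def]])
     auto

lemma integral_ball_hp:
  fixes q :: "real^'n::finite \<Rightarrow> complex"
  assumes "hp m q" "r > 0"
  shows "(LINT x:ball 0 r|lborel. q x) = of_real (r ^ (CARD('n) + m)) * bint q"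
proof -
  have [measurable]: "q \<in> borel_measurable borel"
    using continuous_on_hp[OF assms(1), of UNIV] by (rule borel_measurable_continuous_onI)
  have [measurable]: "(\<lambda>x. indicat_real (ball 0 r) x *\<^sub>R q x) \<in> borel_measurable borel"
    by (intro borel_measurable_scaleR borel_measurable_indicator) auto
  have "(LINT x:ball 0 r|lborel. q x) =
     of_real (r ^ CARD('n)) * (LINT x|lborel. indicator (ball 0 r) (r *\<^sub>R x) *\<^sub>R q (r *\<^sub>R x))"
    unfolding set_lebesgue_integral_def using assms(2) by (subst lborel_integral_scale[of _ r]) auto
  also have "(\<lambda>x. indicator (ball 0 r) (r *\<^sub>R x) *\<^sub>R q (r *\<^sub>R x)) =
      (\<lambda>x. of_real (r ^ m) * (indicator (ball 0 1) x *\<^sub>R q x))"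
    using assms by (auto simp: indicator_def hp_scale)
  also have "(LINT x|lborel. of_real (r ^ m) * (indicator (ball 0 1) x *\<^sub>R q x)) = of_real (r ^ m) * bint q"
    unfolding bint_def set_lebesgue_integral_def by (rule integral_mult_right_zero)
  finally show ?thesis by (simp add: power_add)
qed

lemma has_bochner_integral_exp_tail:
  "has_bochner_integral lborel (\<lambda>s::real. indicator {a<..} s * exp (- s)) (exp (- a))"
proof (rule has_bochner_integral_nn_integral)
  have "(\<integral>\<^sup>+ s. ennreal (indicator {a<..} s * exp (- s)) \<partial>lborel) =
      (\<integral>\<^sup>+ s. ennreal (exp (- s)) * indicator {a..} s \<partial>lborel)"
    using AE_lborel_singleton[of a]
    by (intro nn_integral_cong_AE) (auto elim!: eventually_mono simp: indicator_def)
  also have "\<dots> = ennreal (0 - (- exp (- a)))"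
  proof (rule nn_integral_FTC_atLeast)
    show "((\<lambda>s::real. - exp (- s)) \<longlongrightarrow> 0) at_top" by real_asymp
  qed (auto intro!: derivative_eq_intros)
  finally show "(\<integral>\<^sup>+ s. ennreal (indicator {a<..} s * exp (- s)) \<partial>lborel) = ennreal (exp (- a))" by simp
qed auto

lemma has_bochner_integral_Gamma:
  assumes "x > (0::real)"
  shows "has_bochner_integral lborel (\<lambda>s::real. indicator {0<..} s * (s powr (x - 1) * exp (- s))) (Gamma x)"
proof (rule has_bochner_integral_nn_integral)
  have "(\<integral>\<^sup>+ s. ennreal (indicator {0<..} s * (s powr (x - 1) * exp (- s))) \<partial>lborel) =
      (\<integral>\<^sup>+ s. ennreal (indicator {0..} s * s powr (x - 1) / exp s) \<partial>lborel)"
    using AE_lborel_singleton[of 0]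
    by (intro nn_integral_cong_AE) (auto elim!: eventually_mono simp: indicator_def exp_minus field_simps)
  also have "\<dots> = ennreal (Gamma x)"
    using Gamma_conv_nn_integral_real[OF assms] by simp
  finally show "(\<integral>\<^sup>+ s. ennreal (indicator {0<..} s * (s powr (x - 1) * exp (- s))) \<partial>lborel) = ennreal (Gamma x)" .
qed (use assms in auto)

text \<open>The weight \<open>exp (-|x|\<^sup>2)\<close> is the integral of \<open>exp (-s)\<close>
  over \<open>s > |x|\<^sup>2\<close>. Exchanging the two integrations leaves the integral of
  \<open>q\<close> over the ball of radius \<open>\<surd>s\<close>, which is proportional to
  \<open>s\<close> to the power \<open>(n + m) / 2\<close>, and the integral over \<open>s\<close>
  is a Gamma function.\<close>

lemma gint_eq_Gamma_times_bint:
  fixes q :: "real^'n::finite \<Rightarrow> complex"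
  assumes q: "hp m q"
  shows "gint q = of_real (Gamma ((CARD('n) + m) / 2 + 1)) * bint q"
proof -
  have [measurable]: "q \<in> borel_measurable borel"
    using continuous_on_hp[OF assms(1), of UNIV] by (rule borel_measurable_continuous_onI)
  define F where "F = (\<lambda>(x::real^'n) (s::real). q x * of_real (indicator {(norm x)\<^sup>2<..} s * exp (- s)))"
  have ind: "indicator {(norm x)\<^sup>2<..} s = (if (norm x)\<^sup>2 < s then 1 else 0 :: real)" for x :: "real^'n" and s
    by (simp add: indicator_def)
  have [measurable]: "case_prod F \<in> borel_measurable (lborel \<Otimes>\<^sub>M lborel)"
    unfolding F_def ind by measurable
  have inner: "has_bochner_integral lborel (F x) (q x * of_real (exp (- (norm x)\<^sup>2)))" for x
    unfolding F_def by (intro has_bochner_integral_mult_right has_bochner_integral_of_real has_bochner_integral_exp_tail)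
  have inner_norm: "(LINT s|lborel. norm (F x s)) = norm (q x) * exp (- (norm x)\<^sup>2)" for x
  proof -
    have "(\<lambda>s. norm (F x s)) = (\<lambda>s. norm (q x) * (indicator {(norm x)\<^sup>2<..} s * exp (- s)))"
      by (auto simp: F_def norm_mult indicator_def)
    then show ?thesis
      using has_bochner_integral_mult_right[OF has_bochner_integral_exp_tail, of "norm (q x)" "(norm x)\<^sup>2"]
      by (simp add: has_bochner_integral_iff)
  qed
  have int: "integrable (lborel \<Otimes>\<^sub>M lborel) (case_prod F)"
  proof (rule lborel_pair.Fubini_integrable)
    show "integrable lborel (\<lambda>x. LINT s|lborel. norm (case_prod F (x, s)))"
      using integrable_norm[OF integrable_gint[OF q]]
      by (simp add: inner_norm norm_mult mult.commute)
    show "AE x in lborel. integrable lborel (\<lambda>s. case_prod F (x, s))"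
      using inner by (auto simp: has_bochner_integral_iff)
  qed simp
  have outer: "(LINT x|lborel. F x s) =
      of_real (indicator {0<..} s * (s powr ((CARD('n) + m) / 2 + 1 - 1) * exp (- s))) * bint q" for s
  proof (cases "s > 0")
    case True
    have iff: "(norm x)\<^sup>2 < s \<longleftrightarrow> norm x < sqrt s" for x :: "real^'n"
      using real_sqrt_less_iff[of "(norm x)\<^sup>2" s] by simp
    have "(LINT x|lborel. F x s) = (LINT x|lborel. of_real (exp (- s)) * (indicator (ball 0 (sqrt s)) x *\<^sub>R q x))"
      by (intro Bochner_Integration.integral_cong) (auto simp: F_def indicator_def iff)
    also have "\<dots> = of_real (exp (- s)) * (LINT x:ball 0 (sqrt s)|lborel. q x)"
      unfolding set_lebesgue_integral_def by (rule integral_mult_right_zero)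
    also have "\<dots> = of_real (exp (- s)) * (of_real (sqrt s ^ (CARD('n) + m)) * bint q)"
      using integral_ball_hp[OF q, of "sqrt s"] True by simp
    also have "sqrt s ^ (CARD('n) + m) = s powr ((CARD('n) + m) / 2)"
      using True by (simp add: powr_half_sqrt[symmetric] powr_powr flip: powr_realpow)
    finally show ?thesis using True by simp
  next
    case False
    then have "F x s = 0" for x
      using zero_le_power2[of "norm x"] by (smt (verit) F_def indicator_simps greaterThan_iff mult_eq_0_iff of_real_0)
    then show ?thesis using False by simp
  qed
  have "gint q = (LINT x|lborel. LINT s|lborel. F x s)"
    unfolding gint_def using inner by (simp add: has_bochner_integral_iff mult.commute)
  also have "\<dots> = (LINT s|lborel. LINT x|lborel. F x s)"
    using lborel_pair.Fubini_integral[OF int] by simp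
  also have "\<dots> = of_real (Gamma ((CARD('n) + m) / 2 + 1)) * bint q"
  proof -
    have "(real CARD('n) + m) / 2 + 1 > 0"
      by (intro add_nonneg_pos) simp_all
    from has_bochner_integral_Gamma[OF this] show ?thesis
      unfolding outer of_nat_add
      by (subst integral_mult_left_zero, subst integral_complex_of_real) (simp only: has_bochner_integral_iff)
  qed
  finally show ?thesis .
qed

subsection \<open>Orthogonality of harmonic polynomials\<close>

definition cdot :: "real^'n::finite \<Rightarrow> real^'n \<Rightarrow> complex" where "cdot x b = of_real (x \<bullet> b)"

lemma cdot_eq: "cdot x b = (\<Sum>i\<in>UNIV. of_real (b $ i) * of_real (x $ i))"
  by (simp add: cdot_def inner_vec_def mult.commute)

lemma hp_cdot [simp]: "hp 1 (\<lambda>x. cdot x b)"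
  unfolding cdot_eq by (intro hp_sum hp_cmult hp_coord)

lemma hp_cdot_power: "hp k (\<lambda>x. cdot x b ^ k)"
  using hp_power[OF hp_cdot, of k b] by simp

lemma partial_cdot: "partial_derivative i (\<lambda>x. cdot x b) = (\<lambda>x. of_real (b $ i))"
proof -
  have "partial_derivative i (\<lambda>x. cdot x b) =
      (\<lambda>x. \<Sum>j\<in>UNIV. partial_derivative i (\<lambda>x. of_real (b $ j) * of_real (x $ j)) x)"
    unfolding cdot_eq by (rule partial_sum[of _ 1]) (intro hp_cmult hp_coord)
  then show ?thesis
    by (simp add: partial_cmult[OF hp_coord] partial_coord of_bool_def if_distrib cong: if_cong)
qed

lemma partial_cdot_power:
  "partial_derivative i (\<lambda>x. cdot x b ^ k) = (\<lambda>x. of_nat k * of_real (b $ i) * cdot x b ^ (k - 1))"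
proof (induction k)
  case (Suc k)
  have "of_nat k * (cdot x b * cdot x b ^ (k - 1)) = of_nat k * cdot x b ^ k" for x
    by (cases k) auto
  then show ?case
    using partial_mult[OF hp_cdot hp_cdot_power, of i b b k] Suc
    by (simp add: partial_cdot fun_eq_iff algebra_simps) (metis mult.left_commute)
qed simp

lemma laplacian_cdot_power:
  "laplacian (\<lambda>x. cdot x b ^ k) = (\<lambda>x. of_nat k * of_nat (k - 1) * sqnorm b * cdot x b ^ (k - 2))"
proof
  fix x
  have "partial_derivative i (partial_derivative i (\<lambda>x. cdot x b ^ k)) x =
      of_nat k * of_nat (k - 1) * cdot x b ^ (k - 2) * (of_real (b $ i) * of_real (b $ i))" for i
    unfolding partial_cdot_power
    by (subst partial_cmult[OF hp_cdot_power]) (simp add: partial_cdot_power numeral_2_eq_2)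
  then show "laplacian (\<lambda>x. cdot x b ^ k) x = of_nat k * of_nat (k - 1) * sqnorm b * cdot x b ^ (k - 2)"
    by (simp add: laplacian_def sqnorm_eq flip: sum_distrib_left)
qed

lemma laplacian_partial:
  fixes h :: "real^'n::finite \<Rightarrow> complex"
  assumes "hp m h" shows "laplacian (partial_derivative i h) = partial_derivative i (laplacian h)"
proof -
  have "partial_derivative i (laplacian h) =
      (\<lambda>x. \<Sum>j\<in>UNIV. partial_derivative i (partial_derivative j (partial_derivative j h)) x)"
    unfolding laplacian_def[abs_def] by (rule partial_sum[of _ "m - 2"]) (intro hp_partial2 assms)
  also have "\<dots> = laplacian (partial_derivative i h)"
    unfolding laplacian_def[abs_def]
    by (simp add: partial_commute[OF assms, of i] partial_commute[OF hp_partial[OF assms], of i])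
  finally show ?thesis by simp
qed

lemma harm_partial: "harm l h \<Longrightarrow> harm (l - 1) (partial_derivative i h)"
  using hp_partial[of l h i] by (auto simp: harm_def laplacian_partial)

lemma gint_euler:
  assumes "hp m q"
  shows "of_nat m * gint q = 1 / 2 * gint (laplacian q)"
proof -
  have "of_nat m * gint q = gint (\<lambda>x. \<Sum>i\<in>UNIV. of_real (x $ i) * partial_derivative i q x)"
    by (simp add: euler_identity[OF assms] gint_cmult)
  also have "\<dots> = (\<Sum>i\<in>UNIV. gint (\<lambda>x. of_real (x $ i) * partial_derivative i q x))"
    by (rule gint_sum[of _ "1 + (m - 1)"]) (intro hp_mult hp_coord hp_partial assms)
  also have "\<dots> = (\<Sum>i\<in>UNIV. 1 / 2 * gint (partial_derivative i (partial_derivative i q)))"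
    using gint_by_parts[OF hp_partial[OF assms]] by (intro sum.cong refl)
  also have "\<dots> = 1 / 2 * gint (laplacian q)"
    unfolding laplacian_def[abs_def] sum_distrib_left[symmetric]
    by (subst gint_sum) (auto intro: hp_partial2 assms)
  finally show ?thesis .
qed

lemma gint_coord_mult_prod:
  assumes "hp k f" "hp m g"
  shows "gint (\<lambda>x. of_real (x $ i) * (f x * g x)) =
    1 / 2 * (gint (\<lambda>x. partial_derivative i f x * g x) + gint (\<lambda>x. f x * partial_derivative i g x))"
  unfolding gint_by_parts[OF hp_mult[OF assms]] partial_mult[OF assms]
  by (subst gint_add[OF hp_mult[OF hp_partial[OF assms(1)] assms(2)] hp_mult[OF assms(1) hp_partial[OF assms(2)]]]) simp

lemma gint_sqnorm_mult:
  fixes f :: "real^'n::finite \<Rightarrow> complex"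
  assumes "hp d f"
  shows "gint (\<lambda>x. sqnorm x * f x) = of_real ((real CARD('n) + d) / 2) * gint f"
proof -
  have h: "hp (1 + (1 + d)) (\<lambda>x. of_real (x $ i) * (of_real (x $ i) * f x))" for i
    by (intro hp_mult hp_coord assms)
  have h': "hp (1 + (d - 1)) (\<lambda>x. of_real (x $ i) * partial_derivative i f x)" for i
    by (intro hp_mult hp_coord hp_partial assms)
  have "gint (\<lambda>x. sqnorm x * f x) = gint (\<lambda>x. \<Sum>i\<in>UNIV. of_real (x $ i) * (of_real (x $ i) * f x))"
    by (simp add: sqnorm_eq sum_distrib_right mult.assoc)
  also have "\<dots> = (\<Sum>i\<in>UNIV. gint (\<lambda>x. of_real (x $ i) * (of_real (x $ i) * f x)))"
    by (rule gint_sum[OF h])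
  also have "\<dots> = (\<Sum>i\<in>UNIV. 1 / 2 * (gint f + gint (\<lambda>x. of_real (x $ i) * partial_derivative i f x)))"
    by (simp add: gint_coord_mult_prod[OF hp_coord assms] partial_coord)
  also have "\<dots> = 1 / 2 * (of_nat CARD('n) * gint f + gint (\<lambda>x. \<Sum>i\<in>UNIV. of_real (x $ i) * partial_derivative i f x))"
    by (subst gint_sum[OF h']) (auto simp: sum.distrib simp flip: sum_distrib_left sum_divide_distrib)
  also have "\<dots> = of_real ((real CARD('n) + d) / 2) * gint f"
    unfolding euler_identity[OF assms] gint_cmult by (simp add: field_simps)
  finally show ?thesis .
qed

lemma hp_0_const: "hp 0 q \<Longrightarrow> q = (\<lambda>x. q 0)"
proof
  fix x
  assume "hp 0 q"
  then obtain c where c: "\<And>x. q x = (\<Sum>\<alpha> | sum \<alpha> UNIV = 0. c \<alpha> * multi_power x \<alpha>)"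
    unfolding homogeneous_polynomial_def by blast
  show "q x = q 0" unfolding c by (intro sum.cong) (auto simp: multi_power_def)
qed

text \<open>By Euler's identity \<open>d \<integral> q h\<close> is the sum of
  \<open>\<integral> x\<^sub>i (\<partial>\<^sub>i q) h\<close>. Integrating by parts produces
  \<open>(\<partial>\<^sub>i\<partial>\<^sub>i q) h\<close> and
  \<open>(\<partial>\<^sub>i q) (\<partial>\<^sub>i h)\<close>; in both, the first factor has
  smaller degree than \<open>q\<close> and still smaller degree than the harmonic second factor.\<close>

lemma gint_harm_orthogonal:
  fixes h q :: "real^'n::finite \<Rightarrow> complex"
  assumes "harm l h" "hp d q" "d < l"
  shows "gint (\<lambda>x. q x * h x) = 0"
  using assms
proof (induction d arbitrary: l h q rule: less_induct)
  case (less d)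
  have h: "hp l h" "laplacian h = (\<lambda>x. 0)" using less.prems by (auto simp: harm_def)
  show ?case
  proof (cases "d = 0")
    case True
    then obtain c where c: "q = (\<lambda>x. c)" using hp_0_const less.prems by blast
    have "gint h = 0" using gint_euler[OF h(1)] h(2) less.prems by simp
    then show ?thesis unfolding c gint_cmult by simp
  next
    case False
    have H: "hp (1 + (d - 1) + l) (\<lambda>x. of_real (x $ i) * partial_derivative i q x * h x)" for i
      by (intro hp_mult hp_coord hp_partial less.prems h)
    have "of_nat d * gint (\<lambda>x. q x * h x) = gint (\<lambda>x. \<Sum>i\<in>UNIV. of_real (x $ i) * partial_derivative i q x * h x)"
      unfolding sum_distrib_right[symmetric] euler_identity[OF less.prems(2)] by (simp add: gint_cmult mult.assoc)
    also have "\<dots> = (\<Sum>i\<in>UNIV. gint (\<lambda>x. of_real (x $ i) * (partial_derivative i q x * h x)))"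
      by (subst gint_sum[OF H]) (simp_all add: mult.assoc)
    also have "\<dots> = 0"
    proof (rule sum.neutral, rule ballI)
      fix i
      have "gint (\<lambda>x. partial_derivative i (partial_derivative i q) x * h x) = 0"
        using less.IH[OF _ less.prems(1) hp_partial2[OF less.prems(2)], of i i] False less.prems(3) by simp
      moreover have "gint (\<lambda>x. partial_derivative i q x * partial_derivative i h x) = 0"
        using less.IH[OF _ harm_partial[OF less.prems(1)] hp_partial[OF less.prems(2)], of i i]
          False less.prems(3) by simp
      ultimately show "gint (\<lambda>x. of_real (x $ i) * (partial_derivative i q x * h x)) = 0"
        by (simp add: gint_coord_mult_prod[OF hp_partial[OF less.prems(2)] h(1)])
    qed
    finally show ?thesis using False by simp
  qed
qed

text \<open>Split off one factor \<open>x \<cdot> b\<close> and integrate by parts. If the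
  derivative falls on another factor \<open>x \<cdot> b\<close>, the remaining power has too small a
  degree to pair with \<open>h\<close>; otherwise it falls on \<open>h\<close>, and Euler's identity
  at \<open>b\<close> collects the partial derivatives.\<close>

lemma gint_cdot_power_harm:
  fixes h :: "real^'n::finite \<Rightarrow> complex"
  assumes "harm l h"
  shows "gint (\<lambda>x. cdot x b ^ l * h x) = fact l / 2 ^ l * h b * gint (\<lambda>x::real^'n. 1)"
  using assms
proof (induction l arbitrary: h)
  case 0
  then obtain c where "h = (\<lambda>x. c)" using hp_0_const harm_def by blast
  then show ?case using gint_cmult[of c "\<lambda>x::real^'n. 1"] by simp
next
  case (Suc l)
  have h: "hp (Suc l) h" using Suc.prems by (simp add: harm_def)
  have H: "hp (1 + (l + Suc l)) (\<lambda>x. of_real (b $ i) * (of_real (x $ i) * (cdot x b ^ l * h x)))" for i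
    by (intro hp_cmult hp_mult hp_coord hp_cdot_power h)
  have "gint (\<lambda>x. cdot x b ^ Suc l * h x) =
      gint (\<lambda>x. \<Sum>i\<in>UNIV. of_real (b $ i) * (of_real (x $ i) * (cdot x b ^ l * h x)))"
  proof -
    have "cdot x b ^ Suc l * h x = (\<Sum>i\<in>UNIV. of_real (b $ i) * (of_real (x $ i) * (cdot x b ^ l * h x)))" for x
      unfolding power_Suc mult.assoc by (subst cdot_eq) (simp only: sum_distrib_right mult.assoc)
    then show ?thesis by simp
  qed
  also have "\<dots> = (\<Sum>i\<in>UNIV. of_real (b $ i) * gint (\<lambda>x. of_real (x $ i) * (cdot x b ^ l * h x)))"
    by (subst gint_sum[OF H]) (simp_all add: gint_cmult)
  also have "\<dots> = (\<Sum>i\<in>UNIV. of_real (b $ i) * (1 / 2 * (fact l / 2 ^ l * partial_derivative i h b * gint (\<lambda>x::real^'n. 1))))"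
  proof (intro sum.cong refl)
    fix i
    have "gint (\<lambda>x. cdot x b ^ (l - 1) * h x) = 0"
      by (rule gint_harm_orthogonal[OF Suc.prems hp_cdot_power]) simp
    then have "gint (\<lambda>x. partial_derivative i (\<lambda>x. cdot x b ^ l) x * h x) = 0"
      by (simp add: partial_cdot_power mult.assoc gint_cmult)
    then show "of_real (b $ i) * gint (\<lambda>x. of_real (x $ i) * (cdot x b ^ l * h x)) =
        of_real (b $ i) * (1 / 2 * (fact l / 2 ^ l * partial_derivative i h b * gint (\<lambda>x::real^'n. 1)))"
      using Suc.IH[OF harm_partial[OF Suc.prems, unfolded diff_Suc_1], of i]
      by (simp add: gint_coord_mult_prod[OF hp_cdot_power h])
  qed
  also have "\<dots> = fact l / 2 ^ Suc l * gint (\<lambda>x::real^'n. 1) * (\<Sum>i\<in>UNIV. of_real (b $ i) * partial_derivative i h b)"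
    by (simp add: sum_distrib_left sum_divide_distrib algebra_simps)
  also have "\<dots> = fact (Suc l) / 2 ^ Suc l * h b * gint (\<lambda>x::real^'n. 1)"
    unfolding euler_identity[OF h] by simp
  finally show ?case .
qed

lemma gint_1: "gint (\<lambda>x::real^'n::finite. 1) = of_real (pi powr (CARD('n) / 2))"
proof -
  have "gint (\<lambda>x::real^'n::finite. 1) = of_real (sqrt pi ^ CARD('n))"
    using gint_monomial[of "\<lambda>_::'n. 0"] by (simp add: multi_power_def gmoment_0)
  also have "sqrt pi ^ CARD('n) = pi powr (CARD('n) / 2)"
    by (simp add: powr_half_sqrt[symmetric] powr_powr flip: powr_realpow)
  finally show ?thesis .
qed

lemma bint_eq:
  fixes f :: "real^'n::finite \<Rightarrow> complex"
  assumes "hp d f"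
  shows "bint f = gint f / of_real (Gamma ((CARD('n) + d) / 2 + 1))"
proof -
  have "Gamma ((real CARD('n) + d) / 2 + 1) > 0" by (intro Gamma_real_pos add_nonneg_pos) simp_all
  then show ?thesis using gint_eq_Gamma_times_bint[OF assms] by simp
qed

lemma bint_sqnorm_mult:
  fixes f :: "real^'n::finite \<Rightarrow> complex"
  assumes "hp d f"
  shows "bint (\<lambda>x. sqnorm x * f x) = of_real ((real CARD('n) + d) / (CARD('n) + d + 2)) * bint f"
proof -
  define x where "x = (real CARD('n) + d) / 2 + 1"
  have x: "x > 0" unfolding x_def by (intro add_nonneg_pos) simp_all
  then have G: "Gamma x > 0" "Gamma (x + 1) = x * Gamma x"
    by (auto intro!: Gamma_plus1 elim!: nonpos_Ints_cases)
  have "bint (\<lambda>x. sqnorm x * f x) = of_real ((real CARD('n) + d) / 2) * gint f / of_real (Gamma (x + 1))"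
    using bint_eq[OF hp_mult[OF hp_sqnorm assms]] gint_sqnorm_mult[OF assms]
    by (simp add: x_def add_divide_distrib algebra_simps)
  also have "\<dots> = of_real ((real CARD('n) + d) / 2 / x) * bint f"
    using x G by (subst bint_eq[OF assms]) (simp add: x_def)
  also have "(real CARD('n) + d) / 2 / x = (real CARD('n) + d) / (CARD('n) + d + 2)"
    by (simp add: x_def field_simps)
  finally show ?thesis .
qed

text \<open>The factor is the quotient of the integrals of \<open>r^(n-1+d+2a)\<close> and
  \<open>r^(n-1+d)\<close> over the unit interval.\<close>

lemma bint_sqnorm_power:
  fixes f :: "real^'n::finite \<Rightarrow> complex"
  assumes "hp d f"
  shows "bint (\<lambda>x. sqnorm x ^ a * f x) = of_real ((real CARD('n) + d) / (CARD('n) + d + 2 * a)) * bint f"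
proof (induction a)
  case (Suc a)
  have pos: "real CARD('n) > 0" by simp
  have "bint (\<lambda>x. sqnorm x ^ Suc a * f x) =
      of_real ((real CARD('n) + (d + 2 * a)) / (CARD('n) + (d + 2 * a) + 2)) * bint (\<lambda>x. sqnorm x ^ a * f x)"
    using bint_sqnorm_mult[OF hp_sqnorm_power[OF assms, of a]] by (simp add: mult.assoc)
  also have "\<dots> = of_real ((real CARD('n) + (d + 2 * a)) / (CARD('n) + (d + 2 * a) + 2) *
      ((real CARD('n) + d) / (CARD('n) + d + 2 * a))) * bint f"
    unfolding Suc by (simp add: mult.assoc)
  also have "(real CARD('n) + (d + 2 * a)) / (CARD('n) + (d + 2 * a) + 2) *
      ((real CARD('n) + d) / (CARD('n) + d + 2 * a)) = (real CARD('n) + d) / (CARD('n) + d + 2 * Suc a)"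
    using pos by (simp add: divide_simps add_nonneg_eq_0_iff del: zero_less_card_finite)
  finally show ?case .
qed (simp add: add_nonneg_eq_0_iff)

section \<open>Zonal harmonics\<close>

subsection \<open>Power series\<close>

text \<open>Sums on a one-sided real interval suffice, since its points accumulate at the origin.\<close>

lemma powser_zero_unique:
  fixes c :: "nat \<Rightarrow> complex"
  assumes "\<delta> > 0" and sums: "\<And>s. 0 \<le> s \<Longrightarrow> s < \<delta> \<Longrightarrow> (\<lambda>m. c m * of_real s ^ m) sums 0"
  shows "c m = 0"
proof (rule ccontr)
  assume cm: "c m \<noteq> 0"
  define f where "f = (\<lambda>z. \<Sum>m. c m * z ^ m)"
  have f: "(\<lambda>m. c m * z ^ m) sums f z" if "norm z < \<delta> / 2" for z
  proof -
    have "summable (\<lambda>m. c m * of_real (\<delta> / 2) ^ m)"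
      using sums[of "\<delta> / 2"] \<open>\<delta> > 0\<close> by (auto simp: sums_iff)
    then show ?thesis
      unfolding f_def using that powser_inside by (intro summable_sums) fastforce
  qed
  have f0: "f (of_real s) = 0" if "0 \<le> s" "s < \<delta>" for s
    using sums[OF that] by (simp add: f_def sums_iff)
  show False
  proof (cases m)
    case 0
    then show ?thesis using sums[of 0] \<open>\<delta> > 0\<close> cm by (simp add: sums_iff)
  next
    case (Suc k)
    obtain s where s: "0 < s" "\<And>z. z \<in> cball 0 s - {0} \<Longrightarrow> f z \<noteq> 0"
      using powser_0_nonzero[of "\<delta> / 2" 0 c f m] f f0[of 0] Suc cm \<open>\<delta> > 0\<close> by auto
    define r where "r = min s (\<delta> / 2)"
    have "0 < r" "r \<le> s" "r < \<delta>" using s(1) \<open>\<delta> > 0\<close> by (auto simp: r_def)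
    then show ?thesis
      using f0[of r] s(2)[of "of_real r"] by auto
  qed
qed

lemma powser_unique:
  fixes c d :: "nat \<Rightarrow> complex"
  assumes "\<delta> > 0" and "\<And>s. 0 \<le> s \<Longrightarrow> s < \<delta> \<Longrightarrow> (\<lambda>m. c m * of_real s ^ m) sums f s"
    and "\<And>s. 0 \<le> s \<Longrightarrow> s < \<delta> \<Longrightarrow> (\<lambda>m. d m * of_real s ^ m) sums f s"
  shows "c m = d m"
proof -
  have "(\<lambda>m. (c m - d m) * of_real s ^ m) sums 0" if "0 \<le> s" "s < \<delta>" for s
    using sums_diff[OF assms(2)[OF that] assms(3)[OF that]] by (simp add: left_diff_distrib)
  from powser_zero_unique[OF assms(1) this] show ?thesis by simp
qed

text \<open>The binomial theorem turns the series of \<open>f m (X + Y)\<^sup>m\<close> into an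
  absolutely convergent double series over the powers \<open>X^(m-k) Y\<^sup>k\<close>, which is
  summed here along \<open>l = m + k\<close>. If \<open>X\<close> is linear and \<open>Y\<close>
  quadratic, the new terms are homogeneous of degree \<open>l\<close>. This yields both the
  generating function of the zonal harmonics and the analyticity of holomorphic functions of
  quadratic polynomials.\<close>

lemma sums_quadratic_regroup:
  fixes f :: "nat \<Rightarrow> complex"
  assumes summ: "summable (\<lambda>m. norm (f m) * (norm X + norm Y) ^ m)"
  shows "(\<lambda>l. \<Sum>k | 2 * k \<le> l. f (l - k) * of_nat ((l - k) choose k) * X ^ (l - 2 * k) * Y ^ k)
           sums (\<Sum>m. f m * (X + Y) ^ m)"
proof -
  define g where "g = (\<lambda>(m, k). f m * of_nat (m choose k) * X ^ (m - k) * Y ^ k)"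
  have norm_g: "(\<Sum>k\<le>m. norm (g (m, k))) = norm (f m) * (norm X + norm Y) ^ m" for m
    unfolding g_def by (subst add.commute[of "norm X"])
      (simp add: binomial_ring norm_mult norm_power sum_distrib_left mult_ac)
  have sum_g: "(\<Sum>k\<le>m. g (m, k)) = f m * (X + Y) ^ m" for m
    unfolding g_def by (subst add.commute[of X]) (simp add: binomial_ring sum_distrib_left mult_ac)
  have abs: "(\<lambda>x. norm (g x)) summable_on Sigma UNIV (\<lambda>m. {..m})"
    unfolding Infinite_Sum.abs_summable_on_Sigma_iff
    using norm_summable_imp_summable_on[of "\<lambda>m. norm (f m) * (norm X + norm Y) ^ m"] summ
    by (simp add: norm_g)
  have summ': "summable (\<lambda>m. norm (f m * (X + Y) ^ m))"
    by (rule summable_comparison_test'[OF summ, of 0])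
      (auto simp: norm_mult norm_power intro!: mult_left_mono power_mono norm_triangle_ineq)
  have "(g has_sum (\<Sum>m. f m * (X + Y) ^ m)) (Sigma UNIV (\<lambda>m. {..m}))"
  proof (rule has_sum_SigmaI)
    show "((\<lambda>k. g (m, k)) has_sum (f m * (X + Y) ^ m)) {..m}" for m
      using has_sum_finite[of "{..m}" "\<lambda>k. g (m, k)"] by (simp add: sum_g)
    show "((\<lambda>m. f m * (X + Y) ^ m) has_sum (\<Sum>m. f m * (X + Y) ^ m)) UNIV"
      using norm_summable_imp_has_sum[OF summ'] summable_norm_cancel[OF summ'] by (simp add: sums_iff)
  qed (rule abs_summable_summable[OF abs])
  also have "?this \<longleftrightarrow> ((\<lambda>(l, k). f (l - k) * of_nat ((l - k) choose k) * X ^ (l - 2 * k) * Y ^ k)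
      has_sum (\<Sum>m. f m * (X + Y) ^ m)) (Sigma UNIV (\<lambda>l. {k. 2 * k \<le> l}))"
    by (rule has_sum_reindex_bij_witness[where i = "\<lambda>(l, k). (l - k, k)" and j = "\<lambda>(m, k). (m + k, k)"])
      (auto simp: g_def mult_2)
  finally have "((\<lambda>l. \<Sum>k | 2 * k \<le> l. f (l - k) * of_nat ((l - k) choose k) * X ^ (l - 2 * k) * Y ^ k)
      has_sum (\<Sum>m. f m * (X + Y) ^ m)) UNIV"
  proof (rule has_sum_SigmaD)
    fix l :: nat
    have "finite {k. 2 * k \<le> l}" by (rule finite_subset[of _ "{..l}"]) auto
    from has_sum_finite[OF this]
    show "((\<lambda>k. case (l, k) of (l, k) \<Rightarrow> f (l - k) * of_nat ((l - k) choose k) * X ^ (l - 2 * k) * Y ^ k) has_sum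
        (\<Sum>k | 2 * k \<le> l. f (l - k) * of_nat ((l - k) choose k) * X ^ (l - 2 * k) * Y ^ k)) {k. 2 * k \<le> l}"
      by simp
  qed
  then show ?thesis by (rule has_sum_imp_sums)
qed

subsection \<open>Definition and generating function\<close>

definition gegenbauer_coeff :: "real \<Rightarrow> nat \<Rightarrow> nat \<Rightarrow> real"
  where "gegenbauer_coeff a l k = (-1) ^ k * 2 ^ (l - 2 * k) * pochhammer a (l - k) / (fact k * fact (l - 2 * k))"

text \<open>The Gegenbauer polynomial with parameter \<open>a\<close>, made homogeneous: its usual
  form is the case \<open>q = 1\<close>.\<close>

definition gegenbauer :: "real \<Rightarrow> nat \<Rightarrow> complex \<Rightarrow> complex \<Rightarrow> complex"
  where "gegenbauer a l s q = (\<Sum>k | 2 * k \<le> l. of_real (gegenbauer_coeff a l k) * s ^ (l - 2 * k) * q ^ k)"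

text \<open>For \<open>l > 0\<close>, the closed form of the coefficients of the difference of the
  Gegenbauer polynomials of degrees \<open>l\<close> and \<open>l - 2\<close>, the latter multiplied
  by \<open>q\<close>. The formula refers to \<open>l - 1\<close>, hence the separate value for
  \<open>l = 0\<close>.\<close>

definition zonal_coeff :: "real \<Rightarrow> nat \<Rightarrow> nat \<Rightarrow> real"
  where "zonal_coeff a l k = (if l = 0 then 1 else
     (-1) ^ k * 2 ^ (l - 2 * k) * (a + l - 1) * pochhammer a (l - 1 - k) / (fact k * fact (l - 2 * k)))"

definition zonal :: "real \<Rightarrow> nat \<Rightarrow> complex \<Rightarrow> complex \<Rightarrow> complex"
  where "zonal a l s q = (\<Sum>k | 2 * k \<le> l. of_real (zonal_coeff a l k) * s ^ (l - 2 * k) * q ^ k)"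

lemma finite_halves [simp]: "finite {k. 2 * k \<le> (l::nat)}"
  by (rule finite_subset[of _ "{..l}"]) auto

lemma zonal_coeff_eq:
  assumes "2 * k \<le> l"
  shows "zonal_coeff a l k = gegenbauer_coeff a l k - (if k = 0 then 0 else gegenbauer_coeff a (l - 2) (k - 1))"
proof (cases "l = 0")
  case True
  then show ?thesis using assms by (simp add: zonal_coeff_def gegenbauer_coeff_def)
next
  case False
  then obtain j where j: "l - k = Suc j" using assms by (cases "l - k") auto
  have l: "real l = real j + 1 + real k" and j': "l - 1 - k = j" "l - Suc k = j" using j assms by auto
  show ?thesis
  proof (cases k)
    case 0
    then show ?thesis
      using j by (simp add: zonal_coeff_def gegenbauer_coeff_def pochhammer_Suc)
  next
    case (Suc i)
    have e: "l - 2 - i = j" "l - 2 - 2 * i = l - 2 * k" using Suc j by auto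
    show ?thesis
      unfolding zonal_coeff_def gegenbauer_coeff_def j
      using False Suc l j' e
      by (simp add: pochhammer_Suc divide_simps) (simp add: algebra_simps)
  qed
qed

lemma zonal_eq_gegenbauer:
  "zonal a l s q = gegenbauer a l s q - (if l < 2 then 0 else q * gegenbauer a (l - 2) s q)"
proof -
  have "zonal a l s q = gegenbauer a l s q -
      (\<Sum>k | 2 * k \<le> l. of_real (if k = 0 then 0 else gegenbauer_coeff a (l - 2) (k - 1)) * s ^ (l - 2 * k) * q ^ k)"
    unfolding zonal_def gegenbauer_def sum_subtractf[symmetric]
    by (intro sum.cong) (auto simp: zonal_coeff_eq left_diff_distrib)
  also have "(\<Sum>k | 2 * k \<le> l. of_real (if k = 0 then 0 else gegenbauer_coeff a (l - 2) (k - 1)) * s ^ (l - 2 * k) * q ^ k) =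
     (\<Sum>k | 2 * k \<le> l \<and> k \<noteq> 0. of_real (gegenbauer_coeff a (l - 2) (k - 1)) * s ^ (l - 2 * k) * q ^ k)"
    by (intro sum.mono_neutral_cong_right) auto
  also have "\<dots> = (\<Sum>k | 2 * Suc k \<le> l. of_real (gegenbauer_coeff a (l - 2) k) * s ^ (l - 2 * Suc k) * q ^ Suc k)"
    by (rule sum.reindex_bij_witness[of _ Suc "\<lambda>k. k - 1"]) (auto simp del: power_Suc mult_Suc_right)
  also have "\<dots> = (if l < 2 then 0 else q * gegenbauer a (l - 2) s q)"
  proof (cases "l < 2")
    case True
    then have "{k. 2 * Suc k \<le> l} = {}" by auto
    then show ?thesis using True by (simp only: sum.empty if_True)
  next
    case False
    then have "{k. 2 * Suc k \<le> l} = {k. 2 * k \<le> l - 2}" by auto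
    then show ?thesis using False by (simp add: gegenbauer_def sum_distrib_left mult_ac)
  qed
  finally show ?thesis .
qed

text \<open>This is the binomial series at \<open>- 2ts + t\<^sup>2q\<close> regrouped by powers of
  \<open>t\<close>. The bound on \<open>t\<close> provides the absolute convergence of the double
  series; uniqueness of Taylor coefficients later extends the domain.\<close>

lemma gegenbauer_generating_small:
  fixes s q t :: complex
  assumes "2 * norm (t * s) + norm (t ^ 2 * q) < 1"
  shows "(\<lambda>l. gegenbauer a l s q * t ^ l) sums (1 - 2 * t * s + t ^ 2 * q) powr (- of_real a)"
proof -
  let ?f = "\<lambda>m. of_real (pochhammer a m / fact m) :: complex"
  let ?X = "2 * t * s" and ?Y = "- (t ^ 2 * q)"
  have f: "?f m = (- of_real a gchoose m) * (-1) ^ m" for m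
    by (simp add: gbinomial_pochhammer pochhammer_of_real)
  have XY: "norm ?X + norm ?Y < 1" using assms by (simp add: norm_mult)
  have "summable (\<lambda>m. norm (?f m) * (norm ?X + norm ?Y) ^ m)"
  proof -
    obtain r where r: "norm ?X + norm ?Y < r" "r < 1" using XY dense by blast
    then have "r > 0" by (smt (verit) norm_ge_zero)
    have "summable (\<lambda>m. ((- of_real a :: complex) gchoose m) * of_real r ^ m)"
      using gen_binomial_complex[of "of_real r" "- of_real a"] r \<open>r > 0\<close> by (auto simp: sums_iff)
    from powser_insidea[OF this, of "of_real (norm ?X + norm ?Y)"]
    have "summable (\<lambda>m. norm (((- of_real a :: complex) gchoose m) * of_real (norm ?X + norm ?Y) ^ m))"
      using r \<open>r > 0\<close> by (simp del: of_real_add)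
    also have "(\<lambda>m. norm (((- of_real a :: complex) gchoose m) * of_real (norm ?X + norm ?Y) ^ m)) =
        (\<lambda>m. norm (?f m) * (norm ?X + norm ?Y) ^ m)"
      unfolding f by (simp add: norm_mult norm_power fun_eq_iff flip: of_real_power del: of_real_add)
    finally show ?thesis .
  qed
  from sums_quadratic_regroup[OF this]
  have "(\<lambda>l. \<Sum>k | 2 * k \<le> l. ?f (l - k) * of_nat ((l - k) choose k) * ?X ^ (l - 2 * k) * ?Y ^ k)
      sums (\<Sum>m. ?f m * (?X + ?Y) ^ m)" .
  also have "(\<Sum>m. ?f m * (?X + ?Y) ^ m) = (1 - 2 * t * s + t ^ 2 * q) powr (- of_real a)"
  proof -
    define w where "w = ?X + ?Y"
    have "norm (- w) < 1" using XY norm_triangle_ineq[of ?X ?Y] by (simp only: norm_minus_cancel w_def)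
    from gen_binomial_complex[OF this, of "- of_real a"]
    have "(\<lambda>m. ?f m * w ^ m) sums (1 + - w) powr (- of_real a)"
      unfolding f by (simp only: power_minus[of w] mult.assoc)
    then show ?thesis by (simp add: sums_iff w_def algebra_simps)
  qed
  also have "(\<lambda>l. \<Sum>k | 2 * k \<le> l. ?f (l - k) * of_nat ((l - k) choose k) * ?X ^ (l - 2 * k) * ?Y ^ k) =
      (\<lambda>l. gegenbauer a l s q * t ^ l)"
  proof
    fix l
    have "?f (l - k) * of_nat ((l - k) choose k) * ?X ^ (l - 2 * k) * ?Y ^ k =
        of_real (gegenbauer_coeff a l k) * s ^ (l - 2 * k) * q ^ k * t ^ l" if "2 * k \<le> l" for k
    proof -
      have "pochhammer a (l - k) / fact (l - k) * real ((l - k) choose k) =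
          pochhammer a (l - k) / (fact k * fact (l - 2 * k))"
        using that by (subst binomial_fact) (simp_all add: mult_2)
      then have "?f (l - k) * of_nat ((l - k) choose k) =
          of_real (pochhammer a (l - k) / (fact k * fact (l - 2 * k)))"
        by (metis of_real_mult of_real_of_nat_eq)
      moreover have "?X ^ (l - 2 * k) * ?Y ^ k = (-1) ^ k * 2 ^ (l - 2 * k) * s ^ (l - 2 * k) * q ^ k * t ^ l"
      proof -
        have "t ^ l = t ^ (l - 2 * k) * (t ^ 2) ^ k" using that by (simp flip: power_mult power_add)
        then show ?thesis by (simp add: power_mult_distrib power_minus[of "t\<^sup>2 * q"])
      qed
      ultimately show ?thesis by (simp add: gegenbauer_coeff_def mult.assoc)
    qed
    then show "(\<Sum>k | 2 * k \<le> l. ?f (l - k) * of_nat ((l - k) choose k) * ?X ^ (l - 2 * k) * ?Y ^ k) =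
      gegenbauer a l s q * t ^ l"
      unfolding gegenbauer_def sum_distrib_right by (intro sum.cong) auto
  qed
  finally show ?thesis .
qed

lemma zonal_generating_small:
  fixes s q t :: complex
  assumes "2 * norm (t * s) + norm (t ^ 2 * q) < 1"
  shows "(\<lambda>l. zonal a l s q * t ^ l) sums
           ((1 - t ^ 2 * q) * (1 - 2 * t * s + t ^ 2 * q) powr (- of_real a))"
proof -
  let ?S = "(1 - 2 * t * s + t ^ 2 * q) powr (- of_real a)"
  note G = gegenbauer_generating_small[OF assms, of a]
  let ?g = "\<lambda>l. if l < 2 then 0 else q * gegenbauer a (l - 2) s q * t ^ l"
  have "(\<lambda>l. t ^ 2 * q * (gegenbauer a l s q * t ^ l)) sums (t ^ 2 * q * ?S)"
    by (rule sums_mult[OF G])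
  moreover have "t ^ 2 * q * (gegenbauer a l s q * t ^ l) = ?g (l + 2)" for l
    by (simp add: power2_eq_square)
  ultimately have "(\<lambda>l. ?g (l + 2)) sums (t ^ 2 * q * ?S)" by simp
  then have "?g sums (t ^ 2 * q * ?S)"
    by (subst (asm) sums_iff_shift) (simp add: lessThan_nat_numeral lessThan_Suc)
  from sums_diff[OF G this] have "(\<lambda>l. gegenbauer a l s q * t ^ l - ?g l) sums (?S - t ^ 2 * q * ?S)" .
  also have "(\<lambda>l. gegenbauer a l s q * t ^ l - ?g l) = (\<lambda>l. zonal a l s q * t ^ l)"
    by (auto simp: zonal_eq_gegenbauer left_diff_distrib)
  finally show ?thesis by (simp add: left_diff_distrib)
qed

text \<open>For \<open>a = n / 2\<close>, \<open>t = 1\<close>, \<open>s = x \<cdot> cnj y\<close>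
  and \<open>q = |x|\<^sup>2 |cnj y|\<^sup>2\<close> this is the Poisson kernel.\<close>

definition zonal_gen :: "real \<Rightarrow> complex \<Rightarrow> complex \<Rightarrow> complex \<Rightarrow> complex"
  where "zonal_gen a s q t = (1 - t ^ 2 * q) * (1 - 2 * t * s + t ^ 2 * q) powr (- of_real a)"

text \<open>With \<open>z = s + i \<surd>(q - s\<^sup>2)\<close> one has
  \<open>z + cnj z = 2s\<close> and \<open>|z|\<^sup>2 = q\<close>. Everything about the size and
  the argument of the quadratic follows from this factorization.\<close>

lemma quadratic_factorization:
  fixes s q :: real and t :: complex
  assumes "s ^ 2 \<le> q"
  obtains z where "norm z = sqrt q"
    "1 - 2 * t * of_real s + t ^ 2 * of_real q = (1 - t * z) * (1 - t * cnj z)"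
proof
  define z where "z = Complex s (sqrt (q - s ^ 2))"
  have zz: "z * cnj z = of_real q" "z + cnj z = 2 * of_real s"
    using assms by (auto simp: z_def complex_eq_iff power2_eq_square)
  show "norm z = sqrt q" using assms by (simp add: z_def cmod_def)
  have "(1 - t * z) * (1 - t * cnj z) = 1 - t * (z + cnj z) + t ^ 2 * (z * cnj z)"
    by (simp add: algebra_simps power2_eq_square)
  then show "1 - 2 * t * of_real s + t ^ 2 * of_real q = (1 - t * z) * (1 - t * cnj z)"
    unfolding zz by (simp add: mult_ac)
qed

lemma quadratic_lower_bound:
  fixes s q :: real and t :: complex
  assumes "s ^ 2 \<le> q" "norm t * sqrt q \<le> r" "r \<le> 1"
  shows "norm (1 - 2 * t * of_real s + t ^ 2 * of_real q) \<ge> (1 - r) ^ 2"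
proof -
  obtain z where z: "norm z = sqrt q"
    "1 - 2 * t * of_real s + t ^ 2 * of_real q = (1 - t * z) * (1 - t * cnj z)"
    using quadratic_factorization[OF assms(1)] by metis
  have "norm (1 - t * w) \<ge> 1 - r" if "norm w = sqrt q" for w
    using norm_triangle_ineq2[of 1 "t * w"] assms(2) that by (simp add: norm_mult)
  then have "(1 - r) * (1 - r) \<le> norm (1 - t * z) * norm (1 - t * cnj z)"
    using assms(3) z(1) by (intro mult_mono) auto
  then show ?thesis unfolding z(2) by (simp add: norm_mult power2_eq_square)
qed

text \<open>Both linear factors have positive real part, so the argument of their product lies
  strictly between \<open>- \<pi>\<close> and \<open>\<pi>\<close>.\<close>

lemma quadratic_not_nonpos:
  fixes s q :: real and t :: complex
  assumes "s ^ 2 \<le> q" "norm t * sqrt q < 1"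
  shows "1 - 2 * t * of_real s + t ^ 2 * of_real q \<notin> \<real>\<^sub>\<le>\<^sub>0"
proof
  obtain z where z: "norm z = sqrt q"
    "1 - 2 * t * of_real s + t ^ 2 * of_real q = (1 - t * z) * (1 - t * cnj z)"
    using quadratic_factorization[OF assms(1)] by metis
  define u v where "u = 1 - t * z" and "v = 1 - t * cnj z"
  have pos: "Re (1 - t * w) > 0" if "norm w = sqrt q" for w
    using complex_Re_le_cmod[of "t * w"] assms(2) that by (simp add: norm_mult)
  have uv: "Re u > 0" "Re v > 0" using pos[of z] pos[of "cnj z"] z(1) by (auto simp: u_def v_def)
  assume "1 - 2 * t * of_real s + t ^ 2 * of_real q \<in> \<real>\<^sub>\<le>\<^sub>0"
  then obtain c where c: "u * v = of_real c" "c \<le> 0"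
    unfolding z(2) u_def v_def by (elim nonpos_Reals_cases) auto
  have "u * of_real ((cmod v)\<^sup>2) = of_real c * cnj v"
    using c(1) by (metis complex_norm_square mult.assoc)
  from arg_cong[OF this, of Re] have "Re u * (cmod v)\<^sup>2 = c * Re v"
    by (simp only: times_complex.simps Re_complex_of_real Im_complex_of_real cnj.simps)
  moreover have "Re u * (cmod v)\<^sup>2 > 0" using uv by (auto intro!: mult_pos_pos)
  moreover have "c * Re v \<le> 0" using uv c(2) by (simp add: mult_nonpos_nonneg)
  ultimately show False by linarith
qed

lemma norm_powr_of_real:
  assumes "w \<noteq> (0::complex)" shows "norm (w powr of_real a) = norm w powr a"
  using assms by (simp add: powr_def)

lemma holomorphic_zonal_gen:
  fixes s q :: real
  assumes "s ^ 2 \<le> q" "R * sqrt q \<le> 1" "R > 0"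
  shows "zonal_gen a (of_real s) (of_real q) holomorphic_on ball 0 R"
proof -
  have q: "q \<ge> 0" using assms(1) by (smt (verit) zero_le_power2)
  have "1 - 2 * t * of_real s + t ^ 2 * of_real q \<notin> \<real>\<^sub>\<le>\<^sub>0" if "t \<in> ball 0 R" for t :: complex
  proof (rule quadratic_not_nonpos[OF assms(1)])
    have t: "norm t < R" using that by simp
    show "norm t * sqrt q < 1"
    proof (cases "q = 0")
      case False
      then have "norm t * sqrt q < R * sqrt q" using t q by (intro mult_strict_right_mono) auto
      then show ?thesis using assms(2) by simp
    qed simp
  qed
  then show ?thesis unfolding zonal_gen_def[abs_def] by (intro holomorphic_intros) auto
qed

text \<open>The expansion near the origin identifies the Taylor coefficients of the generating
  function. Cauchy's theory then gives convergence on every disc on which that function is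
  holomorphic, and bounds for the coefficients.\<close>

lemma zonal_taylor:
  fixes s q :: real
  assumes "s ^ 2 \<le> q" "R * sqrt q \<le> 1" "R > 0"
  shows "zonal a l (of_real s) (of_real q) = (deriv ^^ l) (zonal_gen a (of_real s) (of_real q)) 0 / fact l"
proof -
  let ?F = "zonal_gen a (of_real s) (of_real q)"
  have "((\<lambda>t::real. 2 * (t * \<bar>s\<bar>) + t ^ 2 * q) \<longlongrightarrow> 2 * (0 * \<bar>s\<bar>) + 0 ^ 2 * q) (at 0)"
    by (intro tendsto_intros)
  then have "\<forall>\<^sub>F t in at 0. 2 * (t * \<bar>s\<bar>) + t ^ 2 * q < 1"
    by (rule order_tendstoD) simp
  then obtain d where d: "d > 0" "\<And>t. t \<noteq> 0 \<Longrightarrow> \<bar>t\<bar> < d \<Longrightarrow> 2 * (t * \<bar>s\<bar>) + t ^ 2 * q < 1"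
    by (auto simp: eventually_at dist_real_def)
  have q: "q \<ge> 0" using assms(1) by (smt (verit) zero_le_power2)
  show ?thesis
  proof (rule powser_unique[of "min d R" _ "\<lambda>t. ?F (of_real t)"])
    fix t :: real assume t: "0 \<le> t" "t < min d R"
    have "2 * (t * \<bar>s\<bar>) + t ^ 2 * q < 1" using d(2)[of t] t by (cases "t = 0") auto
    then show "(\<lambda>l. zonal a l (of_real s) (of_real q) * of_real t ^ l) sums ?F (of_real t)"
      unfolding zonal_gen_def using t q
      by (intro zonal_generating_small) (simp add: norm_mult norm_power)
    show "(\<lambda>l. (deriv ^^ l) ?F 0 / fact l * of_real t ^ l) sums ?F (of_real t)"
      using holomorphic_power_series[OF holomorphic_zonal_gen[OF assms], of "of_real t" a] t by simp
  qed (use d assms in auto)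
qed

lemma zonal_generating:
  fixes s q :: real
  assumes "s ^ 2 \<le> q" "R * sqrt q \<le> 1" "norm t < R"
  shows "(\<lambda>l. zonal a l (of_real s) (of_real q) * t ^ l) sums zonal_gen a (of_real s) (of_real q) t"
proof -
  have R: "R > 0" using assms(3) by (smt (verit) norm_ge_zero)
  show ?thesis
    unfolding zonal_taylor[OF assms(1,2) R]
    using holomorphic_power_series[OF holomorphic_zonal_gen[OF assms(1,2) R], of t a] assms(3) by simp
qed

text \<open>Cauchy's estimate for the generating function on the circle of radius \<open>r\<close>.
  The bound is uniform in \<open>s\<close> and \<open>q\<close>, hence in the two points of the
  closed ball at which zonal harmonics are evaluated.\<close>

lemma zonal_bound:
  assumes "0 < r" "r < (1::real)" "a \<ge> 0"
  obtains M where "M > 0" "\<And>l s q. s ^ 2 \<le> q \<Longrightarrow> q \<le> 1 \<Longrightarrow> norm (zonal a l (of_real s) (of_real q)) \<le> M / r ^ l"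
proof
  let ?M = "2 * ((1 - r) ^ 2) powr (- a)"
  show "?M > 0" using assms by simp
  fix l and s q :: real assume sq: "s ^ 2 \<le> q" "q \<le> 1"
  have q: "q \<ge> 0" using sq by (smt (verit) zero_le_power2)
  have R: "1 * sqrt q \<le> 1" using sq q by simp
  let ?F = "zonal_gen a (of_real s) (of_real q)"
  have hol: "?F holomorphic_on ball 0 1" by (rule holomorphic_zonal_gen[OF sq(1) R]) simp
  have "norm ((deriv ^^ l) ?F 0) \<le> fact l * ?M / r ^ l"
  proof (rule Cauchy_inequality)
    show "?F holomorphic_on ball 0 r" using hol by (rule holomorphic_on_subset) (use assms in auto)
    show "continuous_on (cball 0 r) ?F"
      using holomorphic_on_imp_continuous_on[OF hol] by (rule continuous_on_subset) (use assms in auto)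
    fix t :: complex assume t: "norm (0 - t) = r"
    let ?D = "1 - 2 * t * of_real s + t ^ 2 * of_real q"
    have D: "norm ?D \<ge> (1 - r) ^ 2"
      by (rule quadratic_lower_bound[OF sq(1)]) (use t sq q assms in \<open>auto simp: mult_left_le\<close>)
    then have "?D \<noteq> 0" using assms by (smt (verit) norm_zero zero_less_power2)
    then have "norm (?D powr (- of_real a)) = norm ?D powr (- a)"
      using norm_powr_of_real[of ?D "- a"] by simp
    also have "\<dots> \<le> ((1 - r) ^ 2) powr (- a)"
      using D assms by (intro powr_mono2') auto
    finally have "norm (?D powr (- of_real a)) \<le> ((1 - r) ^ 2) powr (- a)" .
    moreover have "norm (1 - t ^ 2 * of_real q) \<le> 2"
    proof -
      have "norm (t ^ 2 * of_real q) \<le> 1"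
        using t q sq assms by (simp add: norm_mult norm_power mult_le_one power_le_one)
      then show ?thesis using norm_triangle_ineq4[of 1 "t ^ 2 * of_real q"] by simp
    qed
    ultimately show "norm (?F t) \<le> ?M"
      unfolding zonal_gen_def norm_mult by (intro mult_mono) auto
  qed (use assms in auto)
  then show "norm (zonal a l (of_real s) (of_real q)) \<le> ?M / r ^ l"
    unfolding zonal_taylor[OF sq(1) R zero_less_one] by (simp add: norm_divide field_simps)
qed

subsection \<open>Zonal harmonics as functions on space\<close>

definition zonal_harmonic :: "nat \<Rightarrow> real^'n::finite \<Rightarrow> real^'n \<Rightarrow> complex"
  where "zonal_harmonic l b x = zonal (CARD('n) / 2) l (cdot x b) (sqnorm x * sqnorm b)"

lemma zonal_harmonic_eq:
  "zonal_harmonic l b x = (\<Sum>k | 2 * k \<le> l. of_real (zonal_coeff (CARD('n) / 2) l k) * sqnorm b ^ k *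
      (sqnorm x ^ k * cdot x b ^ (l - 2 * k)))" for x b :: "real^'n::finite"
  unfolding zonal_harmonic_def zonal_def by (simp add: power_mult_distrib mult_ac)

lemma zonal_harmonic_sym: "zonal_harmonic l b x = zonal_harmonic l x b"
  by (simp add: zonal_harmonic_def cdot_def inner_commute mult.commute)

lemma cdot_sqnorm_le: "(x \<bullet> b)\<^sup>2 \<le> (norm x)\<^sup>2 * (norm b)\<^sup>2"
  using Cauchy_Schwarz_ineq[of x b] by (simp add: power2_norm_eq_inner)

lemma zonal_harmonic_real:
  "zonal_harmonic l b x = zonal (CARD('n) / 2) l (of_real (x \<bullet> b)) (of_real ((norm x)\<^sup>2 * (norm b)\<^sup>2))"
  for x b :: "real^'n::finite"
  by (simp add: zonal_harmonic_def cdot_def sqnorm_def)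

lemma cnj_zonal_harmonic [simp]: "cnj (zonal_harmonic l b x) = zonal_harmonic l b x"
  by (simp add: zonal_harmonic_real zonal_def)

lemma hp_sqnorm_cdot:
  assumes "2 * k \<le> l" shows "hp l (\<lambda>x. sqnorm x ^ k * cdot x b ^ (l - 2 * k))"
  using hp_sqnorm_power[OF hp_cdot_power, of "l - 2 * k" k b] assms by simp

lemma hp_zonal_harmonic: "hp l (zonal_harmonic l b)"
  unfolding zonal_harmonic_eq[abs_def] by (intro hp_sum hp_cmult hp_sqnorm_cdot) simp

text \<open>The recursion that makes consecutive terms of the Laplacian of a zonal harmonic cancel.\<close>

lemma zonal_coeff_Suc:
  assumes "2 * Suc k \<le> l"
  shows "zonal_coeff (real n / 2) l (Suc k) * (2 * real (Suc k) * (real n + 2 * real (Suc k) + 2 * real (l - 2 * Suc k) - 2))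
     = - zonal_coeff (real n / 2) l k * (real (l - 2 * k) * real (l - 2 * k - 1))"
proof -
  define i where "i = l - 2 * Suc k"
  have l: "l = Suc (Suc (i + 2 * k))" using assms by (simp add: i_def)
  have "fact (l - 2 * k) = (real i + 2) * (real i + 1) * fact i" unfolding l by (simp add: algebra_simps)
  moreover have "pochhammer (real n / 2) (l - 1 - k) = pochhammer (real n / 2) (i + k) * (real n / 2 + i + k)"
    unfolding l by (simp add: pochhammer_Suc add_ac)
  ultimately show ?thesis
    unfolding zonal_coeff_def l
    by (simp add: pochhammer_Suc divide_simps) (simp add: algebra_simps)
qed

lemma laplacian_sum: "(\<And>i. i \<in> I \<Longrightarrow> hp m (f i)) \<Longrightarrow>
    laplacian (\<lambda>x. \<Sum>i\<in>I. f i x) = (\<lambda>x. \<Sum>i\<in>I. laplacian (f i) x)"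
  using laplacian_iter_sum[of I m f 1] by simp

text \<open>The Laplacian of the \<open>k\<close>-th term consists of a multiple of
  \<open>|x|^(2k-2) (x \<cdot> b)^(l-2k)\<close>, called \<open>A\<close> below, and a multiple of
  \<open>|x|^(2k) (x \<cdot> b)^(l-2k-2)\<close>, called \<open>B\<close>. The part \<open>A\<close>
  of each term cancels the part \<open>B\<close> of the preceding one.\<close>

lemma harm_zonal_harmonic: "harm l (zonal_harmonic l (b::real^'n::finite))"
proof -
  define z where "z = (\<lambda>k. zonal_coeff (CARD('n) / 2) l k)"
  define K where "K = l div 2"
  have K: "{k. 2 * k \<le> l} = {..K}" by (auto simp: K_def)
  define A where "A = (\<lambda>(x::real^'n) k. of_real (z k * (2 * real k * (real CARD('n) + 2 * real k + 2 * real (l - 2 * k) - 2)))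
      * (sqnorm b ^ k * sqnorm x ^ (k - 1) * cdot x b ^ (l - 2 * k)))"
  define B where "B = (\<lambda>(x::real^'n) k. of_real (z k * (real (l - 2 * k) * real (l - 2 * k - 1)))
      * (sqnorm b ^ Suc k * sqnorm x ^ k * cdot x b ^ (l - 2 * k - 2)))"
  have "laplacian (zonal_harmonic l b) =
      (\<lambda>x. \<Sum>k | 2 * k \<le> l. laplacian (\<lambda>x. of_real (z k) * sqnorm b ^ k * (sqnorm x ^ k * cdot x b ^ (l - 2 * k))) x)"
    unfolding zonal_harmonic_eq[abs_def] z_def
    by (rule laplacian_sum[of _ l]) (intro hp_cmult hp_sqnorm_cdot, simp)
  also have "\<dots> = (\<lambda>x. \<Sum>k\<le>K. A x k + B x k)"
  proof (intro ext sum.cong K)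
    fix x :: "real^'n" and k assume "k \<in> {..K}"
    then have k: "2 * k \<le> l" using K by blast
    show "laplacian (\<lambda>x. of_real (z k) * sqnorm b ^ k * (sqnorm x ^ k * cdot x b ^ (l - 2 * k))) x = A x k + B x k"
      unfolding laplacian_cmult[OF hp_sqnorm_cdot[OF k]] laplacian_sqnorm_power[OF hp_cdot_power] laplacian_cdot_power
        A_def B_def
      by (simp add: distrib_left mult_ac)
  qed
  also have "\<dots> = (\<lambda>x. 0)"
  proof
    fix x :: "real^'n"
    have "A x (Suc k) = - B x k" if "k < K" for k
    proof -
      have k: "2 * Suc k \<le> l" using that by (simp add: K_def)
      show ?thesis
        unfolding A_def B_def z_def zonal_coeff_Suc[OF k]
        by (simp add: mult_ac)
    qed
    moreover have "A x 0 = 0" "B x K = 0" by (auto simp: A_def B_def K_def)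
    moreover have "(\<Sum>k\<le>K. A x k) = A x 0 + (\<Sum>k<K. A x (Suc k))" by (rule sum.atMost_shift)
    moreover have "(\<Sum>k\<le>K. B x k) = (\<Sum>k<K. B x k) + B x K" by (simp flip: lessThan_Suc_atMost)
    ultimately have "(\<Sum>k\<le>K. A x k) = - (\<Sum>k\<le>K. B x k)" by (simp add: sum_negf)
    then show "(\<Sum>k\<le>K. A x k + B x k) = 0" by (simp add: sum.distrib)
  qed
  finally show ?thesis by (simp add: harm_def hp_zonal_harmonic)
qed

lemma gint_sqnorm_power:
  fixes f :: "real^'n::finite \<Rightarrow> complex"
  assumes "hp d f"
  shows "\<exists>c. gint (\<lambda>x. sqnorm x ^ k * f x) = c * gint f"
proof (induction k)
  case (Suc k)
  then obtain c where "gint (\<lambda>x. sqnorm x ^ k * f x) = c * gint f" by blast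
  then show ?case
    using gint_sqnorm_mult[OF hp_sqnorm_power[OF assms, of k]]
    by (intro exI[of _ "of_real ((real CARD('n) + real (d + 2 * k)) / 2) * c"]) (simp add: mult.assoc)
qed (auto intro: exI[of _ 1])

text \<open>All terms of the zonal harmonic except the leading one, a multiple of
  \<open>(x \<cdot> b)\<^sup>l\<close>, are a power of \<open>|x|\<^sup>2\<close> times a polynomial
  of degree below \<open>l\<close>, and so are orthogonal to \<open>h\<close>.\<close>

lemma gint_zonal_harmonic:
  fixes h :: "real^'n::finite \<Rightarrow> complex"
  assumes "harm l h"
  shows "gint (\<lambda>x. zonal_harmonic l b x * h x) =
    of_real (pochhammer (CARD('n) / 2) l * pi powr (CARD('n) / 2)) * h b"
proof -
  let ?z = "zonal_coeff (CARD('n) / 2) l"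
  have h: "hp l h" using assms by (simp add: harm_def)
  have "gint (\<lambda>x. zonal_harmonic l b x * h x) =
      gint (\<lambda>x. \<Sum>k | 2 * k \<le> l. of_real (?z k) * sqnorm b ^ k * (sqnorm x ^ k * cdot x b ^ (l - 2 * k) * h x))"
    by (simp add: zonal_harmonic_eq sum_distrib_right mult.assoc)
  also have "\<dots> = (\<Sum>k | 2 * k \<le> l. of_real (?z k) * sqnorm b ^ k * gint (\<lambda>x. sqnorm x ^ k * cdot x b ^ (l - 2 * k) * h x))"
    by (subst gint_sum[of _ "l + l"]) (auto intro!: hp_cmult hp_mult[OF hp_sqnorm_cdot h] simp: gint_cmult)
  also have "\<dots> = (\<Sum>k\<in>{0}. of_real (?z k) * sqnorm b ^ k * gint (\<lambda>x. sqnorm x ^ k * cdot x b ^ (l - 2 * k) * h x))"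
  proof (intro sum.mono_neutral_right ballI)
    fix k assume k: "k \<in> {k. 2 * k \<le> l} - {0}"
    have "gint (\<lambda>x. cdot x b ^ (l - 2 * k) * h x) = 0"
      using k by (intro gint_harm_orthogonal[OF assms hp_cdot_power]) auto
    then have "gint (\<lambda>x. sqnorm x ^ k * (cdot x b ^ (l - 2 * k) * h x)) = 0"
      using gint_sqnorm_power[OF hp_mult[OF hp_cdot_power h, of "l - 2 * k" b], of k] by auto
    then show "of_real (?z k) * sqnorm b ^ k * gint (\<lambda>x. sqnorm x ^ k * cdot x b ^ (l - 2 * k) * h x) = 0"
      by (simp add: mult.assoc)
  qed auto
  also have "\<dots> = of_real (?z 0) * (fact l / 2 ^ l * h b * of_real (pi powr (CARD('n) / 2)))"
    using gint_cdot_power_harm[OF assms, of b] by (simp add: gint_1)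
  also have "\<dots> = of_real (?z 0 * (fact l / 2 ^ l) * pi powr (CARD('n) / 2)) * h b"
    by simp
  also have "?z 0 * (fact l / 2 ^ l) = pochhammer (CARD('n) / 2) l"
  proof (cases l)
    case (Suc j)
    then show ?thesis by (simp add: zonal_coeff_def pochhammer_Suc mult.commute del: fact_Suc)
  qed (simp add: zonal_coeff_def)
  finally show ?thesis .
qed

lemma pos_notin_nonpos_Ints: "x > 0 \<Longrightarrow> (x::real) \<notin> \<int>\<^sub>\<le>\<^sub>0"
  by (auto elim!: nonpos_Ints_cases)

text \<open>The reproducing property of zonal harmonics on the sphere, integrated over the radius:
  \<open>n \<Omega>\<close> is the area of the sphere, and \<open>1 / (n + 2l + 2a)\<close> is the
  integral of \<open>r^(n-1+2l+2a)\<close> over the unit interval.\<close>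

theorem bint_zonal_harmonic:
  fixes h :: "real^'n::finite \<Rightarrow> complex"
  assumes "harm l h"
  shows "bint (\<lambda>x. sqnorm x ^ a * (zonal_harmonic l b x * h x)) =
    of_real (CARD('n) * unit_ball_vol (CARD('n)) / (CARD('n) + 2 * l + 2 * a)) * h b"
proof -
  let ?n = "real CARD('n)"
  have n: "?n > 0" by simp
  have H: "hp (l + l) (\<lambda>x. zonal_harmonic l b x * h x)"
    using assms by (intro hp_mult hp_zonal_harmonic) (simp add: harm_def)
  have "bint (\<lambda>x. zonal_harmonic l b x * h x) =
      of_real (pochhammer (?n / 2) l * pi powr (?n / 2)) * h b / of_real (Gamma ((CARD('n) + (l + l)) / 2 + 1))"
    using bint_eq[OF H] gint_zonal_harmonic[OF assms, of b] by simp
  also have "pochhammer (?n / 2) l = Gamma (?n / 2 + l) / Gamma (?n / 2)"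
    using n by (intro pochhammer_Gamma) (simp_all add: pos_notin_nonpos_Ints)
  also have "Gamma ((CARD('n) + (l + l)) / 2 + 1) = (?n / 2 + l) * Gamma (?n / 2 + l)"
  proof -
    have "?n / 2 + l > 0" using n by (simp add: add_pos_nonneg)
    then have "Gamma (?n / 2 + l + 1) = (?n / 2 + l) * Gamma (?n / 2 + l)"
      by (intro Gamma_plus1) (simp_all add: pos_notin_nonpos_Ints)
    then show ?thesis by (simp add: add_divide_distrib)
  qed
  also have "of_real (Gamma (?n / 2 + l) / Gamma (?n / 2) * pi powr (?n / 2)) * h b /
      of_real ((?n / 2 + l) * Gamma (?n / 2 + l)) =
      of_real (Gamma (?n / 2 + l) / Gamma (?n / 2) * pi powr (?n / 2) / ((?n / 2 + l) * Gamma (?n / 2 + l))) * h b"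
    by simp
  also have "Gamma (?n / 2 + l) / Gamma (?n / 2) * pi powr (?n / 2) / ((?n / 2 + l) * Gamma (?n / 2 + l)) =
      ?n * unit_ball_vol ?n / (?n + 2 * l)"
  proof -
    have aux: "x / y * P / ((N / 2 + l) * x) = N * (P / (N / 2 * y)) / (N + 2 * l)"
      if "x > 0" "y > 0" "N > 0" for x y P N :: real
      using that by (simp add: divide_simps add_nonneg_eq_0_iff)
    have "Gamma (?n / 2 + l) > 0" using n by (intro Gamma_real_pos add_pos_nonneg) simp_all
    moreover have G: "Gamma (?n / 2 + 1) = ?n / 2 * Gamma (?n / 2)"
      using n by (intro Gamma_plus1) (simp_all add: pos_notin_nonpos_Ints)
    moreover have "Gamma (?n / 2) > 0" using n by (intro Gamma_real_pos) simp_all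
    ultimately show ?thesis unfolding unit_ball_vol_def G by (intro aux n)
  qed
  finally have base: "bint (\<lambda>x. zonal_harmonic l b x * h x) = of_real (?n * unit_ball_vol ?n / (?n + 2 * l)) * h b" .
  have "bint (\<lambda>x. sqnorm x ^ a * (zonal_harmonic l b x * h x)) =
      of_real ((?n + real (l + l)) / (real (CARD('n) + (l + l)) + 2 * a) * (?n * unit_ball_vol ?n / (?n + 2 * l))) * h b"
    unfolding bint_sqnorm_power[OF H, of a] base by (simp only: of_real_mult mult.assoc of_nat_add of_nat_mult of_nat_numeral)
  also have "(?n + real (l + l)) / (real (CARD('n) + (l + l)) + 2 * a) * (?n * unit_ball_vol ?n / (?n + 2 * l)) =
      ?n * unit_ball_vol ?n / (?n + 2 * l + 2 * a)"
    using n by (simp add: divide_simps add_nonneg_eq_0_iff del: zero_less_card_finite)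
  finally show ?thesis by simp
qed

theorem bint_zonal_harmonic_orthogonal:
  fixes h :: "real^'n::finite \<Rightarrow> complex"
  assumes "harm m h" "m \<noteq> l"
  shows "bint (\<lambda>x. sqnorm x ^ a * (zonal_harmonic l b x * h x)) = 0"
proof -
  have h: "hp m h" using assms by (simp add: harm_def)
  have H: "hp (l + m) (\<lambda>x. zonal_harmonic l b x * h x)"
    by (intro hp_mult hp_zonal_harmonic h)
  have "gint (\<lambda>x. zonal_harmonic l b x * h x) = 0"
  proof (cases "l < m")
    case True
    then show ?thesis using gint_harm_orthogonal[OF assms(1) hp_zonal_harmonic] by blast
  next
    case False
    then show ?thesis
      using gint_harm_orthogonal[OF harm_zonal_harmonic h, of l b] assms(2) by (simp add: mult.commute)
  qed
  then show ?thesis using bint_sqnorm_power[OF H, of a] bint_eq[OF H] by simp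
qed

section \<open>Expansions into homogeneous polynomials\<close>

subsection \<open>Homogeneous polynomials with bounded coefficient sum\<close>

text \<open>The sum of the absolute values of the coefficients is submultiplicative, controls
  partial derivatives, and bounds the polynomial on polydiscs of complex points; \<open>A\<close> is
  an upper bound for it.\<close>

definition hpb :: "nat \<Rightarrow> (real^'n::finite \<Rightarrow> complex) \<Rightarrow> real \<Rightarrow> bool"
  where "hpb m q A \<longleftrightarrow> (\<exists>c. (\<forall>x. q x = (\<Sum>\<alpha> | sum \<alpha> UNIV = m. c \<alpha> * multi_power x \<alpha>)) \<and>
     (\<Sum>\<alpha> | sum \<alpha> UNIV = m. norm (c \<alpha>)) \<le> A)"

lemma hpb_imp_hp: "hpb m q A \<Longrightarrow> hp m q"
  unfolding hpb_def homogeneous_polynomial_def by blast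

lemma hp_imp_hpb: "hp m q \<Longrightarrow> \<exists>A. hpb m q A"
  unfolding hpb_def homogeneous_polynomial_def by blast

lemma hpb_nonneg: "hpb m q A \<Longrightarrow> 0 \<le> A"
  unfolding hpb_def by (metis (no_types, lifting) norm_ge_zero order_trans sum_nonneg)

lemma hpb_mono: "hpb m q A \<Longrightarrow> A \<le> B \<Longrightarrow> hpb m q B"
  unfolding hpb_def by force

lemma norm_multi_power_le:
  fixes h :: "real^'n::finite"
  assumes "\<And>i. \<bar>vec_nth h i\<bar> \<le> t" shows "norm (multi_power h \<alpha>) \<le> t ^ sum \<alpha> UNIV"
  unfolding multi_power_def prod_norm[symmetric] power_sum
  using assms by (intro prod_mono) (auto simp: norm_power intro!: power_mono)

lemma hpb_bound:
  fixes h :: "real^'n::finite"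
  assumes "hpb m q A" "\<And>i. \<bar>vec_nth h i\<bar> \<le> t" shows "norm (q h) \<le> A * t ^ m"
proof -
  obtain c where c: "\<And>x. q x = (\<Sum>\<alpha> | sum \<alpha> UNIV = m. c \<alpha> * multi_power x \<alpha>)"
    "(\<Sum>\<alpha> | sum \<alpha> UNIV = m. norm (c \<alpha>)) \<le> A"
    using assms(1) unfolding hpb_def by blast
  have t: "t \<ge> 0" using assms(2) abs_ge_zero order_trans by blast
  have "norm (q h) \<le> (\<Sum>\<alpha> | sum \<alpha> UNIV = m. norm (c \<alpha> * multi_power h \<alpha>))"
    unfolding c(1) by (rule norm_sum)
  also have "\<dots> \<le> (\<Sum>\<alpha> | sum \<alpha> UNIV = m. norm (c \<alpha>) * t ^ m)"
    using norm_multi_power_le[of h t, OF assms(2)]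
    by (intro sum_mono) (auto simp: norm_mult intro!: mult_left_mono)
  also have "\<dots> \<le> A * t ^ m"
    unfolding sum_distrib_right[symmetric] using c(2) t by (intro mult_right_mono) auto
  finally show ?thesis .
qed

lemma hpb_zero [simp]: "hpb m (\<lambda>x. 0) 0"
  unfolding hpb_def by (intro exI[of _ "\<lambda>_. 0"]) simp

lemma hpb_add: "hpb m f A \<Longrightarrow> hpb m g B \<Longrightarrow> hpb m (\<lambda>x. f x + g x) (A + B)"
  unfolding hpb_def
proof (elim exE conjE)
  fix c d
  assume c: "\<forall>x. f x = (\<Sum>\<alpha> | sum \<alpha> UNIV = m. c \<alpha> * multi_power x \<alpha>)" "(\<Sum>\<alpha> | sum \<alpha> UNIV = m. norm (c \<alpha>)) \<le> A"
    and d: "\<forall>x. g x = (\<Sum>\<alpha> | sum \<alpha> UNIV = m. d \<alpha> * multi_power x \<alpha>)" "(\<Sum>\<alpha> | sum \<alpha> UNIV = m. norm (d \<alpha>)) \<le> B"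
  have "(\<Sum>\<alpha> | sum \<alpha> UNIV = m. norm (c \<alpha> + d \<alpha>)) \<le> (\<Sum>\<alpha> | sum \<alpha> UNIV = m. norm (c \<alpha>) + norm (d \<alpha>))"
    by (intro sum_mono norm_triangle_ineq)
  then show "\<exists>e. (\<forall>x. f x + g x = (\<Sum>\<alpha> | sum \<alpha> UNIV = m. e \<alpha> * multi_power x \<alpha>)) \<and>
      (\<Sum>\<alpha> | sum \<alpha> UNIV = m. norm (e \<alpha>)) \<le> A + B"
    using c d by (intro exI[of _ "\<lambda>\<alpha>. c \<alpha> + d \<alpha>"]) (auto simp: distrib_right sum.distrib)
qed

lemma hpb_cmult: "hpb m f A \<Longrightarrow> hpb m (\<lambda>x. k * f x) (norm k * A)"
  unfolding hpb_def
proof (elim exE conjE)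
  fix c
  assume c: "\<forall>x. f x = (\<Sum>\<alpha> | sum \<alpha> UNIV = m. c \<alpha> * multi_power x \<alpha>)" "(\<Sum>\<alpha> | sum \<alpha> UNIV = m. norm (c \<alpha>)) \<le> A"
  then show "\<exists>e. (\<forall>x. k * f x = (\<Sum>\<alpha> | sum \<alpha> UNIV = m. e \<alpha> * multi_power x \<alpha>)) \<and>
      (\<Sum>\<alpha> | sum \<alpha> UNIV = m. norm (e \<alpha>)) \<le> norm k * A"
    by (intro exI[of _ "\<lambda>\<alpha>. k * c \<alpha>"])
      (auto simp: norm_mult mult.assoc mult_left_mono simp flip: sum_distrib_left)
qed

lemma hpb_sum: "(\<And>i. i \<in> I \<Longrightarrow> hpb m (f i) (A i)) \<Longrightarrow> hpb m (\<lambda>x. \<Sum>i\<in>I. f i x) (\<Sum>i\<in>I. A i)"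
  by (induction I rule: infinite_finite_induct) (auto intro: hpb_add)

lemma hpb_monomial:
  assumes "sum \<alpha> UNIV = m" shows "hpb m (\<lambda>x. multi_power x \<alpha>) 1"
  unfolding hpb_def
proof (intro exI conjI allI)
  have s: "(\<Sum>\<beta> | sum \<beta> UNIV = m. of_bool (\<beta> = \<alpha>) * f \<beta>) = f \<alpha>" for f :: "_ \<Rightarrow> complex"
    using assms by (subst sum.remove[OF finite_multi_indices, of \<alpha>]) auto
  show "multi_power x \<alpha> = (\<Sum>\<beta> | sum \<beta> UNIV = m. of_bool (\<beta> = \<alpha>) * multi_power x \<beta>)" for x
    by (simp only: s)
  show "(\<Sum>\<beta> | sum \<beta> UNIV = m. norm (of_bool (\<beta> = \<alpha>) :: complex)) \<le> 1"
    using assms by (subst sum.remove[OF finite_multi_indices, of \<alpha>]) auto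
qed

lemma hpb_const: "hpb 0 (\<lambda>x. c) (norm c)"
  using hpb_cmult[OF hpb_monomial[of "\<lambda>_. 0" 0], of c] by (simp add: multi_power_def)

lemma hpb_mult:
  assumes "hpb m f A" "hpb k g B" shows "hpb (m + k) (\<lambda>x. f x * g x) (A * B)"
proof -
  obtain c where c: "\<And>x. f x = (\<Sum>\<alpha> | sum \<alpha> UNIV = m. c \<alpha> * multi_power x \<alpha>)" "(\<Sum>\<alpha> | sum \<alpha> UNIV = m. norm (c \<alpha>)) \<le> A"
    using assms(1) unfolding hpb_def by blast
  obtain d where d: "\<And>x. g x = (\<Sum>\<alpha> | sum \<alpha> UNIV = k. d \<alpha> * multi_power x \<alpha>)" "(\<Sum>\<alpha> | sum \<alpha> UNIV = k. norm (d \<alpha>)) \<le> B"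
    using assms(2) unfolding hpb_def by blast
  have "hpb (m + k) (\<lambda>x. \<Sum>\<alpha> | sum \<alpha> UNIV = m. \<Sum>\<beta> | sum \<beta> UNIV = k. (c \<alpha> * d \<beta>) * multi_power x (\<lambda>i. \<alpha> i + \<beta> i))
     (\<Sum>\<alpha> | sum \<alpha> UNIV = m. \<Sum>\<beta> | sum \<beta> UNIV = k. norm (c \<alpha> * d \<beta>) * 1)"
    by (intro hpb_sum hpb_cmult hpb_monomial) (simp add: sum.distrib)
  also have "(\<lambda>x. \<Sum>\<alpha> | sum \<alpha> UNIV = m. \<Sum>\<beta> | sum \<beta> UNIV = k. (c \<alpha> * d \<beta>) * multi_power x (\<lambda>i. \<alpha> i + \<beta> i)) =
      (\<lambda>x. f x * g x)"
    unfolding c(1) d(1) sum_product multi_power_add by (simp add: mult_ac)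
  finally show ?thesis
  proof (rule hpb_mono)
    have "(\<Sum>\<alpha> | sum \<alpha> UNIV = m. \<Sum>\<beta> | sum \<beta> UNIV = k. norm (c \<alpha> * d \<beta>) * 1) =
        (\<Sum>\<alpha> | sum \<alpha> UNIV = m. norm (c \<alpha>)) * (\<Sum>\<beta> | sum \<beta> UNIV = k. norm (d \<beta>))"
      by (simp add: sum_product norm_mult)
    also have "\<dots> \<le> A * B"
      using c(2) d(2) hpb_nonneg[OF assms(1)] by (intro mult_mono) (auto intro: sum_nonneg)
    finally show "(\<Sum>\<alpha> | sum \<alpha> UNIV = m. \<Sum>\<beta> | sum \<beta> UNIV = k. norm (c \<alpha> * d \<beta>) * 1) \<le> A * B" .
  qed
qed

lemma hpb_power: "hpb m f A \<Longrightarrow> hpb (k * m) (\<lambda>x. f x ^ k) (A ^ k)"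
  by (induction k) (auto intro: hpb_mult hpb_const[of 1, simplified])

lemma hpb_partial:
  assumes "hpb m q A" shows "hpb (m - 1) (partial_derivative i q) (of_nat m * A)"
proof -
  obtain c where c: "\<And>x. q x = (\<Sum>\<alpha> | sum \<alpha> UNIV = m. c \<alpha> * multi_power x \<alpha>)" "(\<Sum>\<alpha> | sum \<alpha> UNIV = m. norm (c \<alpha>)) \<le> A"
    using assms unfolding hpb_def by blast
  have "q = (\<lambda>x. \<Sum>\<alpha> | sum \<alpha> UNIV = m. c \<alpha> * multi_power x \<alpha>)" using c by blast
  then have "partial_derivative i q = (\<lambda>x. \<Sum>\<alpha> | sum \<alpha> UNIV = m. partial_derivative i (\<lambda>x. c \<alpha> * multi_power x \<alpha>) x)"
    by (simp only:) (rule partial_sum[of _ m], auto intro: hp_cmult hp_monomial)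
  also have "\<dots> = (\<lambda>x. \<Sum>\<alpha> | sum \<alpha> UNIV = m. (c \<alpha> * of_nat (\<alpha> i)) * multi_power x (\<alpha>(i := \<alpha> i - 1)))"
    by (simp add: partial_cmult[OF hp_monomial[OF refl]] partial_monomial mult.assoc)
  finally have eq: "partial_derivative i q =
      (\<lambda>x. \<Sum>\<alpha> | sum \<alpha> UNIV = m. (c \<alpha> * of_nat (\<alpha> i)) * multi_power x (\<alpha>(i := \<alpha> i - 1)))" .
  have "hpb (m - 1) (partial_derivative i q) (\<Sum>\<alpha> | sum \<alpha> UNIV = m. norm (c \<alpha> * of_nat (\<alpha> i)))"
    unfolding eq
  proof (intro hpb_sum)
    fix \<alpha> :: "'a \<Rightarrow> nat" assume \<alpha>: "\<alpha> \<in> {\<alpha>. sum \<alpha> UNIV = m}"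
    show "hpb (m - 1) (\<lambda>x. (c \<alpha> * of_nat (\<alpha> i)) * multi_power x (\<alpha>(i := \<alpha> i - 1))) (norm (c \<alpha> * of_nat (\<alpha> i)))"
    proof (cases "\<alpha> i = 0")
      case False
      then show ?thesis
        using hpb_cmult[OF hpb_monomial[OF sum_update_pred[of \<alpha> m i]], of "c \<alpha> * of_nat (\<alpha> i)"] \<alpha> by simp
    qed simp
  qed
  then show ?thesis
  proof (rule hpb_mono)
    have "(\<Sum>\<alpha> | sum \<alpha> UNIV = m. norm (c \<alpha> * of_nat (\<alpha> i))) \<le> (\<Sum>\<alpha> | sum \<alpha> UNIV = m. of_nat m * norm (c \<alpha>))"
    proof (rule sum_mono)
      fix \<alpha> :: "'a \<Rightarrow> nat" assume "\<alpha> \<in> {\<alpha>. sum \<alpha> UNIV = m}"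
      then have "\<alpha> i \<le> m" using member_le_sum[of i UNIV \<alpha>] by auto
      then show "norm (c \<alpha> * of_nat (\<alpha> i)) \<le> of_nat m * norm (c \<alpha>)"
        by (simp add: norm_mult mult.commute mult_right_mono)
    qed
    also have "\<dots> \<le> of_nat m * A"
      using c(2) by (simp add: mult_left_mono flip: sum_distrib_left)
    finally show "(\<Sum>\<alpha> | sum \<alpha> UNIV = m. norm (c \<alpha> * of_nat (\<alpha> i))) \<le> of_nat m * A" .
  qed
qed

subsection \<open>Grouping multi-indices by degree\<close>

lemma has_sum_multi_index_iff:
  "(f has_sum S) (UNIV :: ('n::finite \<Rightarrow> nat) set) \<longleftrightarrow>
   ((\<lambda>(m, \<alpha>). f \<alpha>) has_sum S) (Sigma UNIV (\<lambda>m. {\<alpha>. sum \<alpha> UNIV = m}))"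
  by (rule has_sum_reindex_bij_witness[where i = snd and j = "\<lambda>\<alpha>. (sum \<alpha> UNIV, \<alpha>)"]) auto

lemma has_sum_imp_sums_by_degree:
  fixes f :: "('n::finite \<Rightarrow> nat) \<Rightarrow> 'a::banach"
  assumes "(f has_sum S) UNIV"
  shows "(\<lambda>m. \<Sum>\<alpha> | sum \<alpha> UNIV = m. f \<alpha>) sums S"
proof -
  have "((\<lambda>m. \<Sum>\<alpha> | sum \<alpha> UNIV = m. f \<alpha>) has_sum S) UNIV"
    using assms unfolding has_sum_multi_index_iff
  proof (rule has_sum_SigmaD)
    show "((\<lambda>\<alpha>. case (m, \<alpha>) of (m, \<alpha>) \<Rightarrow> f \<alpha>) has_sum (\<Sum>\<alpha> | sum \<alpha> UNIV = m. f \<alpha>)) {\<alpha>. sum \<alpha> UNIV = m}" for m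
      using has_sum_finite[OF finite_multi_indices, of f m] by simp
  qed
  then show ?thesis by (rule has_sum_imp_sums)
qed

lemma sums_by_degree_imp_has_sum:
  fixes f :: "('n::finite \<Rightarrow> nat) \<Rightarrow> complex"
  assumes abs: "summable (\<lambda>m. \<Sum>\<alpha> | sum \<alpha> UNIV = m. norm (f \<alpha>))"
    and sums: "(\<lambda>m. \<Sum>\<alpha> | sum \<alpha> UNIV = m. f \<alpha>) sums S"
  shows "(f has_sum S) UNIV"
  unfolding has_sum_multi_index_iff
proof (rule has_sum_SigmaI)
  show "((\<lambda>\<alpha>. case (m, \<alpha>) of (m, \<alpha>) \<Rightarrow> f \<alpha>) has_sum (\<Sum>\<alpha> | sum \<alpha> UNIV = m. f \<alpha>)) {\<alpha>. sum \<alpha> UNIV = m}" for m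
    using has_sum_finite[OF finite_multi_indices, of f m] by simp
  have "summable (\<lambda>m. norm (\<Sum>\<alpha> | sum \<alpha> UNIV = m. f \<alpha>))"
    by (rule summable_comparison_test'[OF abs, of 0]) (auto intro: norm_sum)
  then show "((\<lambda>m. \<Sum>\<alpha> | sum \<alpha> UNIV = m. f \<alpha>) has_sum S) UNIV"
    using sums by (rule norm_summable_imp_has_sum)
  have "(\<lambda>p. norm (case p of (m, \<alpha>) \<Rightarrow> f \<alpha>)) summable_on (SIGMA m:UNIV. {\<alpha>. sum \<alpha> UNIV = m})"
    unfolding Infinite_Sum.abs_summable_on_Sigma_iff
    using norm_summable_imp_summable_on[of "\<lambda>m. \<Sum>\<alpha> | sum \<alpha> UNIV = m. norm (f \<alpha>)"] abs
    by (simp add: finite_multi_indices sum_nonneg)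
  then show "(\<lambda>(m, \<alpha>). f \<alpha>) summable_on (SIGMA m:UNIV. {\<alpha>. sum \<alpha> UNIV = m})"
    by (rule abs_summable_summable)
qed

subsection \<open>Local expansions\<close>

text \<open>An expansion of \<open>u\<close> at \<open>a\<close> by degree, with a summable majorant
  on the cube \<open>|h\<^sub>i| \<le> t\<close>. On the cube the majorant
  \<open>A m * t ^ m\<close> is the estimate \<open>hpb_bound\<close>. Local expansions of this kind
  characterize real analyticity, by the two lemmas that follow, but involve an ordinary series
  instead of a sum over multi-indices.\<close>

definition aseries :: "(nat \<Rightarrow> real^'n::finite \<Rightarrow> complex) \<Rightarrow> real \<Rightarrow> real^'n \<Rightarrow> (real^'n \<Rightarrow> complex) \<Rightarrow> bool"
  where "aseries q t a u \<longleftrightarrow> t > 0 \<and> (\<exists>A. (\<forall>m. hpb m (q m) (A m)) \<and> summable (\<lambda>m. A m * t ^ m)) \<and>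
    (\<forall>h. (\<forall>i. \<bar>vec_nth h i\<bar> \<le> t) \<longrightarrow> (\<lambda>m. q m h) sums u (a + h))"

lemma aseriesI:
  assumes "t > 0" "\<And>m. hpb m (q m) (A m)" "summable (\<lambda>m. A m * t ^ m)"
    and "\<And>h. (\<And>i. \<bar>vec_nth h i\<bar> \<le> t) \<Longrightarrow> (\<lambda>m. q m h) sums u (a + h)"
  shows "aseries q t a u"
  using assms unfolding aseries_def by blast

lemma aseries_shrink:
  assumes "aseries q t a u" "0 < s" "s \<le> t" shows "aseries q s a u"
proof -
  obtain A where A: "\<And>m. hpb m (q m) (A m)" "summable (\<lambda>m. A m * t ^ m)"
    using assms(1) unfolding aseries_def by blast
  have "summable (\<lambda>m. A m * s ^ m)"
    using hpb_nonneg[OF A(1)] assms(2,3)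
    by (intro summable_comparison_test'[OF A(2), of 0]) (auto intro!: mult_left_mono power_mono)
  then show ?thesis using A(1) assms unfolding aseries_def by (meson order_trans)
qed

lemma component_abs_le: "\<bar>vec_nth h i\<bar> \<le> norm (h :: real^'n::finite)"
  using component_le_norm_cart by blast

lemma real_analytic_imp_aseries:
  fixes u :: "real^'n::finite \<Rightarrow> complex"
  assumes "real_analytic_on u S" "a \<in> S"
  shows "\<exists>q t. aseries q t a u"
proof -
  obtain r c where r: "r > 0" and c: "\<And>x. x \<in> ball a r \<Longrightarrow> ((\<lambda>\<alpha>. c \<alpha> * multi_power (x - a) \<alpha>) has_sum u x) UNIV"
    using assms unfolding real_analytic_on_def by blast
  define t where "t = r / (2 * CARD('n))"
  have n: "real CARD('n) > 0" by simp
  then have t: "t > 0" "CARD('n) * t < r" using r by (auto simp: t_def divide_simps)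
  have small: "a + h \<in> ball a r" if "\<And>i. \<bar>vec_nth h i\<bar> \<le> t" for h
  proof -
    have "norm h \<le> (\<Sum>i\<in>UNIV. \<bar>vec_nth h i\<bar>)" by (rule norm_le_l1_cart)
    also have "\<dots> \<le> (\<Sum>i\<in>(UNIV::'n set). t)" by (intro sum_mono that)
    finally show ?thesis using t by (simp add: dist_norm)
  qed
  define q where "q = (\<lambda>m h. \<Sum>\<alpha> | sum \<alpha> UNIV = m. c \<alpha> * multi_power h \<alpha>)"
  define A where "A = (\<lambda>m. \<Sum>\<alpha> | sum \<alpha> UNIV = m. norm (c \<alpha>))"
  have "hpb m (q m) (A m)" for m
    unfolding hpb_def q_def A_def by blast
  moreover have "summable (\<lambda>m. A m * t ^ m)"
  proof -
    \<comment> \<open>at the corner of the cube, absolute convergence of the multi-index sum is the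
      majorant\<close>
    let ?h = "\<chi> i::'n. t"
    have "((\<lambda>\<alpha>. c \<alpha> * multi_power ?h \<alpha>) has_sum u (a + ?h)) UNIV"
      using c[OF small[of ?h]] t by simp
    then have "(\<lambda>\<alpha>. norm (c \<alpha> * multi_power ?h \<alpha>)) summable_on UNIV"
      using summable_on_iff_abs_summable_on_complex[of "\<lambda>\<alpha>. c \<alpha> * multi_power ?h \<alpha>" UNIV]
        has_sum_imp_summable by blast
    then obtain T where T: "((\<lambda>\<alpha>. norm (c \<alpha> * multi_power ?h \<alpha>)) has_sum T) UNIV"
      using summable_on_def by blast
    have "norm (c \<alpha> * multi_power ?h \<alpha>) = norm (c \<alpha>) * t ^ sum \<alpha> UNIV" for \<alpha>
      using t by (simp add: multi_power_def norm_mult power_sum norm_power flip: prod_norm)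
    then have "(\<lambda>m. \<Sum>\<alpha> | sum \<alpha> UNIV = m. norm (c \<alpha>) * t ^ sum \<alpha> UNIV) sums T"
      using has_sum_imp_sums_by_degree[OF T] by simp
    moreover have "(\<Sum>\<alpha> | sum \<alpha> UNIV = m. norm (c \<alpha>) * t ^ sum \<alpha> UNIV) = A m * t ^ m" for m
      by (simp add: A_def sum_distrib_right)
    ultimately show ?thesis by (simp add: sums_iff)
  qed
  moreover have "(\<lambda>m. q m h) sums u (a + h)" if "\<And>i. \<bar>vec_nth h i\<bar> \<le> t" for h
    using has_sum_imp_sums_by_degree[OF c[OF small[OF that]]] by (simp add: q_def)
  ultimately have "aseries q t a u" by (rule aseriesI[OF t(1)])
  then show ?thesis by blast
qed

lemma aseries_imp_real_analytic:
  fixes u :: "real^'n::finite \<Rightarrow> complex"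
  assumes "\<And>a. a \<in> S \<Longrightarrow> \<exists>q t. aseries q t a u"
  shows "real_analytic_on u S"
  unfolding real_analytic_on_def
proof
  fix a assume "a \<in> S"
  then obtain q t where "aseries q t a u" using assms by blast
  then obtain A where A: "t > 0" "\<And>m. hpb m (q m) (A m)" "summable (\<lambda>m. A m * t ^ m)"
     and sums: "\<And>h. (\<And>i. \<bar>vec_nth h i\<bar> \<le> t) \<Longrightarrow> (\<lambda>m. q m h) sums u (a + h)"
    unfolding aseries_def by blast
  obtain c where c: "\<And>m x. q m x = (\<Sum>\<alpha> | sum \<alpha> UNIV = m. c m \<alpha> * multi_power x \<alpha>)"
      "\<And>m. (\<Sum>\<alpha> | sum \<alpha> UNIV = m. norm (c m \<alpha>)) \<le> A m"
  proof -
    have "\<forall>m. \<exists>c. (\<forall>x. q m x = (\<Sum>\<alpha> | sum \<alpha> UNIV = m. c \<alpha> * multi_power x \<alpha>)) \<and>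
        (\<Sum>\<alpha> | sum \<alpha> UNIV = m. norm (c \<alpha>)) \<le> A m"
      using A(2) unfolding hpb_def by blast
    from choice[OF this] show ?thesis using that by blast
  qed
  define d where "d = (\<lambda>\<alpha>::'n \<Rightarrow> nat. c (sum \<alpha> UNIV) \<alpha>)"
  have "((\<lambda>\<alpha>. d \<alpha> * multi_power (x - a) \<alpha>) has_sum u x) UNIV" if x: "x \<in> ball a t" for x
  proof (rule sums_by_degree_imp_has_sum)
    have h: "\<bar>(x - a) $ i\<bar> \<le> t" for i
      using component_abs_le[of "x - a" i] x by (simp add: dist_norm norm_minus_commute)
    show "summable (\<lambda>m. \<Sum>\<alpha> | sum \<alpha> UNIV = m. norm (d \<alpha> * multi_power (x - a) \<alpha>))"
    proof (rule summable_comparison_test'[OF A(3), of 0])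
      fix m :: nat
      have "(\<Sum>\<alpha> | sum \<alpha> UNIV = m. norm (d \<alpha> * multi_power (x - a) \<alpha>)) \<le>
          (\<Sum>\<alpha> | sum \<alpha> UNIV = m. norm (c m \<alpha>) * t ^ m)"
        using norm_multi_power_le[of "x - a" t, OF h]
        by (intro sum_mono) (auto simp: norm_mult d_def intro!: mult_left_mono)
      also have "\<dots> \<le> A m * t ^ m"
        unfolding sum_distrib_right[symmetric] using c(2) A(1) by (intro mult_right_mono) auto
      finally show "norm (\<Sum>\<alpha> | sum \<alpha> UNIV = m. norm (d \<alpha> * multi_power (x - a) \<alpha>)) \<le> A m * t ^ m"
        by (simp add: sum_nonneg)
    qed
    have "(\<Sum>\<alpha> | sum \<alpha> UNIV = m. d \<alpha> * multi_power (x - a) \<alpha>) = q m (x - a)" for m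
      unfolding c(1) d_def by (intro sum.cong) auto
    then show "(\<lambda>m. \<Sum>\<alpha> | sum \<alpha> UNIV = m. d \<alpha> * multi_power (x - a) \<alpha>) sums u x"
      using sums[of "x - a"] h by simp
  qed
  then show "\<exists>r>0. \<exists>c. \<forall>x\<in>ball a r. ((\<lambda>\<alpha>. c \<alpha> * multi_power (x - a) \<alpha>) has_sum u x) UNIV"
    using A(1) by blast
qed

subsection \<open>Termwise differentiation\<close>

lemma has_vector_derivative_shift_0:
  assumes "((\<lambda>t. f (t + s)) has_vector_derivative d) (at 0)"
  shows "(f has_vector_derivative d) (at (s::real))"
proof -
  have "((\<lambda>t. f ((t - s) + s)) has_vector_derivative 1 *\<^sub>R d) (at s)"
    by (rule vector_diff_chain_at[of "\<lambda>t. t - s" 1 s "\<lambda>t. f (t + s)" d, unfolded comp_def])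
      (use assms in \<open>auto intro!: derivative_eq_intros\<close>)
  then show ?thesis by simp
qed

lemma has_partial_line:
  assumes "has_partial i q d (h + s *\<^sub>R axis i 1)"
  shows "((\<lambda>t. q (h + t *\<^sub>R axis i 1)) has_vector_derivative d) (at s)"
  by (rule has_vector_derivative_shift_0)
    (use assms in \<open>simp add: has_partial_def algebra_simps\<close>)

lemma summable_termdiff:
  assumes "summable (\<lambda>m. A m * t ^ m)" "0 \<le> s" "s < (t::real)"
  shows "summable (\<lambda>m. of_nat (Suc m) * A (Suc m) * s ^ m)"
proof -
  have "summable (\<lambda>m. diffs A m * s ^ m)"
    by (rule termdiff_converges[of s t]) (use assms powser_inside[OF assms(1)] in auto)
  then show ?thesis by (simp add: diffs_def)
qed

text \<open>On a slightly smaller cube the series of derivatives is dominated by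
  \<open>m A\<^sub>m \<tau>^(m-1)\<close>, so it converges uniformly along a segment in direction
  \<open>i\<close>, and termwise differentiation is allowed.\<close>

lemma aseries_has_partial:
  fixes u :: "real^'n::finite \<Rightarrow> complex" and h :: "real^'n"
  assumes "aseries q t a u" "0 < t'" "t' < t" and h: "\<And>i. \<bar>vec_nth h i\<bar> \<le> t'"
  shows "has_partial i u (\<Sum>m. partial_derivative i (q m) h) (a + h)"
    and "summable (\<lambda>m. partial_derivative i (q m) h)"
proof -
  obtain A where A: "\<And>m. hpb m (q m) (A m)" "summable (\<lambda>m. A m * t ^ m)"
     and sums: "\<And>h. (\<And>i. \<bar>vec_nth h i\<bar> \<le> t) \<Longrightarrow> (\<lambda>m. q m h) sums u (a + h)"
    using assms(1) unfolding aseries_def by blast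
  \<comment> \<open>\<open>\<tau>\<close> is the midpoint of \<open>t'\<close> and \<open>t\<close>,
    and \<open>\<delta>\<close> is the room for moving \<open>h\<close> inside the cube of size
    \<open>\<tau>\<close>\<close>
  define \<delta> where "\<delta> = (t - t') / 2"
  define \<tau> where "\<tau> = (t + t') / 2"
  have dt: "\<delta> > 0" "t' + \<delta> = \<tau>" "\<tau> < t" "0 \<le> \<tau>" using assms by (auto simp: \<delta>_def \<tau>_def field_simps)
  let ?h = "\<lambda>s. h + s *\<^sub>R axis i 1"
  have small: "\<bar>?h s $ j\<bar> \<le> \<tau>" if "\<bar>s\<bar> \<le> \<delta>" for s j
    using h[of j] that dt(1,2) by (auto simp: axis_def)
  let ?S = "{-\<delta>..\<delta>}"
  let ?d = "\<lambda>m s. partial_derivative i (q m) (?h s)"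
  let ?M = "\<lambda>m. of_nat m * A m * \<tau> ^ (m - 1)"
  have M: "summable ?M"
    using summable_termdiff[OF A(2) dt(4,3)] by (subst summable_Suc_iff[symmetric]) simp
  have bound: "norm (?d m s) \<le> ?M m" if "s \<in> ?S" for m s
    by (rule hpb_bound[OF hpb_partial[OF A(1)]]) (use small that in auto)
  have unif: "uniform_limit ?S (\<lambda>n s. \<Sum>m<n. ?d m s) (\<lambda>s. \<Sum>m. ?d m s) sequentially"
    by (rule Weierstrass_m_test[OF bound M])
  have ex_g: "\<exists>g. \<forall>s\<in>?S. (\<lambda>m. q m (?h s)) sums g s \<and>
      (g has_derivative (\<lambda>k. k *\<^sub>R (\<Sum>m. ?d m s))) (at s within ?S)"
  proof (rule has_derivative_series[where f' = "\<lambda>m s k. k *\<^sub>R ?d m s"])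
    fix m s assume "s \<in> ?S"
    have "((\<lambda>s. q m (?h s)) has_vector_derivative ?d m s) (at s)"
      by (rule has_partial_line) (rule has_partial_hp[OF hpb_imp_hp[OF A(1)]])
    then show "((\<lambda>s. q m (?h s)) has_derivative (\<lambda>k. k *\<^sub>R ?d m s)) (at s within ?S)"
      using has_vector_derivative_at_within unfolding has_vector_derivative_def[symmetric] by blast
  next
    fix e :: real assume "e > 0"
    then have "\<forall>\<^sub>F n in sequentially. \<forall>s\<in>?S. dist (\<Sum>m<n. ?d m s) (\<Sum>m. ?d m s) < e"
      using unif unfolding uniform_limit_iff by blast
    then show "\<forall>\<^sub>F n in sequentially. \<forall>s\<in>?S. \<forall>k::real. norm ((\<Sum>m<n. k *\<^sub>R ?d m s) - k *\<^sub>R (\<Sum>m. ?d m s)) \<le> e * norm k"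
    proof (rule eventually_mono, intro ballI allI)
      fix n s and k :: real assume "\<forall>s\<in>?S. dist (\<Sum>m<n. ?d m s) (\<Sum>m. ?d m s) < e" "s \<in> ?S"
      then have "norm ((\<Sum>m<n. ?d m s) - (\<Sum>m. ?d m s)) * norm k \<le> e * norm k"
        by (intro mult_right_mono) (auto simp: dist_norm less_imp_le)
      then show "norm ((\<Sum>m<n. k *\<^sub>R ?d m s) - k *\<^sub>R (\<Sum>m. ?d m s)) \<le> e * norm k"
        by (simp add: mult.commute flip: scaleR_sum_right scaleR_diff_right)
    qed
  next
    show "(0::real) \<in> ?S" using dt by simp
    show "(\<lambda>m. q m (?h 0)) sums u (a + h)" using sums[of h] h assms(3) by (simp add: order_trans[OF h])
  qed simp
  obtain g where g: "\<And>s. s \<in> ?S \<Longrightarrow> (\<lambda>m. q m (?h s)) sums g s"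
      "(g has_vector_derivative (\<Sum>m. ?d m 0)) (at 0 within ?S)"
  proof -
    assume *: "\<And>g. (\<And>s. s \<in> ?S \<Longrightarrow> (\<lambda>m. q m (?h s)) sums g s) \<Longrightarrow>
        (g has_vector_derivative (\<Sum>m. ?d m 0)) (at 0 within ?S) \<Longrightarrow> thesis"
    obtain g where g: "\<forall>s\<in>?S. (\<lambda>m. q m (?h s)) sums g s \<and>
        (g has_derivative (\<lambda>k. k *\<^sub>R (\<Sum>m. ?d m s))) (at s within ?S)"
      using ex_g by blast
    show thesis
      by (rule *[of g]) (use g dt in \<open>auto simp: has_vector_derivative_def dest: bspec[of _ _ 0]\<close>)
  qed
  have g_eq: "g s = u (a + h + s *\<^sub>R axis i 1)" if "s \<in> ?S" for s
  proof -
    have "\<bar>?h s $ j\<bar> \<le> t" for j using small[of s j] that dt by (simp add: abs_le_iff)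
    from sums[OF this] g(1)[OF that] show ?thesis by (simp add: sums_iff add.assoc)
  qed
  have "(g has_vector_derivative (\<Sum>m. ?d m 0)) (at 0)"
    using g(2) dt by (subst (asm) at_within_interior) auto
  then have "((\<lambda>s. u (a + h + s *\<^sub>R axis i 1)) has_vector_derivative (\<Sum>m. ?d m 0)) (at 0)"
  proof (rule has_vector_derivative_transform_within[of _ _ _ _ \<delta>])
    fix s :: real assume "dist s 0 < \<delta>"
    then show "g s = u (a + h + s *\<^sub>R axis i 1)" by (intro g_eq) (auto simp: dist_real_def)
  qed (use dt in auto)
  then show "has_partial i u (\<Sum>m. partial_derivative i (q m) h) (a + h)"
    by (simp add: has_partial_def)
  show "summable (\<lambda>m. partial_derivative i (q m) h)"
    using bound[of 0] dt by (intro summable_comparison_test'[OF M, of 0]) auto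
qed

lemma aseries_partial:
  fixes u :: "real^'n::finite \<Rightarrow> complex"
  assumes "aseries q t a u" "0 < t'" "t' < t"
  shows "aseries (\<lambda>m. partial_derivative i (q (Suc m))) t' a (partial_derivative i u)"
proof -
  obtain A where A: "\<And>m. hpb m (q m) (A m)" "summable (\<lambda>m. A m * t ^ m)"
    using assms(1) unfolding aseries_def by blast
  have "hpb m (partial_derivative i (q (Suc m))) (of_nat (Suc m) * A (Suc m))" for m
    using hpb_partial[OF A(1)[of "Suc m"]] by simp
  moreover have "summable (\<lambda>m. of_nat (Suc m) * A (Suc m) * t' ^ m)"
    using assms by (intro summable_termdiff[OF A(2)]) auto
  moreover have "(\<lambda>m. partial_derivative i (q (Suc m)) h) sums partial_derivative i u (a + h)"
    if "\<And>i. \<bar>vec_nth h i\<bar> \<le> t'" for h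
  proof -
    note P = aseries_has_partial[OF assms that, of i]
    have "partial_derivative i (q 0) h = 0"
      using partial_hp_0[OF hpb_imp_hp[OF A(1)[of 0]]] by simp
    then have "(\<lambda>m. partial_derivative i (q (Suc m)) h) sums (\<Sum>m. partial_derivative i (q m) h)"
      using summable_sums[OF P(2)] by (subst sums_Suc_iff) simp
    then show ?thesis using partial_derivative_eqI[OF P(1)] by simp
  qed
  ultimately show ?thesis by (rule aseriesI[OF assms(2)])
qed

lemma aseries_add:
  assumes "aseries q t a u" "aseries r t a v"
  shows "aseries (\<lambda>m x. q m x + r m x) t a (\<lambda>x. u x + v x)"
proof -
  obtain A where A: "\<And>m. hpb m (q m) (A m)" "summable (\<lambda>m. A m * t ^ m)"
    using assms(1) unfolding aseries_def by blast
  obtain B where B: "\<And>m. hpb m (r m) (B m)" "summable (\<lambda>m. B m * t ^ m)"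
    using assms(2) unfolding aseries_def by blast
  have "hpb m (\<lambda>x. q m x + r m x) (A m + B m)" for m by (intro hpb_add A B)
  moreover have "summable (\<lambda>m. (A m + B m) * t ^ m)"
    using summable_add[OF A(2) B(2)] by (simp add: distrib_right)
  ultimately show ?thesis
    by (rule aseriesI[rotated]) (use assms in \<open>auto simp: aseries_def intro!: sums_add\<close>)
qed

lemma aseries_zero: "t > 0 \<Longrightarrow> aseries (\<lambda>m x. 0) t a (\<lambda>x. 0)"
  unfolding aseries_def by (auto intro!: exI[of _ "\<lambda>_. 0"])

lemma aseries_sum:
  assumes "t > 0" "\<And>i. i \<in> I \<Longrightarrow> aseries (q i) t a (u i)"
  shows "aseries (\<lambda>m x. \<Sum>i\<in>I. q i m x) t a (\<lambda>x. \<Sum>i\<in>I. u i x)"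
  using assms by (induction I rule: infinite_finite_induct) (auto intro: aseries_add aseries_zero)

lemma aseries_laplacian:
  assumes "aseries q t a u" "0 < t'" "t' < t"
  shows "aseries (\<lambda>m. laplacian (q (m + 2))) t' a (laplacian u)"
proof -
  obtain s where s: "t' < s" "s < t" using assms(3) dense by blast
  have "aseries (\<lambda>m. partial_derivative i (partial_derivative i (q (m + 2)))) t' a
      (partial_derivative i (partial_derivative i u))" for i
    using aseries_partial[OF aseries_partial[OF assms(1), of s i] assms(2) s(1), of i] s assms(2) by simp
  then show ?thesis
    unfolding laplacian_def[abs_def] by (intro aseries_sum assms)
qed

lemma aseries_laplacian_iter:
  assumes "aseries q t a u"
  shows "\<exists>t'. aseries (\<lambda>m. (laplacian ^^ p) (q (m + 2 * p))) t' a ((laplacian ^^ p) u)"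
proof (induction p)
  case (Suc p)
  then obtain s where s: "aseries (\<lambda>m. (laplacian ^^ p) (q (m + 2 * p))) s a ((laplacian ^^ p) u)" by blast
  then have "s > 0" by (simp add: aseries_def)
  from aseries_laplacian[OF s, of "s / 2"] this show ?case
    by (intro exI[of _ "s / 2"]) (simp add: add.commute add.left_commute)
qed (use assms in auto)

text \<open>Along a ray both expansions are power series in the radius.\<close>

lemma hp_series_unique:
  assumes "\<delta> > 0" "\<And>m. hp m (q m)" "\<And>m. hp m (r m)"
    and "\<And>x. norm x < \<delta> \<Longrightarrow> (\<lambda>m. q m x) sums u x" "\<And>x. norm x < \<delta> \<Longrightarrow> (\<lambda>m. r m x) sums u x"
  shows "q m x = r m (x :: real^'n::finite)"
proof (rule powser_unique[of "\<delta> / (norm x + 1)" "\<lambda>m. q m x" "\<lambda>s. u (s *\<^sub>R x)" "\<lambda>m. r m x"])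
  show "\<delta> / (norm x + 1) > 0" using assms(1) by (simp add: add_nonneg_pos)
  fix s :: real assume s: "0 \<le> s" "s < \<delta> / (norm x + 1)"
  have "norm (s *\<^sub>R x) \<le> s * (norm x + 1)" using s by (simp add: mult_left_mono)
  also have "\<dots> < \<delta>" using s by (simp add: pos_less_divide_eq add_nonneg_pos)
  finally have sx: "norm (s *\<^sub>R x) < \<delta>" .
  show "(\<lambda>m. q m x * of_real s ^ m) sums u (s *\<^sub>R x)"
    using assms(4)[OF sx] by (simp add: hp_scale[OF assms(2)] mult.commute)
  show "(\<lambda>m. r m x * of_real s ^ m) sums u (s *\<^sub>R x)"
    using assms(5)[OF sx] by (simp add: hp_scale[OF assms(3)] mult.commute)
qed

lemma aseries_hp: "aseries q t a u \<Longrightarrow> hp m (q m)"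
  unfolding aseries_def using hpb_imp_hp by blast

lemma aseries_sums:
  "aseries q t a u \<Longrightarrow> norm h < t \<Longrightarrow> (\<lambda>m. q m h) sums u (a + h)"
  unfolding aseries_def by (meson component_abs_le less_imp_le order_trans)

subsection \<open>Analyticity of algebraic expressions\<close>

definition analytic_at :: "real^'n::finite \<Rightarrow> (real^'n \<Rightarrow> complex) \<Rightarrow> bool"
  where "analytic_at a u \<longleftrightarrow> (\<exists>q t. aseries q t a u)"

lemma analytic_atI: "aseries q t a u \<Longrightarrow> analytic_at a u"
  unfolding analytic_at_def by blast

lemma analytic_at2E:
  assumes "analytic_at a u" "analytic_at a v"
  obtains q r t where "aseries q t a u" "aseries r t a v"
proof -
  obtain q t r s where 1: "aseries q t a u" "aseries r s a v" using assms unfolding analytic_at_def by blast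
  then have "t > 0" "s > 0" by (auto simp: aseries_def)
  with aseries_shrink[OF 1(1), of "min t s"] aseries_shrink[OF 1(2), of "min t s"] that show ?thesis by auto
qed

lemma analytic_at_add: "analytic_at a u \<Longrightarrow> analytic_at a v \<Longrightarrow> analytic_at a (\<lambda>x. u x + v x)"
  by (erule (1) analytic_at2E) (auto intro: analytic_atI aseries_add)

lemma analytic_at_mult:
  assumes "analytic_at a u" "analytic_at a v" shows "analytic_at a (\<lambda>x. u x * v x)"
proof -
  obtain q r t where q: "aseries q t a u" and r: "aseries r t a v" by (rule analytic_at2E[OF assms])
  obtain A where A: "\<And>m. hpb m (q m) (A m)" "summable (\<lambda>m. A m * t ^ m)"
    using q unfolding aseries_def by blast
  obtain B where B: "\<And>m. hpb m (r m) (B m)" "summable (\<lambda>m. B m * t ^ m)"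
    using r unfolding aseries_def by blast
  have t: "t > 0" using q by (simp add: aseries_def)
  have nn: "norm (A m * t ^ m) = A m * t ^ m" "norm (B m * t ^ m) = B m * t ^ m" for m
    using t hpb_nonneg[OF A(1)] hpb_nonneg[OF B(1)] by simp_all
  have hpb: "hpb m (\<lambda>x. \<Sum>i\<le>m. q i x * r (m - i) x) (\<Sum>i\<le>m. A i * B (m - i))" for m
  proof (rule hpb_sum)
    fix i assume "i \<in> {..m}"
    then show "hpb m (\<lambda>x. q i x * r (m - i) x) (A i * B (m - i))"
      using hpb_mult[OF A(1)[of i] B(1)[of "m - i"]] by simp
  qed
  have "summable (\<lambda>m. \<Sum>i\<le>m. (A i * t ^ i) * (B (m - i) * t ^ (m - i)))"
    using Cauchy_product_sums[of "\<lambda>m. A m * t ^ m" "\<lambda>m. B m * t ^ m"] A(2) B(2)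
    unfolding nn by (simp add: sums_iff)
  also have "(\<lambda>m. \<Sum>i\<le>m. (A i * t ^ i) * (B (m - i) * t ^ (m - i))) =
      (\<lambda>m. (\<Sum>i\<le>m. A i * B (m - i)) * t ^ m)"
    unfolding sum_distrib_right
    by (intro ext sum.cong refl) (simp add: power_add[symmetric] mult_ac)
  finally have summ: "summable (\<lambda>m. (\<Sum>i\<le>m. A i * B (m - i)) * t ^ m)" .
  have "(\<lambda>m. \<Sum>i\<le>m. q i h * r (m - i) h) sums (u (a + h) * v (a + h))" if h: "\<And>i. \<bar>vec_nth h i\<bar> \<le> t" for h
  proof -
    have 1: "summable (\<lambda>m. norm (q m h))" "summable (\<lambda>m. norm (r m h))"
      using hpb_bound[OF A(1) h] hpb_bound[OF B(1) h]
      by (intro summable_comparison_test'[OF A(2), of 0] summable_comparison_test'[OF B(2), of 0]; simp)+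
    have "(\<lambda>m. q m h) sums u (a + h)" "(\<lambda>m. r m h) sums v (a + h)"
      using q r h unfolding aseries_def by auto
    then show ?thesis using Cauchy_product_sums[OF 1] by (simp add: sums_iff)
  qed
  then have "aseries (\<lambda>m x. \<Sum>i\<le>m. q i x * r (m - i) x) t a (\<lambda>x. u x * v x)"
    by (rule aseriesI[OF t hpb summ])
  then show ?thesis by (rule analytic_atI)
qed

lemma analytic_at_hp_translate:
  assumes "hp 0 f0" "hp 1 f1" "\<And>h. u (a + h) = f0 h + f1 h"
  shows "analytic_at a u"
proof -
  let ?q = "\<lambda>m. if m = 0 then f0 else if m = 1 then f1 else (\<lambda>x. 0)"
  obtain A B where AB: "hpb 0 f0 A" "hpb 1 f1 B" using hp_imp_hpb assms by metis
  let ?A = "\<lambda>m::nat. if m = 0 then A else if m = 1 then B else 0"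
  have "hpb m (?q m) (?A m)" for m using AB by auto
  moreover have "summable (\<lambda>m. ?A m * 1 ^ m)"
    by (rule summable_finite[of "{0,1}"]) auto
  moreover have "(\<lambda>m. ?q m h) sums u (a + h)" for h
    using sums_finite[of "{0,1}" "\<lambda>m. ?q m h"] assms(3) by simp
  ultimately have "aseries ?q 1 a u" by (rule aseriesI[OF zero_less_one])
  then show ?thesis by (rule analytic_atI)
qed

lemma analytic_at_const: "analytic_at a (\<lambda>x. c)"
  by (rule analytic_at_hp_translate[of "\<lambda>_. c" "\<lambda>_. 0"]) auto

lemma analytic_at_coord: "analytic_at a (\<lambda>x. of_real (x $ i))"
  by (rule analytic_at_hp_translate[OF hp_const hp_coord]) simp

lemma analytic_at_sum: "(\<And>i. i \<in> I \<Longrightarrow> analytic_at a (u i)) \<Longrightarrow> analytic_at a (\<lambda>x. \<Sum>i\<in>I. u i x)"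
  by (induction I rule: infinite_finite_induct) (auto intro: analytic_at_add analytic_at_const)

lemma analytic_at_power: "analytic_at a u \<Longrightarrow> analytic_at a (\<lambda>x. u x ^ k)"
  by (induction k) (auto intro: analytic_at_mult analytic_at_const)

lemma analytic_at_diff: "analytic_at a u \<Longrightarrow> analytic_at a v \<Longrightarrow> analytic_at a (\<lambda>x. u x - v x)"
  using analytic_at_add[of a u "\<lambda>x. (-1) * v x"] analytic_at_mult[OF analytic_at_const, of a v "-1"] by simp

lemma analytic_at_sqnorm: "analytic_at a sqnorm"
  unfolding sqnorm_eq[abs_def] by (intro analytic_at_sum analytic_at_mult analytic_at_coord)

lemma analytic_at_cdot: "analytic_at a (\<lambda>x. cdot x b)"
  unfolding cdot_eq by (intro analytic_at_sum analytic_at_mult analytic_at_coord analytic_at_const)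

text \<open>The increment of \<open>D\<close> is the sum of a linear and a quadratic form, so
  \<open>sums_quadratic_regroup\<close> orders the Taylor series of \<open>f\<close> at
  \<open>D a\<close> by the degree in \<open>h\<close>. Applied to the majorants \<open>B t\<close>
  and \<open>C t\<^sup>2\<close> of the two forms, the same lemma gives the summable majorant.\<close>

lemma analytic_at_compose_quadratic:
  fixes D :: "real^'n::finite \<Rightarrow> complex"
  assumes L: "hp 1 L" "hp 2 M" and D: "\<And>h. D (a + h) = D a + L h + M h"
    and f: "f holomorphic_on ball (D a) \<rho>" "\<rho> > 0"
  shows "analytic_at a (\<lambda>x. f (D x))"
proof -
  obtain B C where BC: "hpb 1 L B" "hpb 2 M C" using hp_imp_hpb L by metis
  then have nn: "B \<ge> 0" "C \<ge> 0" using hpb_nonneg by auto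
  have "((\<lambda>t. B * t + C * t ^ 2) \<longlongrightarrow> B * 0 + C * 0 ^ 2) (at_right 0)" by (intro tendsto_intros)
  then have "\<forall>\<^sub>F t in at_right 0. B * t + C * t ^ 2 < \<rho>" using f(2) by (intro order_tendstoD) auto
  then obtain b where b: "b > 0" "\<And>t. 0 < t \<Longrightarrow> t < b \<Longrightarrow> B * t + C * t ^ 2 < \<rho>"
    unfolding eventually_at_right_field by auto
  define t where "t = b / 2"
  have t: "t > 0" "B * t + C * t ^ 2 < \<rho>" using b(1) b(2)[of t] by (auto simp: t_def)
  define c where "c = (\<lambda>k. (deriv ^^ k) f (D a) / fact k)"
  have c: "(\<lambda>k. c k * z ^ k) sums f (D a + z)" if "norm z < \<rho>" for z
    using holomorphic_power_series[OF f(1), of "D a + z"] that by (simp add: c_def dist_norm)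
  define \<sigma> where "\<sigma> = B * t + C * t ^ 2"
  have \<sigma>: "0 \<le> \<sigma>" "\<sigma> < \<rho>" using nn t by (auto simp: \<sigma>_def)
  have csum: "summable (\<lambda>k. norm (c k) * \<sigma> ^ k)"
  proof -
    obtain r where r: "\<sigma> < r" "r < \<rho>" using \<sigma> dense by blast
    have "summable (\<lambda>k. c k * of_real r ^ k)" using c[of "of_real r"] r \<sigma> by (auto simp: sums_iff)
    from powser_insidea[OF this, of "of_real \<sigma>"] r \<sigma> show ?thesis by (simp add: norm_mult norm_power)
  qed
  define q where "q = (\<lambda>l x. \<Sum>k | 2 * k \<le> l. c (l - k) * of_nat ((l - k) choose k) * (L x ^ (l - 2 * k) * M x ^ k))"
  define A where "A = (\<lambda>l. \<Sum>k | 2 * k \<le> l. norm (c (l - k) * of_nat ((l - k) choose k)) * (B ^ (l - 2 * k) * C ^ k))"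
  have "hpb l (q l) (A l)" for l
    unfolding q_def A_def
  proof (intro hpb_sum hpb_cmult)
    fix k assume "k \<in> {k. 2 * k \<le> l}"
    then show "hpb l (\<lambda>x. L x ^ (l - 2 * k) * M x ^ k) (B ^ (l - 2 * k) * C ^ k)"
      using hpb_mult[OF hpb_power[OF BC(1), of "l - 2 * k"] hpb_power[OF BC(2), of k]] by (simp add: mult.commute)
  qed
  moreover have "summable (\<lambda>l. A l * t ^ l)"
  proof -
    have "summable (\<lambda>m. norm (complex_of_real (norm (c m))) * (norm (complex_of_real (B * t)) + norm (complex_of_real (C * t ^ 2))) ^ m)"
      using csum nn t(1) by (simp add: \<sigma>_def norm_mult norm_power)
    from sums_summable[OF sums_quadratic_regroup[OF this]]
    have "summable (\<lambda>l. \<Sum>k | 2 * k \<le> l. complex_of_real (norm (c (l - k))) * of_nat ((l - k) choose k) *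
       complex_of_real (B * t) ^ (l - 2 * k) * complex_of_real (C * t ^ 2) ^ k)" .
    also have "(\<lambda>l. \<Sum>k | 2 * k \<le> l. complex_of_real (norm (c (l - k))) * of_nat ((l - k) choose k) *
       complex_of_real (B * t) ^ (l - 2 * k) * complex_of_real (C * t ^ 2) ^ k) = (\<lambda>l. of_real (A l * t ^ l))"
    proof
      fix l
      have "norm (c (l - k)) * real ((l - k) choose k) * (B * t) ^ (l - 2 * k) * (C * t ^ 2) ^ k =
          norm (c (l - k) * of_nat ((l - k) choose k)) * (B ^ (l - 2 * k) * C ^ k) * t ^ l" if "2 * k \<le> l" for k
      proof -
        have "t ^ l = t ^ (l - 2 * k) * (t ^ 2) ^ k" using that by (simp flip: power_mult power_add)
        then show ?thesis by (simp add: norm_mult power_mult_distrib)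
      qed
      then have "(\<Sum>k | 2 * k \<le> l. norm (c (l - k)) * real ((l - k) choose k) * (B * t) ^ (l - 2 * k) * (C * t ^ 2) ^ k) =
          A l * t ^ l"
        unfolding A_def sum_distrib_right by (intro sum.cong) auto
      from arg_cong[OF this, of complex_of_real]
      show "(\<Sum>k | 2 * k \<le> l. complex_of_real (norm (c (l - k))) * of_nat ((l - k) choose k) *
         complex_of_real (B * t) ^ (l - 2 * k) * complex_of_real (C * t ^ 2) ^ k) = of_real (A l * t ^ l)"
        by (simp only: of_real_sum of_real_mult of_real_power of_real_of_nat_eq)
    qed
    finally show ?thesis by (simp only: summable_complex_of_real)
  qed
  moreover have "(\<lambda>l. q l h) sums f (D (a + h))" if h: "\<And>i. \<bar>vec_nth h i\<bar> \<le> t" for h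
  proof -
    have n: "norm (L h) \<le> B * t" "norm (M h) \<le> C * t ^ 2"
      using hpb_bound[OF BC(1) h] hpb_bound[OF BC(2) h] by auto
    have "summable (\<lambda>m. norm (c m) * (norm (L h) + norm (M h)) ^ m)"
      using n by (intro summable_comparison_test'[OF csum, of 0]) (auto simp: \<sigma>_def intro!: mult_left_mono power_mono)
    from sums_quadratic_regroup[OF this]
    have "(\<lambda>l. q l h) sums (\<Sum>m. c m * (L h + M h) ^ m)" by (simp add: q_def mult.assoc)
    moreover have "norm (L h + M h) < \<rho>"
      using norm_triangle_ineq[of "L h" "M h"] n \<sigma> by (simp add: \<sigma>_def)
    ultimately show ?thesis using c[of "L h + M h"] D[of h] by (simp add: sums_iff add.assoc)
  qed
  ultimately have "aseries q t a (\<lambda>x. f (D x))" by (rule aseriesI[OF t(1)])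
  then show ?thesis by (rule analytic_atI)
qed

subsection \<open>Identity theorem along rays\<close>

text \<open>The identity theorem for a function on a half-open interval that is locally the
  restriction of holomorphic functions: the set of points near which it vanishes is open and closed
  in the interval.\<close>

lemma holomorphic_identity_interval:
  fixes g :: "real \<Rightarrow> complex"
  assumes loc: "\<And>t0. 0 \<le> t0 \<Longrightarrow> t0 < T \<Longrightarrow> \<exists>\<delta>>0. \<exists>F. F holomorphic_on ball 0 \<delta> \<and>
      (\<forall>s. \<bar>s\<bar> < \<delta> \<longrightarrow> 0 \<le> t0 + s \<longrightarrow> t0 + s < T \<longrightarrow> g (t0 + s) = F (of_real s))"
    and "\<epsilon> > 0" and zero: "\<And>s. 0 \<le> s \<Longrightarrow> s < \<epsilon> \<Longrightarrow> g s = 0"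
    and s: "0 \<le> s" "s < T"
  shows "g s = 0"
proof -
  define P where "P = (\<lambda>t0. \<exists>\<delta>>0. \<forall>s. \<bar>s - t0\<bar> < \<delta> \<longrightarrow> 0 \<le> s \<longrightarrow> s < T \<longrightarrow> g s = 0)"
  have "P s"
  proof (rule connected_induction_simple[of "{0..<T}" 0])
    show "P 0" unfolding P_def using assms(2) zero by (intro exI[of _ \<epsilon>]) auto
    show "0 \<in> {0..<T}" "s \<in> {0..<T}" using s by auto
    fix t0 assume t0: "t0 \<in> {0..<T}"
    then obtain \<delta> F where \<delta>: "\<delta> > 0" and F: "F holomorphic_on ball 0 \<delta>"
      "\<And>s. \<bar>s\<bar> < \<delta> \<Longrightarrow> 0 \<le> t0 + s \<Longrightarrow> t0 + s < T \<Longrightarrow> g (t0 + s) = F (of_real s)"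
      using loc[of t0] by auto
    let ?N = "{0..<T} \<inter> ball t0 \<delta>"
    have imp: "P y" if x: "x \<in> ?N" "P x" and y: "y \<in> ?N" for x y
    proof -
      obtain d where d: "d > 0" "\<And>s. \<bar>s - x\<bar> < d \<Longrightarrow> 0 \<le> s \<Longrightarrow> s < T \<Longrightarrow> g s = 0"
        using x(2) unfolding P_def by blast
      define e where "e = min d (min (T - x) (\<delta> - (x - t0)))"
      have e: "e > 0" using d x by (auto simp: e_def dist_real_def)
      define U where "U = (\<lambda>r. complex_of_real (x - t0 + r)) ` {0<..<e}"
      have F0: "F z = 0" if "z \<in> ball 0 \<delta>" for z
      proof (rule analytic_continuation[OF F(1)])
        show "U \<subseteq> ball 0 \<delta>"
        proof
          fix z assume "z \<in> U"
          then obtain r where r: "0 < r" "r < e" "z = of_real (x - t0 + r)" by (auto simp: U_def)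
          then have "\<bar>x - t0 + r\<bar> < \<delta>" using x by (auto simp: e_def dist_real_def)
          then show "z \<in> ball 0 \<delta>" unfolding r(3) by (simp del: of_real_add of_real_diff)
        qed
        show "complex_of_real (x - t0) \<in> ball 0 \<delta>"
          using x by (simp add: dist_real_def abs_minus_commute del: of_real_diff)
        show "complex_of_real (x - t0) islimpt U"
          unfolding islimpt_approachable
        proof (intro allI impI)
          fix \<eta> :: real assume "\<eta> > 0"
          let ?r = "min (e / 2) (\<eta> / 2)"
          have "of_real (x - t0 + ?r) \<in> U" using e \<open>\<eta> > 0\<close> unfolding U_def by (intro imageI) auto
          moreover have "complex_of_real (x - t0 + ?r) \<noteq> of_real (x - t0)"
            unfolding of_real_eq_iff using e \<open>\<eta> > 0\<close> by auto
          moreover have "dist (complex_of_real (x - t0 + ?r)) (of_real (x - t0)) < \<eta>"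
            using e \<open>\<eta> > 0\<close> by (simp only: dist_of_real dist_real_def)
          ultimately show "\<exists>x'\<in>U. x' \<noteq> of_real (x - t0) \<and> dist x' (of_real (x - t0)) < \<eta>" by blast
        qed
        fix z assume "z \<in> U"
        then obtain r where r: "0 < r" "r < e" "z = of_real (x - t0 + r)" by (auto simp: U_def)
        have "F (of_real (x - t0 + r)) = g (t0 + (x - t0 + r))"
          using r x by (intro F(2)[symmetric]) (auto simp: e_def dist_real_def)
        also have "\<dots> = 0" using r x by (intro d(2)) (auto simp: e_def)
        finally show "F z = 0" using r(3) by simp
      qed (use that in auto)
      define d' where "d' = \<delta> - \<bar>y - t0\<bar>"
      have "d' > 0" using y by (auto simp: d'_def dist_real_def)
      moreover have "g s = 0" if "\<bar>s - y\<bar> < d'" "0 \<le> s" "s < T" for s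
      proof -
        have "\<bar>s - t0\<bar> < \<delta>" using that(1) by (auto simp: d'_def)
        moreover from this have "of_real (s - t0) \<in> ball (0::complex) \<delta>" by (simp del: of_real_diff)
        ultimately show ?thesis using F(2)[of "s - t0"] F0[of "of_real (s - t0)"] that by auto
      qed
      ultimately show ?thesis unfolding P_def by blast
    qed
    have "openin (top_of_set {0..<T}) ?N" "t0 \<in> ?N"
      using t0 \<delta> by (auto intro: openin_open_Int)
    with imp show "\<exists>N. openin (top_of_set {0..<T}) N \<and> t0 \<in> N \<and> (\<forall>x\<in>N. \<forall>y\<in>N. P x \<longrightarrow> P y)"
      by blast
  qed simp
  then show ?thesis unfolding P_def using s by auto
qed

lemma aseries_line_holomorphic:
  assumes "aseries q t a u"
  shows "\<exists>\<delta>>0. \<exists>F. F holomorphic_on ball 0 \<delta> \<and> (\<forall>s::real. \<bar>s\<bar> < \<delta> \<longrightarrow> u (a + s *\<^sub>R x) = F (of_real s))"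
proof -
  obtain A where A: "t > 0" "\<And>m. hpb m (q m) (A m)" "summable (\<lambda>m. A m * t ^ m)"
    and sums: "\<And>h. (\<And>i. \<bar>vec_nth h i\<bar> \<le> t) \<Longrightarrow> (\<lambda>m. q m h) sums u (a + h)"
    using assms unfolding aseries_def by blast
  define \<delta> where "\<delta> = t / (norm x + 1)"
  have \<delta>: "\<delta> > 0" "\<delta> * norm x \<le> t"
    using A(1) by (auto simp: \<delta>_def add_nonneg_pos divide_simps intro!: mult_left_mono)
  define F where "F = (\<lambda>z. \<Sum>m. q m x * z ^ m)"
  have F: "(\<lambda>m. q m x * z ^ m) sums F z" if "norm z < \<delta>" for z
    unfolding F_def
  proof (intro summable_sums summable_comparison_test'[OF A(3), of 0])
    fix m
    have "norm (q m x * z ^ m) \<le> A m * norm x ^ m * norm z ^ m"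
      using hpb_bound[OF A(2) component_abs_le] by (simp add: norm_mult norm_power mult_right_mono)
    also have "\<dots> = A m * (norm z * norm x) ^ m" by (simp add: power_mult_distrib mult_ac)
    also have "\<dots> \<le> A m * t ^ m"
    proof (intro mult_left_mono power_mono)
      have "norm z * norm x \<le> \<delta> * norm x" using that by (intro mult_right_mono) auto
      then show "norm z * norm x \<le> t" using \<delta> by simp
    qed (use hpb_nonneg[OF A(2)] in auto)
    finally show "norm (q m x * z ^ m) \<le> A m * t ^ m" .
  qed
  have "F holomorphic_on ball 0 \<delta>"
    using F by (intro power_series_holomorphic[of 0 \<delta> "\<lambda>m. q m x"]) auto
  moreover have "u (a + s *\<^sub>R x) = F (of_real s)" if s: "\<bar>s\<bar> < \<delta>" for s
  proof -
    have "\<bar>(s *\<^sub>R x) $ i\<bar> \<le> t" for i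
    proof -
      have "\<bar>(s *\<^sub>R x) $ i\<bar> \<le> \<bar>s\<bar> * norm x" using component_abs_le[of "s *\<^sub>R x" i] by simp
      also have "\<dots> \<le> \<delta> * norm x" using s by (intro mult_right_mono) auto
      finally show ?thesis using \<delta> by simp
    qed
    then have "(\<lambda>m. q m (s *\<^sub>R x)) sums u (a + s *\<^sub>R x)" by (rule sums)
    then have "(\<lambda>m. q m x * of_real s ^ m) sums u (a + s *\<^sub>R x)"
      by (simp add: hp_scale[OF hpb_imp_hp[OF A(2)]] mult.commute)
    then show ?thesis using F[of "of_real s"] s by (simp add: sums_iff)
  qed
  ultimately show ?thesis using \<delta>(1) by blast
qed

text \<open>This carries identities from a neighbourhood of the origin to the whole ball.\<close>

lemma real_analytic_ray_identity:
  fixes u :: "real^'n::finite \<Rightarrow> complex"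
  assumes u: "real_analytic_on u (ball 0 1)"
    and F: "F holomorphic_on ball 0 T" and T: "T * norm x \<le> 1"
    and "\<epsilon> > 0" "\<And>s. 0 \<le> s \<Longrightarrow> s < \<epsilon> \<Longrightarrow> u (s *\<^sub>R x) = F (of_real s)"
    and s: "0 \<le> s" "s < T"
  shows "u (s *\<^sub>R x) = F (of_real s)"
proof -
  have loc: "\<exists>\<delta>>0. \<exists>F'. F' holomorphic_on ball 0 \<delta> \<and>
      (\<forall>s. \<bar>s\<bar> < \<delta> \<longrightarrow> 0 \<le> t0 + s \<longrightarrow> t0 + s < T \<longrightarrow>
        u ((t0 + s) *\<^sub>R x) - F (of_real (t0 + s)) = F' (of_real s))" if t0: "0 \<le> t0" "t0 < T" for t0 :: real
  proof -
    have "norm (t0 *\<^sub>R x) < 1"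
    proof (cases "x = 0")
      case False
      then have "t0 * norm x < T * norm x" using t0 by (intro mult_strict_right_mono) auto
      then show ?thesis using T t0 by simp
    qed simp
    then obtain q t where "aseries q t (t0 *\<^sub>R x) u" using real_analytic_imp_aseries[OF u] by force
    from aseries_line_holomorphic[OF this, of x] obtain \<delta> H where H: "\<delta> > 0" "H holomorphic_on ball 0 \<delta>"
      "\<And>s::real. \<bar>s\<bar> < \<delta> \<Longrightarrow> u (t0 *\<^sub>R x + s *\<^sub>R x) = H (of_real s)" by blast
    define d where "d = min \<delta> (T - t0)"
    have "(\<lambda>z. H z - F (of_real t0 + z)) holomorphic_on ball 0 d"
    proof (rule holomorphic_on_diff)
      show "H holomorphic_on ball 0 d" using H(2) by (rule holomorphic_on_subset) (auto simp: d_def)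
      have sub: "of_real t0 + z \<in> ball (0::complex) T" if "z \<in> ball 0 d" for z :: complex
      proof -
        have "norm z < T - t0" using that by (simp add: d_def)
        then show ?thesis using norm_triangle_ineq[of "of_real t0" z] t0 by simp
      qed
      have "(\<lambda>z. of_real t0 + z) holomorphic_on ball 0 d" by (intro holomorphic_intros)
      moreover have "F holomorphic_on (\<lambda>z. of_real t0 + z) ` ball 0 d"
        by (rule holomorphic_on_subset[OF F]) (use sub in blast)
      ultimately have "(F \<circ> (\<lambda>z. of_real t0 + z)) holomorphic_on ball 0 d"
        by (rule holomorphic_on_compose)
      then show "(\<lambda>z. F (of_real t0 + z)) holomorphic_on ball 0 d" by (simp add: comp_def)
    qed
    moreover have "u ((t0 + s) *\<^sub>R x) - F (of_real (t0 + s)) = H (of_real s) - F (of_real t0 + of_real s)"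
      if "\<bar>s\<bar> < d" for s using H(3)[of s] that by (simp add: d_def scaleR_add_left)
    moreover have "d > 0" using H t0 by (simp add: d_def)
    ultimately show ?thesis by blast
  qed
  have "u (s *\<^sub>R x) - F (of_real s) = 0"
    by (rule holomorphic_identity_interval[OF loc assms(4) _ s]) (use assms(5) in auto)
  then show ?thesis by simp
qed

section \<open>Polyharmonic functions expand on the whole ball\<close>

subsection \<open>Integrals of series\<close>

lemma set_integrable_bounded_continuous:
  fixes f :: "real^'n::finite \<Rightarrow> 'b::{banach, second_countable_topology}"
  assumes "A \<in> sets lborel" "A \<subseteq> cball 0 1" "continuous_on UNIV f"
  shows "set_integrable lborel A f"
proof (rule set_integrable_subset[OF _ assms(1,2)])
  show "set_integrable lborel (cball 0 1) f"
    unfolding set_integrable_def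
    by (rule borel_integrable_compact) (use assms(3) continuous_on_subset in auto)
qed

lemma set_integral_norm_le:
  fixes f :: "'a \<Rightarrow> complex" and w :: "'a \<Rightarrow> real"
  assumes "set_integrable M A f" "set_integrable M A w" "\<And>y. y \<in> A \<Longrightarrow> norm (f y) \<le> w y"
  shows "norm (LINT y:A|M. f y) \<le> (LINT y:A|M. w y)"
proof -
  have "norm (LINT y:A|M. f y) \<le> (LINT y|M. norm (indicator A y *\<^sub>R f y))"
    unfolding set_lebesgue_integral_def by (rule integral_norm_bound)
  also have "\<dots> \<le> (LINT y:A|M. w y)"
    unfolding set_lebesgue_integral_def
  proof (rule integral_mono)
    show "integrable M (\<lambda>y. norm (indicator A y *\<^sub>R f y))"
      using assms(1) unfolding set_integrable_def by (rule integrable_norm)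
  qed (use assms in \<open>auto simp: set_integrable_def indicator_def\<close>)
  finally show ?thesis .
qed

lemma set_integral_sums:
  fixes f :: "nat \<Rightarrow> 'a \<Rightarrow> complex" and w :: "'a \<Rightarrow> real"
  assumes f: "\<And>m. set_integrable M A (f m)" and w: "set_integrable M A w"
    and bound: "\<And>m y. y \<in> A \<Longrightarrow> norm (f m y) \<le> B m * w y" and B: "summable B"
    and sums: "\<And>y. y \<in> A \<Longrightarrow> (\<lambda>m. f m y) sums g y"
  shows "set_integrable M A g" "(\<lambda>m. LINT y:A|M. f m y) sums (LINT y:A|M. g y)"
proof -
  let ?f = "\<lambda>m y. indicator A y *\<^sub>R f m y"
  have int: "integrable M (?f m)" for m using f unfolding set_integrable_def .
  have bd: "norm (?f m y) \<le> B m * (indicator A y *\<^sub>R w y)" for m y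
    using bound[of y m] by (auto simp: indicator_def)
  have 1: "AE y in M. summable (\<lambda>m. norm (?f m y))"
  proof (rule AE_I2)
    fix y
    show "summable (\<lambda>m. norm (?f m y))"
      using summable_mult2[OF B, of "indicator A y *\<^sub>R w y"] bd
      by (rule_tac summable_comparison_test'[of "\<lambda>m. B m * (indicator A y *\<^sub>R w y)" 0]) auto
  qed
  have 2: "summable (\<lambda>m. LINT y|M. norm (?f m y))"
  proof (rule summable_comparison_test'[of "\<lambda>m. B m * (LINT y:A|M. w y)" 0])
    show "summable (\<lambda>m. B m * (LINT y:A|M. w y))" by (rule summable_mult2[OF B])
    fix m
    have "norm (LINT y|M. norm (?f m y)) = (LINT y|M. norm (?f m y))" by simp
    also have "\<dots> \<le> (LINT y|M. B m * (indicator A y *\<^sub>R w y))"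
    proof (rule integral_mono)
      show "integrable M (\<lambda>y. norm (?f m y))" using int by (rule integrable_norm)
    qed (use w bd in \<open>auto simp: set_integrable_def\<close>)
    also have "\<dots> = B m * (LINT y:A|M. w y)" by (simp add: set_lebesgue_integral_def)
    finally show "norm (LINT y|M. norm (?f m y)) \<le> B m * (LINT y:A|M. w y)" .
  qed
  have eq: "(\<lambda>y. \<Sum>m. ?f m y) = (\<lambda>y. indicator A y *\<^sub>R g y)"
  proof
    fix y show "(\<Sum>m. ?f m y) = indicator A y *\<^sub>R g y"
      using sums[of y] by (cases "y \<in> A") (auto simp: sums_iff)
  qed
  show "set_integrable M A g"
    using integrable_suminf[OF int 1 2] unfolding eq set_integrable_def .
  show "(\<lambda>m. LINT y:A|M. f m y) sums (LINT y:A|M. g y)"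
    using sums_integral[OF int 1 2] unfolding eq set_lebesgue_integral_def .
qed

subsection \<open>Analytic dependence of integrals on the radius\<close>

text \<open>The arbitrary weight \<open>w\<close> makes this class of integrands stable under
  multiplication by functions affine in \<open>z\<close>: their coefficients, being continuous in
  \<open>y\<close>, are absorbed into the weight.\<close>

definition entire_family :: "(real^'n::finite) set \<Rightarrow> (complex \<Rightarrow> real^'n \<Rightarrow> complex) \<Rightarrow> bool"
  where "entire_family A \<Phi> \<longleftrightarrow> (\<forall>z. continuous_on UNIV (\<Phi> z)) \<and>
    (\<forall>w. continuous_on UNIV w \<longrightarrow> (\<lambda>z. LINT y:A|lborel. w y * \<Phi> z y) holomorphic_on UNIV)"

lemma entire_family_1: "entire_family A (\<lambda>z y. 1)"
  unfolding entire_family_def by auto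

lemma entire_family_mult_linear:
  fixes A :: "(real^'n::finite) set"
  assumes A: "A \<in> sets lborel" "A \<subseteq> cball 0 1" and \<Phi>: "entire_family A \<Phi>"
    and vb: "continuous_on UNIV v" "continuous_on UNIV b"
  shows "entire_family A (\<lambda>z y. (v y + z * b y) * \<Phi> z y)"
  unfolding entire_family_def
proof (intro conjI allI impI)
  have c: "continuous_on UNIV (\<Phi> z)" for z using \<Phi> by (simp add: entire_family_def)
  then show "continuous_on UNIV (\<lambda>y. (v y + z * b y) * \<Phi> z y)" for z
    by (intro continuous_intros vb)
  fix w :: "real^'n \<Rightarrow> complex" assume w: "continuous_on UNIV w"
  have "(LINT y:A|lborel. w y * ((v y + z * b y) * \<Phi> z y)) =
      (LINT y:A|lborel. (w y * v y) * \<Phi> z y) + z * (LINT y:A|lborel. (w y * b y) * \<Phi> z y)" for z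
  proof -
    have "(LINT y:A|lborel. w y * ((v y + z * b y) * \<Phi> z y)) =
      (LINT y:A|lborel. (w y * v y) * \<Phi> z y + z * ((w y * b y) * \<Phi> z y))"
      by (simp add: algebra_simps)
    also have "\<dots> = (LINT y:A|lborel. (w y * v y) * \<Phi> z y) + (LINT y:A|lborel. z * ((w y * b y) * \<Phi> z y))"
      by (intro set_integral_add set_integrable_bounded_continuous A continuous_intros w vb c)
    finally show ?thesis by simp
  qed
  moreover have "(\<lambda>z. LINT y:A|lborel. (w y * v y) * \<Phi> z y) holomorphic_on UNIV"
    "(\<lambda>z. LINT y:A|lborel. (w y * b y) * \<Phi> z y) holomorphic_on UNIV"
    using \<Phi> continuous_on_mult[OF w vb(1)] continuous_on_mult[OF w vb(2)] unfolding entire_family_def by blast+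
  ultimately show "(\<lambda>z. LINT y:A|lborel. w y * ((v y + z * b y) * \<Phi> z y)) holomorphic_on UNIV"
    by (auto intro!: holomorphic_intros)
qed

lemma entire_family_prod:
  assumes A: "A \<in> sets lborel" "A \<subseteq> cball 0 1" and "finite I"
    and vb: "\<And>i. continuous_on UNIV (v i)" "\<And>i. continuous_on UNIV (b i)"
  shows "entire_family A (\<lambda>z y. \<Prod>i\<in>I. (v i y + z * b i y) ^ \<alpha> i)"
  using assms(3)
proof (induction I rule: finite_induct)
  case empty
  show ?case by (simp add: entire_family_1)
next
  case (insert i I)
  have "entire_family A (\<lambda>z y. (v i y + z * b i y) ^ k * (\<Prod>i\<in>I. (v i y + z * b i y) ^ \<alpha> i))" for k
  proof (induction k)
    case (Suc k)
    from entire_family_mult_linear[OF A this vb(1)[of i] vb(2)[of i]] show ?case by (simp add: mult.assoc)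
  qed (use insert in simp)
  then show ?case using insert by simp
qed

text \<open>Near \<open>t0\<close>, the integral of \<open>Z y * u (\<tau> y)\<close> over
  \<open>A\<close> is the restriction of a holomorphic function of \<open>\<tau>\<close>.
  Integrability is included so that integrals over disjoint sets can be added.\<close>

definition holo_integral :: "(real^'n::finite \<Rightarrow> complex) \<Rightarrow> (real^'n \<Rightarrow> complex) \<Rightarrow> real \<Rightarrow> (real^'n) set \<Rightarrow> bool"
  where "holo_integral u Z t0 A \<longleftrightarrow> (\<exists>\<delta>>0. \<exists>F. F holomorphic_on ball 0 \<delta> \<and>
     (\<forall>s. \<bar>s\<bar> < \<delta> \<longrightarrow> set_integrable lborel A (\<lambda>y. Z y * u ((t0 + s) *\<^sub>R y)) \<and>
       (LINT y:A|lborel. Z y * u ((t0 + s) *\<^sub>R y)) = F (of_real s)))"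

lemma holo_integral_Un:
  assumes "holo_integral u Z t0 A" "holo_integral u Z t0 B" "A \<inter> B = {}" "A \<in> sets lborel" "B \<in> sets lborel"
  shows "holo_integral u Z t0 (A \<union> B)"
proof -
  obtain \<delta> F where F: "\<delta> > 0" "F holomorphic_on ball 0 \<delta>"
    "\<And>s. \<bar>s\<bar> < \<delta> \<Longrightarrow> set_integrable lborel A (\<lambda>y. Z y * u ((t0 + s) *\<^sub>R y))"
    "\<And>s. \<bar>s\<bar> < \<delta> \<Longrightarrow> (LINT y:A|lborel. Z y * u ((t0 + s) *\<^sub>R y)) = F (of_real s)"
    using assms(1) unfolding holo_integral_def by blast
  obtain \<epsilon> G where G: "\<epsilon> > 0" "G holomorphic_on ball 0 \<epsilon>"
    "\<And>s. \<bar>s\<bar> < \<epsilon> \<Longrightarrow> set_integrable lborel B (\<lambda>y. Z y * u ((t0 + s) *\<^sub>R y))"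
    "\<And>s. \<bar>s\<bar> < \<epsilon> \<Longrightarrow> (LINT y:B|lborel. Z y * u ((t0 + s) *\<^sub>R y)) = G (of_real s)"
    using assms(2) unfolding holo_integral_def by blast
  have "(\<lambda>z. F z + G z) holomorphic_on ball 0 (min \<delta> \<epsilon>)"
    by (intro holomorphic_on_add holomorphic_on_subset[OF F(2)] holomorphic_on_subset[OF G(2)]) auto
  moreover have "set_integrable lborel (A \<union> B) (\<lambda>y. Z y * u ((t0 + s) *\<^sub>R y)) \<and>
      (LINT y:A\<union>B|lborel. Z y * u ((t0 + s) *\<^sub>R y)) = F (of_real s) + G (of_real s)"
    if "\<bar>s\<bar> < min \<delta> \<epsilon>" for s
    using that F G assms(3-5) by (auto simp: set_integral_Un intro!: set_integrable_Un)
  ultimately show ?thesis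
    unfolding holo_integral_def using F(1) G(1)
    by (intro exI[of _ "min \<delta> \<epsilon>"] conjI exI[of _ "\<lambda>z. F z + G z"]) auto
qed

lemma holo_integral_empty: "holo_integral u Z t0 {}"
  unfolding holo_integral_def by (intro exI[of _ 1] conjI exI[of _ "\<lambda>_. 0"]) (auto simp: set_lebesgue_integral_def)

text \<open>If \<open>A\<close> lies near \<open>y0\<close>, then \<open>\<tau> y\<close> stays in
  the cube of convergence of the expansion of \<open>u\<close> at \<open>t0 y0\<close> for all
  \<open>y\<close> in \<open>A\<close> and all \<open>\<tau>\<close> near \<open>t0\<close>. Since
  the coefficients of the homogeneous parts are controlled, this remains true for complex
  \<open>\<tau>\<close>, and the integral is a uniform limit of entire functions.\<close>

lemma holo_integral_local:
  fixes u :: "real^'n::finite \<Rightarrow> complex"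
  assumes u: "aseries q t (t0 *\<^sub>R y0) u" and Z: "continuous_on UNIV Z" and t0: "0 \<le> t0" "t0 \<le> 1"
    and A: "A \<in> sets lborel" "A \<subseteq> cball 0 1" "A \<subseteq> ball y0 (t / 2)"
  shows "holo_integral u Z t0 A"
proof -
  obtain B where B: "t > 0" "\<And>m. hpb m (q m) (B m)" "summable (\<lambda>m. B m * t ^ m)"
     and sums: "\<And>h. (\<And>i. \<bar>vec_nth h i\<bar> \<le> t) \<Longrightarrow> (\<lambda>m. q m h) sums u (t0 *\<^sub>R y0 + h)"
    using u unfolding aseries_def by blast
  have "\<forall>m. \<exists>c. (\<forall>x. q m x = (\<Sum>\<alpha> | sum \<alpha> UNIV = m. c \<alpha> * multi_power x \<alpha>)) \<and>
        (\<Sum>\<alpha> | sum \<alpha> UNIV = m. norm (c \<alpha>)) \<le> B m"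
    using B(2) unfolding hpb_def by blast
  from choice[OF this] obtain c where
    c: "\<And>m x. q m x = (\<Sum>\<alpha> | sum \<alpha> UNIV = m. c m \<alpha> * multi_power x \<alpha>)"
      "\<And>m. (\<Sum>\<alpha> | sum \<alpha> UNIV = m. norm (c m \<alpha>)) \<le> B m" by blast
  \<comment> \<open>for \<open>\<tau> = t0 + z\<close> the increment is
    \<open>\<tau> y - t0 y0 = t0 (y - y0) + z y\<close>, with components
    \<open>v i y + z * b i y\<close>\<close>
  define v where "v = (\<lambda>(i::'n) (y::real^'n). complex_of_real (t0 * (vec_nth y i - vec_nth y0 i)))"
  define b where "b = (\<lambda>(i::'n) (y::real^'n). complex_of_real (vec_nth y i))"
  define \<Phi> where "\<Phi> = (\<lambda>\<alpha> z y. \<Prod>i\<in>UNIV. (v i y + z * b i y) ^ \<alpha> i)"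
  define Q where "Q = (\<lambda>m z y. \<Sum>\<alpha> | sum \<alpha> UNIV = m. c m \<alpha> * \<Phi> \<alpha> z y)"
  have cont_v: "continuous_on UNIV (v i)" and cont_b: "continuous_on UNIV (b i)" for i
    unfolding v_def b_def by (intro continuous_intros)+
  have ef: "entire_family A (\<Phi> \<alpha>)" for \<alpha>
    unfolding \<Phi>_def by (rule entire_family_prod[OF A(1,2)]) (auto intro: cont_v cont_b)
  then have cont_\<Phi>: "continuous_on UNIV (\<Phi> \<alpha> z)" for \<alpha> z by (simp add: entire_family_def)
  have cont_Q: "continuous_on UNIV (Q m z)" for m z
    unfolding Q_def by (intro continuous_intros cont_\<Phi>)
  have norm_arg: "norm (v i y + z * b i y) \<le> t" if y: "y \<in> A" and z: "norm z < t / 2" for i y z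
  proof -
    have "\<bar>vec_nth (y - y0) i\<bar> \<le> norm (y - y0)" by (rule component_abs_le)
    also have "\<dots> \<le> t / 2" using y A(3) by (auto simp: dist_norm norm_minus_commute)
    finally have d: "\<bar>vec_nth y i - vec_nth y0 i\<bar> \<le> t / 2" by simp
    have "norm (v i y) \<le> 1 * (t / 2)"
      unfolding v_def norm_of_real abs_mult using t0 d by (intro mult_mono) auto
    moreover have "norm (z * b i y) \<le> (t / 2) * 1"
      unfolding norm_mult b_def norm_of_real
      using z y A(2) B(1) component_abs_le[of y i] by (intro mult_mono) auto
    ultimately show ?thesis using norm_triangle_ineq[of "v i y" "z * b i y"] by simp
  qed
  have norm_\<Phi>: "norm (\<Phi> \<alpha> z y) \<le> t ^ sum \<alpha> UNIV" if "y \<in> A" "norm z < t / 2" for \<alpha> y z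
    unfolding \<Phi>_def prod_norm[symmetric] power_sum
    using norm_arg[OF that] by (intro prod_mono) (auto simp: norm_power intro!: power_mono)
  have norm_Q: "norm (Q m z y) \<le> B m * t ^ m" if "y \<in> A" "norm z < t / 2" for m y z
  proof -
    have "norm (Q m z y) \<le> (\<Sum>\<alpha> | sum \<alpha> UNIV = m. norm (c m \<alpha> * \<Phi> \<alpha> z y))"
      unfolding Q_def by (rule norm_sum)
    also have "\<dots> \<le> (\<Sum>\<alpha> | sum \<alpha> UNIV = m. norm (c m \<alpha>) * t ^ m)"
      using norm_\<Phi>[OF that] by (intro sum_mono) (auto simp: norm_mult intro!: mult_left_mono)
    also have "\<dots> \<le> B m * t ^ m"
      unfolding sum_distrib_right[symmetric] using c(2) B(1) by (intro mult_right_mono) auto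
    finally show ?thesis .
  qed
  have intZQ: "set_integrable lborel A (\<lambda>y. Z y * Q m z y)" for m z
    by (intro set_integrable_bounded_continuous A(1,2) continuous_intros Z cont_Q)
  have intZ: "set_integrable lborel A (\<lambda>y. norm (Z y))"
    by (intro set_integrable_bounded_continuous A(1,2) continuous_intros Z)
  let ?G = "\<lambda>m z. LINT y:A|lborel. Z y * Q m z y"
  have hol: "?G m holomorphic_on UNIV" for m
  proof -
    have "?G m z = (\<Sum>\<alpha> | sum \<alpha> UNIV = m. c m \<alpha> * (LINT y:A|lborel. Z y * \<Phi> \<alpha> z y))" for z
    proof -
      have "?G m z = (LINT y:A|lborel. \<Sum>\<alpha> | sum \<alpha> UNIV = m. c m \<alpha> * (Z y * \<Phi> \<alpha> z y))"
        by (simp add: Q_def sum_distrib_left mult.left_commute)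
      also have "\<dots> = (\<Sum>\<alpha> | sum \<alpha> UNIV = m. LINT y:A|lborel. c m \<alpha> * (Z y * \<Phi> \<alpha> z y))"
        unfolding set_lebesgue_integral_def scaleR_sum_right
        by (intro Bochner_Integration.integral_sum set_integrable_bounded_continuous[unfolded set_integrable_def]
            A(1,2) continuous_intros Z cont_\<Phi>)
      finally show ?thesis by simp
    qed
    moreover have "(\<lambda>z. LINT y:A|lborel. Z y * \<Phi> \<alpha> z y) holomorphic_on UNIV" for \<alpha>
      using ef[of \<alpha>] Z unfolding entire_family_def by blast
    ultimately show ?thesis by (auto intro!: holomorphic_intros)
  qed
  let ?M = "\<lambda>m. B m * t ^ m * (LINT y:A|lborel. norm (Z y))"
  have norm_ZQ: "norm (Z y * Q m z y) \<le> (B m * t ^ m) * norm (Z y)" if "y \<in> A" "norm z < t / 2" for y m z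
    using norm_Q[OF that, of m] by (simp add: norm_mult mult.commute mult_left_mono)
  have norm_G: "norm (?G m z) \<le> ?M m" if "z \<in> ball 0 (t / 2)" for m z
  proof -
    have "norm (?G m z) \<le> (LINT y:A|lborel. (B m * t ^ m) * norm (Z y))"
      by (rule set_integral_norm_le[OF intZQ]) (use intZ norm_ZQ that in auto)
    then show ?thesis by simp
  qed
  have M: "summable ?M" by (intro summable_mult2 B(3))
  define F where "F = (\<lambda>z. \<Sum>m. ?G m z)"
  have "F holomorphic_on ball 0 (t / 2)"
  proof (rule holomorphic_uniform_sequence[where f = "\<lambda>n z. \<Sum>m<n. ?G m z"])
    show "(\<lambda>z. \<Sum>m<n. ?G m z) holomorphic_on ball 0 (t / 2)" for n
      by (intro holomorphic_intros holomorphic_on_subset[OF hol]) auto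
    fix z :: complex assume z: "z \<in> ball 0 (t / 2)"
    obtain d where d: "d > 0" "cball z d \<subseteq> ball 0 (t / 2)"
      using open_contains_cball open_ball z by metis
    have "uniform_limit (ball 0 (t / 2)) (\<lambda>n z. \<Sum>m<n. ?G m z) F sequentially"
      unfolding F_def by (rule Weierstrass_m_test[OF norm_G M])
    then show "\<exists>d>0. cball z d \<subseteq> ball 0 (t / 2) \<and> uniform_limit (cball z d) (\<lambda>n z. \<Sum>m<n. ?G m z) F sequentially"
      using d uniform_limit_on_subset by blast
  qed simp
  moreover have "set_integrable lborel A (\<lambda>y. Z y * u ((t0 + s) *\<^sub>R y))"
    "(LINT y:A|lborel. Z y * u ((t0 + s) *\<^sub>R y)) = F (of_real s)" if s: "\<bar>s\<bar> < t / 2" for s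
  proof -
    have sm: "(\<lambda>m. Z y * Q m (of_real s) y) sums (Z y * u ((t0 + s) *\<^sub>R y))" if y: "y \<in> A" for y
    proof -
      define h where "h = t0 *\<^sub>R (y - y0) + s *\<^sub>R y"
      have h: "v i y + of_real s * b i y = of_real (vec_nth h i)" for i
        by (simp add: v_def b_def h_def)
      have "\<bar>vec_nth h i\<bar> \<le> t" for i
        using norm_arg[OF y, of "of_real s" i] s unfolding h by simp
      then have "(\<lambda>m. q m h) sums u (t0 *\<^sub>R y0 + h)" by (rule sums)
      moreover have "t0 *\<^sub>R y0 + h = (t0 + s) *\<^sub>R y" by (simp add: h_def algebra_simps)
      moreover have "q m h = Q m (of_real s) y" for m
        unfolding c(1) Q_def \<Phi>_def h multi_power_def ..
      ultimately show ?thesis by (simp add: sums_mult)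
    qed
    have bd: "norm (Z y * Q m (of_real s) y) \<le> (B m * t ^ m) * norm (Z y)" if "y \<in> A" for m y
      using norm_ZQ[OF that, of "of_real s" m] s by simp
    note S = set_integral_sums[OF intZQ intZ bd B(3) sm]
    show "set_integrable lborel A (\<lambda>y. Z y * u ((t0 + s) *\<^sub>R y))" by (rule S(1))
    show "(LINT y:A|lborel. Z y * u ((t0 + s) *\<^sub>R y)) = F (of_real s)"
      using S(2) by (simp add: F_def sums_iff)
  qed
  ultimately show ?thesis unfolding holo_integral_def using B(1)
    by (intro exI[of _ "t / 2"] conjI exI[of _ F]) auto
qed

text \<open>By compactness the ball is a finite disjoint union of pieces to which
  \<open>holo_integral_local\<close> applies.\<close>

lemma holo_integral_ball:
  fixes u :: "real^'n::finite \<Rightarrow> complex"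
  assumes u: "real_analytic_on u (ball 0 1)" and Z: "continuous_on UNIV Z" and t0: "0 \<le> t0" "t0 < 1"
  shows "holo_integral u Z t0 (ball 0 1)"
proof -
  have "\<exists>r>0. \<forall>A\<in>sets lborel. A \<subseteq> cball 0 1 \<longrightarrow> A \<subseteq> ball y0 r \<longrightarrow> holo_integral u Z t0 A"
    if "y0 \<in> cball 0 1" for y0
  proof -
    have "t0 * norm y0 \<le> t0 * 1" using that t0 by (intro mult_left_mono) auto
    then have "t0 *\<^sub>R y0 \<in> ball 0 1" using t0 by simp
    then obtain q t where "aseries q t (t0 *\<^sub>R y0) u" using real_analytic_imp_aseries[OF u] by blast
    moreover from this have "t > 0" by (simp add: aseries_def)
    ultimately show ?thesis
      using holo_integral_local[OF _ Z t0(1)] t0(2) by (intro exI[of _ "t / 2"]) auto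
  qed
  then obtain r where r: "\<And>y0. y0 \<in> cball 0 1 \<Longrightarrow> r y0 > 0"
    "\<And>y0 A. y0 \<in> cball 0 1 \<Longrightarrow> A \<in> sets lborel \<Longrightarrow> A \<subseteq> cball 0 1 \<Longrightarrow> A \<subseteq> ball y0 (r y0) \<Longrightarrow> holo_integral u Z t0 A"
    by metis
  obtain C where C: "C \<subseteq> cball 0 1" "finite C" "cball 0 1 \<subseteq> (\<Union>y0\<in>C. ball y0 (r y0))"
    using compactE_image[OF compact_cball[of "0::real^'n" 1], of "cball 0 1" "\<lambda>y0. ball y0 (r y0)"] r(1)
    by (metis (no_types, lifting) UN_iff centre_in_ball open_ball subsetI)
  have "holo_integral u Z t0 A" if "A \<in> sets lborel" "A \<subseteq> cball 0 1" "A \<subseteq> (\<Union>y0\<in>D. ball y0 (r y0))" "D \<subseteq> C" for A D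
    using finite_subset[OF that(4) C(2)] that
  proof (induction D arbitrary: A rule: finite_induct)
    case empty
    then show ?case by (simp add: holo_integral_empty)
  next
    case (insert y0 D)
    have "holo_integral u Z t0 ((A - ball y0 (r y0)) \<union> (A \<inter> ball y0 (r y0)))"
    proof (rule holo_integral_Un)
      show "holo_integral u Z t0 (A - ball y0 (r y0))"
        using insert.prems by (intro insert.IH) auto
      show "holo_integral u Z t0 (A \<inter> ball y0 (r y0))"
        using insert.prems C(1) by (intro r(2)[of y0]) auto
    qed (use insert.prems in auto)
    moreover have "(A - ball y0 (r y0)) \<union> (A \<inter> ball y0 (r y0)) = A" by blast
    ultimately show ?case by simp
  qed
  moreover have "ball 0 1 \<subseteq> (\<Union>y0\<in>C. ball y0 (r y0))"
    using C(3) ball_subset_cball order_trans by blast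
  ultimately show ?thesis by simp
qed

lemma analytic_continuous_on:
  fixes u :: "real^'n::finite \<Rightarrow> complex"
  assumes "real_analytic_on u S" "open S" shows "continuous_on S u"
  unfolding continuous_on_eq_continuous_at[OF assms(2)]
proof
  fix a assume "a \<in> S"
  then obtain q t where "aseries q t a u" using real_analytic_imp_aseries[OF assms(1)] by blast
  then obtain A where A: "t > 0" "\<And>m. hpb m (q m) (A m)" "summable (\<lambda>m. A m * t ^ m)"
     and sums: "\<And>h. (\<And>i. \<bar>vec_nth h i\<bar> \<le> t) \<Longrightarrow> (\<lambda>m. q m h) sums u (a + h)"
    unfolding aseries_def by blast
  have le: "\<bar>vec_nth h i\<bar> \<le> t" if "h \<in> ball 0 t" for h i
    using component_abs_le[of h i] that by simp
  have "uniform_limit (ball 0 t) (\<lambda>n h. \<Sum>m<n. q m h) (\<lambda>h. \<Sum>m. q m h) sequentially"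
    by (rule Weierstrass_m_test[OF _ A(3)]) (rule hpb_bound[OF A(2)], rule le)
  then have "continuous_on (ball 0 t) (\<lambda>h. \<Sum>m. q m h)"
    by (rule uniform_limit_theorem[rotated])
      (auto intro!: always_eventually continuous_on_sum continuous_on_hp[OF hpb_imp_hp[OF A(2)]])
  then have "continuous_on (ball 0 t) (\<lambda>h. u (a + h))"
    by (rule continuous_on_eq) (use sums[OF le] in \<open>auto simp: sums_iff\<close>)
  then have "isCont (\<lambda>h. u (a + h)) 0"
    using A(1) by (simp add: continuous_on_eq_continuous_at)
  then have "isCont ((\<lambda>h. u (a + h)) \<circ> (\<lambda>x. x - a)) a"
    by (intro continuous_at_compose) (auto intro: continuous_intros)
  then show "isCont u a" by (simp add: comp_def)
qed

subsection \<open>Moments of expansions\<close>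

text \<open>The part of degree \<open>m\<close> of the sum of all \<open>|x|^(2j) H l j x\<close>
  with \<open>j < p\<close>. The first index of \<open>H\<close> is the degree of the harmonic
  polynomial.\<close>

definition hom_part :: "nat \<Rightarrow> (nat \<Rightarrow> nat \<Rightarrow> real^'n::finite \<Rightarrow> complex) \<Rightarrow> nat \<Rightarrow> real^'n \<Rightarrow> complex"
  where "hom_part p H m x = (\<Sum>j | j < p \<and> 2 * j \<le> m. sqnorm x ^ j * H (m - 2 * j) j x)"

lemma hp_hom_part:
  assumes "\<And>l j. harm l (H l j)" shows "hp m (hom_part p H m)"
  unfolding hom_part_def[abs_def]
proof (intro hp_sum)
  fix j assume "j \<in> {j. j < p \<and> 2 * j \<le> m}"
  then show "hp m (\<lambda>x. sqnorm x ^ j * H (m - 2 * j) j x)"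
    using hp_sqnorm_power[of "m - 2 * j" "H (m - 2 * j) j" j] assms by (auto simp: harm_def)
qed

lemma laplacian_iter_hom_part:
  assumes "\<And>l j. harm l (H l j)" shows "(laplacian ^^ p) (hom_part p H m) = (\<lambda>x. 0)"
proof -
  have "(laplacian ^^ p) (hom_part p H m) =
      (\<lambda>x. \<Sum>j | j < p \<and> 2 * j \<le> m. (laplacian ^^ p) (\<lambda>x. sqnorm x ^ j * H (m - 2 * j) j x) x)"
    unfolding hom_part_def[abs_def]
  proof (rule laplacian_iter_sum[of _ m])
    fix j assume "j \<in> {j. j < p \<and> 2 * j \<le> m}"
    then show "hp m (\<lambda>x. sqnorm x ^ j * H (m - 2 * j) j x)"
      using hp_sqnorm_power[of "m - 2 * j" "H (m - 2 * j) j" j] assms by (auto simp: harm_def)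
  qed
  also have "\<dots> = (\<lambda>x. 0)"
    using laplacian_iter_sqnorm_power_eq_0[OF assms] by (intro ext sum.neutral) auto
  finally show ?thesis .
qed

lemma set_integrable_hp: "hp m q \<Longrightarrow> set_integrable lborel (ball 0 1) q"
  by (rule set_integrable_cball) (rule continuous_on_hp)

lemma bint_sum_hp:
  assumes "finite I" "\<And>i. i \<in> I \<Longrightarrow> hp (m i) (f i)"
  shows "bint (\<lambda>x. \<Sum>i\<in>I. f i x) = (\<Sum>i\<in>I. bint (f i))"
  unfolding bint_def set_lebesgue_integral_def scaleR_sum_right
  by (rule Bochner_Integration.integral_sum) (use set_integrable_hp[OF assms(2)] in \<open>auto simp: set_integrable_def\<close>)

lemma bint_hom_part:
  fixes H :: "nat \<Rightarrow> nat \<Rightarrow> real^'n::finite \<Rightarrow> complex"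
  assumes H: "\<And>l j. harm l (H l j)"
  shows "bint (\<lambda>x. sqnorm x ^ a * (zonal_harmonic l b x * hom_part p H m x)) =
    (\<Sum>j<p. if m = l + 2 * j
       then of_real (CARD('n) * unit_ball_vol (CARD('n)) / (CARD('n) + 2 * l + 2 * (a + j))) * H l j b else 0)"
proof -
  let ?C = "\<lambda>j. of_real (CARD('n) * unit_ball_vol (CARD('n)) / (CARD('n) + 2 * l + 2 * (a + j))) * H l j b"
  have h: "hp (m - 2 * j) (H (m - 2 * j) j)" for j using H by (simp add: harm_def)
  have "bint (\<lambda>x. sqnorm x ^ a * (zonal_harmonic l b x * hom_part p H m x)) =
      bint (\<lambda>x. \<Sum>j | j < p \<and> 2 * j \<le> m. sqnorm x ^ (a + j) * (zonal_harmonic l b x * H (m - 2 * j) j x))"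
    unfolding hom_part_def sum_distrib_left by (simp add: power_add mult_ac)
  also have "\<dots> = (\<Sum>j | j < p \<and> 2 * j \<le> m. bint (\<lambda>x. sqnorm x ^ (a + j) * (zonal_harmonic l b x * H (m - 2 * j) j x)))"
    by (rule bint_sum_hp) (auto intro!: hp_sqnorm_power hp_mult hp_zonal_harmonic h)
  also have "\<dots> = (\<Sum>j | j < p \<and> 2 * j \<le> m. if m = l + 2 * j then ?C j else 0)"
  proof (intro sum.cong refl)
    fix j assume "j \<in> {j. j < p \<and> 2 * j \<le> m}"
    then have j: "2 * j \<le> m" by simp
    show "bint (\<lambda>x. sqnorm x ^ (a + j) * (zonal_harmonic l b x * H (m - 2 * j) j x)) = (if m = l + 2 * j then ?C j else 0)"
    proof (cases "m = l + 2 * j")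
      case True
      then show ?thesis using bint_zonal_harmonic[OF H[of l j], of "a + j" b] by simp
    next
      case False
      then have "m - 2 * j \<noteq> l" using j by auto
      then show ?thesis using bint_zonal_harmonic_orthogonal[OF H[of "m - 2 * j" j]] False by simp
    qed
  qed
  also have "\<dots> = (\<Sum>j<p. if m = l + 2 * j then ?C j else 0)"
    by (rule sum.mono_neutral_left) auto
  finally show ?thesis .
qed

lemma zonal_harmonic_bound:
  assumes "0 < r" "r < (1::real)"
  obtains M where "M > 0" "\<And>l b x. norm b \<le> 1 \<Longrightarrow> norm x \<le> 1 \<Longrightarrow>
    norm (zonal_harmonic l b (x :: real^'n::finite)) \<le> M / r ^ l"
proof -
  obtain M where M: "M > 0" "\<And>l s q. s ^ 2 \<le> q \<Longrightarrow> q \<le> 1 \<Longrightarrow>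
      norm (zonal (CARD('n) / 2) l (of_real s) (of_real q)) \<le> M / r ^ l"
    using zonal_bound[OF assms, of "CARD('n) / 2"] by auto
  have "norm (zonal_harmonic l b x) \<le> M / r ^ l" if "norm b \<le> 1" "norm x \<le> 1" for l and b x :: "real^'n"
    unfolding zonal_harmonic_real
    by (rule M(2)[OF cdot_sqnorm_le]) (use that in \<open>simp add: mult_le_one power_le_one\<close>)
  then show ?thesis using that M(1) by blast
qed

text \<open>Integrating termwise, orthogonality leaves from each homogeneous part only the component
  whose harmonic factor has degree \<open>l\<close>. The factors \<open>\<epsilon>\<close> will be
  powers of a radius or phases of a rotation.\<close>

lemma moment_of_expansion:
  fixes H :: "nat \<Rightarrow> nat \<Rightarrow> real^'n::finite \<Rightarrow> complex"
  assumes H: "\<And>l j. harm l (H l j)"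
    and bound: "\<And>m y. norm y < 1 \<Longrightarrow> norm (\<epsilon> m * hom_part p H m y) \<le> B m" and B: "summable B"
    and sums: "\<And>y. norm y < 1 \<Longrightarrow> (\<lambda>m. \<epsilon> m * hom_part p H m y) sums v y"
  shows "(LINT y:ball 0 1|lborel. sqnorm y ^ a * (zonal_harmonic l b y * v y)) =
    (\<Sum>j<p. \<epsilon> (l + 2 * j) * of_real (CARD('n) * unit_ball_vol (CARD('n)) / (CARD('n) + 2 * l + 2 * (a + j))) * H l j b)"
    (is "?L = ?R")
    and "set_integrable lborel (ball 0 1) (\<lambda>y. sqnorm y ^ a * (zonal_harmonic l b y * v y))"
proof -
  let ?w = "\<lambda>y. sqnorm y ^ a * zonal_harmonic l b y"
  let ?f = "\<lambda>m y. \<epsilon> m * (sqnorm y ^ a * (zonal_harmonic l b y * hom_part p H m y))"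
  have hpw: "hp (l + 2 * a) ?w" by (rule hp_sqnorm_power[OF hp_zonal_harmonic])
  have hpf: "hp (l + m + 2 * a) (?f m)" for m
    by (intro hp_cmult hp_sqnorm_power hp_mult hp_zonal_harmonic hp_hom_part H)
  have 1: "set_integrable lborel (ball 0 1) (?f m)" for m by (rule set_integrable_hp[OF hpf])
  have 2: "set_integrable lborel (ball 0 1) (\<lambda>y. norm (?w y))"
    by (rule set_integrable_bounded_continuous) (auto intro!: continuous_on_norm continuous_on_hp[OF hpw])
  have 3: "norm (?f m y) \<le> B m * norm (?w y)" if "y \<in> ball 0 1" for m y
  proof -
    have "norm (?f m y) = norm (\<epsilon> m * hom_part p H m y) * norm (?w y)" by (simp add: norm_mult)
    also have "\<dots> \<le> B m * norm (?w y)" using bound[of y m] that by (intro mult_right_mono) auto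
    finally show ?thesis .
  qed
  have 4: "(\<lambda>m. ?f m y) sums (sqnorm y ^ a * (zonal_harmonic l b y * v y))" if "y \<in> ball 0 1" for y
    using sums_mult[OF sums[of y], of "?w y"] that by (simp add: mult_ac)
  note S = set_integral_sums[OF 1 2 3 B 4]
  show "set_integrable lborel (ball 0 1) (\<lambda>y. sqnorm y ^ a * (zonal_harmonic l b y * v y))" by (rule S(1))
  let ?C = "\<lambda>j. \<epsilon> (l + 2 * j) * of_real (CARD('n) * unit_ball_vol (CARD('n)) / (CARD('n) + 2 * l + 2 * (a + j))) * H l j b"
  have "(LINT y:ball 0 1|lborel. ?f m y) = (\<Sum>j<p. if m = l + 2 * j then ?C j else 0)" for m
  proof -
    have "(LINT y:ball 0 1|lborel. ?f m y) = \<epsilon> m * bint (\<lambda>y. sqnorm y ^ a * (zonal_harmonic l b y * hom_part p H m y))"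
      by (simp add: bint_def)
    also have "\<dots> = (\<Sum>j<p. if m = l + 2 * j then ?C j else 0)"
      unfolding bint_hom_part[OF H] sum_distrib_left by (intro sum.cong) auto
    finally show ?thesis .
  qed
  moreover have "(\<lambda>m. \<Sum>j<p. if m = l + 2 * j then ?C j else 0) sums (\<Sum>j<p. ?C j)"
  proof (rule sums_sum)
    fix j
    show "(\<lambda>m. if m = l + 2 * j then ?C j else 0) sums ?C j"
      using sums_single[of "l + 2 * j" "\<lambda>_. ?C j"] by simp
  qed
  ultimately show "?L = ?R" using S(2) sums_unique2 by fastforce
qed

subsection \<open>Bounding coefficients\<close>

text \<open>Coefficients of polynomials of bounded degree are controlled by the maximum on an
  interval, with a constant that depends only on the interval and the degree. In
  \<open>P(r\<sigma>) - r\<^sup>p P(\<sigma>)\<close> the term of degree \<open>p\<close> cancels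
  and the other coefficients are multiplied by \<open>r\<^sup>j - r\<^sup>p > 0\<close>, so
  induction applies on the shorter interval where both \<open>\<sigma>\<close> and
  \<open>r\<sigma>\<close> are admissible.\<close>

lemma polynomial_coeff_bound:
  assumes "0 < \<sigma>1" "\<sigma>1 < (\<sigma>2::real)"
  shows "\<exists>C\<ge>0. \<forall>(b::nat \<Rightarrow> complex) M. (\<forall>\<sigma>. \<sigma>1 \<le> \<sigma> \<longrightarrow> \<sigma> \<le> \<sigma>2 \<longrightarrow> norm (\<Sum>j<p. b j * of_real \<sigma> ^ j) \<le> M) \<longrightarrow>
     (\<forall>j<p. norm (b j) \<le> C * M)"
  using assms
proof (induction p arbitrary: \<sigma>1)
  case 0
  then show ?case by auto
next
  case (Suc p)
  \<comment> \<open>the new left end point \<open>r\<sigma>2\<close> is the geometric mean of the old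
    end points\<close>
  define r where "r = sqrt (\<sigma>1 / \<sigma>2)"
  have r: "0 < r" "r < 1" using Suc.prems by (auto simp: r_def)
  have rr: "r * r = \<sigma>1 / \<sigma>2" using Suc.prems by (simp add: r_def)
  define \<sigma>' where "\<sigma>' = r * \<sigma>2"
  have \<sigma>': "0 < \<sigma>'" "\<sigma>' < \<sigma>2" "r * \<sigma>' = \<sigma>1" using r rr Suc.prems by (auto simp: \<sigma>'_def field_simps)
  obtain C where C: "C \<ge> 0" "\<And>(b::nat \<Rightarrow> complex) M j. (\<And>\<sigma>. \<sigma>' \<le> \<sigma> \<Longrightarrow> \<sigma> \<le> \<sigma>2 \<Longrightarrow> norm (\<Sum>j<p. b j * of_real \<sigma> ^ j) \<le> M) \<Longrightarrow>
      j < p \<Longrightarrow> norm (b j) \<le> C * M"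
    using Suc.IH[OF \<sigma>'(1,2)] by blast
  define d where "d = r ^ (p - 1) - r ^ p"
  define K where "K = 2 * C / (if p = 0 then 1 else d)"
  have d: "d > 0" if "p > 0"
    using power_strict_decreasing[of "p - 1" p r] r that by (simp add: d_def)
  have K: "K \<ge> 0" using C(1) d by (auto simp: K_def intro!: divide_nonneg_pos)
  define L where "L = (1 + (\<Sum>j<p. K * \<sigma>2 ^ j)) / \<sigma>2 ^ p"
  have L: "L \<ge> 0" using K Suc.prems by (auto simp: L_def intro!: divide_nonneg_pos add_nonneg_nonneg sum_nonneg)
  show ?case
  proof (intro exI[of _ "K + L"] conjI allI impI)
    show "0 \<le> K + L" using K L by simp
    fix b :: "nat \<Rightarrow> complex" and M j
    assume "\<forall>\<sigma>. \<sigma>1 \<le> \<sigma> \<longrightarrow> \<sigma> \<le> \<sigma>2 \<longrightarrow> norm (\<Sum>j<Suc p. b j * of_real \<sigma> ^ j) \<le> M" and j: "j < Suc p"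
    then have b: "norm (\<Sum>j<Suc p. b j * of_real \<sigma> ^ j) \<le> M" if "\<sigma>1 \<le> \<sigma>" "\<sigma> \<le> \<sigma>2" for \<sigma> using that by blast
    have M: "M \<ge> 0" using b[of \<sigma>2] Suc.prems by (meson less_imp_le norm_ge_zero order_refl order_trans)
    have low: "norm (b j) \<le> K * M" if j: "j < p" for j
    proof -
      have "norm ((of_real (r ^ j - r ^ p)) * b j) \<le> C * (2 * M)"
      proof (rule C(2)[OF _ j])
        fix \<sigma> assume \<sigma>: "\<sigma>' \<le> \<sigma>" "\<sigma> \<le> \<sigma>2"
        have r\<sigma>: "\<sigma>1 \<le> r * \<sigma>" "r * \<sigma> \<le> \<sigma>2" "\<sigma>1 \<le> \<sigma>"
        proof -
          show "\<sigma>1 \<le> r * \<sigma>" using \<sigma> \<sigma>'(3) r mult_left_mono[of \<sigma>' \<sigma> r] by simp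
          moreover have "r * \<sigma> \<le> \<sigma>" using r \<sigma> \<sigma>'(1) by (intro mult_left_le_one_le) auto
          ultimately show "r * \<sigma> \<le> \<sigma>2" "\<sigma>1 \<le> \<sigma>" using \<sigma> by auto
        qed
        have "(\<Sum>j<p. (of_real (r ^ j - r ^ p)) * b j * of_real \<sigma> ^ j) =
            (\<Sum>j<Suc p. b j * of_real (r * \<sigma>) ^ j) - of_real (r ^ p) * (\<Sum>j<Suc p. b j * of_real \<sigma> ^ j)"
          by (simp add: sum_subtractf[symmetric] sum_distrib_left algebra_simps)
        also have "norm \<dots> \<le> M + 1 * M"
        proof (rule order_trans[OF norm_triangle_ineq4], rule add_mono[OF b[OF r\<sigma>(1,2)]])
          show "norm (of_real (r ^ p) * (\<Sum>j<Suc p. b j * of_real \<sigma> ^ j)) \<le> 1 * M"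
            unfolding norm_mult using r b[OF r\<sigma>(3) \<sigma>(2)]
            by (intro mult_mono) (auto simp: norm_power power_le_one)
        qed
        finally show "norm (\<Sum>j<p. (of_real (r ^ j - r ^ p)) * b j * of_real \<sigma> ^ j) \<le> 2 * M" by simp
      qed
      moreover have "d \<le> r ^ j - r ^ p"
        unfolding d_def using power_decreasing[of j "p - 1" r] j r by simp
      ultimately have "d * norm (b j) \<le> C * (2 * M)"
        using d j unfolding norm_mult norm_of_real by (smt (verit) mult_right_mono norm_ge_zero)
      then show ?thesis using d j by (simp add: K_def field_simps)
    qed
    show "norm (b j) \<le> (K + L) * M"
    proof (cases "j < p")
      case True
      then show ?thesis using low[OF True] mult_nonneg_nonneg[OF L M] by (simp add: distrib_right)
    next
      case False
      then have j: "j = p" using j by simp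
      have "b p * of_real \<sigma>2 ^ p = (\<Sum>j<Suc p. b j * of_real \<sigma>2 ^ j) - (\<Sum>j<p. b j * of_real \<sigma>2 ^ j)" by simp
      then have "norm (b p) * \<sigma>2 ^ p = norm ((\<Sum>j<Suc p. b j * of_real \<sigma>2 ^ j) - (\<Sum>j<p. b j * of_real \<sigma>2 ^ j))"
        using Suc.prems by (metis abs_of_pos norm_mult norm_of_real norm_power order_less_trans)
      also have "\<dots> \<le> M + (\<Sum>j<p. K * M * \<sigma>2 ^ j)"
      proof (rule order_trans[OF norm_triangle_ineq4], rule add_mono)
        show "norm (\<Sum>j<Suc p. b j * of_real \<sigma>2 ^ j) \<le> M" using b[of \<sigma>2] Suc.prems by simp
        show "norm (\<Sum>j<p. b j * of_real \<sigma>2 ^ j) \<le> (\<Sum>j<p. K * M * \<sigma>2 ^ j)"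
          by (rule sum_norm_le) (use low Suc.prems in \<open>auto simp: norm_mult norm_power intro!: mult_right_mono\<close>)
      qed
      also have "\<dots> = L * M * \<sigma>2 ^ p"
      proof -
        have "L * \<sigma>2 ^ p = 1 + (\<Sum>j<p. K * \<sigma>2 ^ j)" using Suc.prems by (simp add: L_def)
        moreover have "L * M * \<sigma>2 ^ p = (L * \<sigma>2 ^ p) * M" by (simp add: mult_ac)
        ultimately show ?thesis by (simp add: distrib_right distrib_left sum_distrib_right sum_distrib_left mult_ac)
      qed
      finally have "norm (b p) \<le> L * M" using Suc.prems by simp
      then show ?thesis unfolding j using mult_nonneg_nonneg[OF K M] by (simp add: distrib_right)
    qed
  qed
qed

subsection \<open>The expansion theorem\<close>

lemma laplacian_iter_low:
  assumes "hp m q" "m < 2 * p" shows "(laplacian ^^ p) q = (\<lambda>x. 0)"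
  using assms(2)
proof (induction p)
  case (Suc p)
  show ?case
  proof (cases "m < 2 * p")
    case True
    then show ?thesis using Suc.IH by simp
  next
    case False
    then show ?thesis using laplacian_hp_low[OF hp_laplacian_iter[OF assms(1), of p]] Suc.prems by simp
  qed
qed simp

text \<open>Applying \<open>\<Delta>\<^sup>p\<close> termwise and comparing degrees shows that it
  kills every homogeneous part of \<open>u\<close>, and the Almansi decomposition applies to each
  part.\<close>

lemma polyharmonic_local_expansion:
  fixes u :: "real^'n::finite \<Rightarrow> complex"
  assumes "u \<in> polyharmonic p"
  shows "\<exists>H t. (\<forall>l j. harm l (H l j)) \<and> aseries (hom_part p H) t 0 u"
proof -
  have u: "real_analytic_on u (ball 0 1)" and lap: "\<And>x. norm x < 1 \<Longrightarrow> (laplacian ^^ p) u x = 0"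
    using assms by (auto simp: polyharmonic_def)
  obtain q t where q: "aseries q t 0 u" using real_analytic_imp_aseries[OF u, of 0] by auto
  obtain t' where t': "aseries (\<lambda>m. (laplacian ^^ p) (q (m + 2 * p))) t' 0 ((laplacian ^^ p) u)"
    using aseries_laplacian_iter[OF q] by blast
  then have "t' > 0" by (simp add: aseries_def)
  have "(laplacian ^^ p) (q (m + 2 * p)) x = 0" for m x
  proof (rule hp_series_unique[where q = "\<lambda>m. (laplacian ^^ p) (q (m + 2 * p))" and r = "\<lambda>m x. 0" and u = "\<lambda>x. 0"])
    show "0 < min t' 1" using \<open>t' > 0\<close> by simp
    fix x :: "real^'n" assume "norm x < min t' 1"
    then show "(\<lambda>m. (laplacian ^^ p) (q (m + 2 * p)) x) sums 0"
      using aseries_sums[OF t', of x] lap[of x] by simp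
  qed (use aseries_hp[OF t'] in auto)
  then have "(laplacian ^^ p) (q m) = (\<lambda>x. 0)" for m
    using laplacian_iter_low[OF aseries_hp[OF q]] by (cases "m < 2 * p") (auto dest!: le_Suc_ex simp: not_less add.commute)
  then have "\<forall>m. \<exists>h. (\<forall>j. harm (m - 2 * j) (h j)) \<and> q m = (\<lambda>x. \<Sum>j | j < p \<and> 2 * j \<le> m. sqnorm x ^ j * h j x)"
    using almansi_decomposition[OF aseries_hp[OF q]] by blast
  from choice[OF this] obtain h where h: "\<And>m j. harm (m - 2 * j) (h m j)"
    "\<And>m. q m = (\<lambda>x. \<Sum>j | j < p \<and> 2 * j \<le> m. sqnorm x ^ j * h m j x)" by blast
  define H where "H = (\<lambda>l j. h (l + 2 * j) j)"
  have "harm l (H l j)" for l j using h(1)[of "l + 2 * j" j] by (simp add: H_def)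
  moreover have "hom_part p H = q"
    unfolding hom_part_def[abs_def] h(2) H_def by (auto intro!: ext sum.cong)
  ultimately show ?thesis using q by metis
qed

text \<open>For small \<open>\<rho>\<close> this is termwise integration of the local expansion.
  Both sides are analytic in \<open>\<rho>\<close> on the unit interval, the left one by
  \<open>holo_integral_ball\<close>.\<close>

lemma radial_moment:
  fixes u :: "real^'n::finite \<Rightarrow> complex"
  assumes u: "real_analytic_on u (ball 0 1)" and H: "\<And>l j. harm l (H l j)"
    and ser: "aseries (hom_part p H) t 0 u" and \<rho>: "0 \<le> \<rho>" "\<rho> < 1"
  shows "(LINT y:ball 0 1|lborel. zonal_harmonic l b y * u (\<rho> *\<^sub>R y)) =
    (\<Sum>j<p. of_real \<rho> ^ (l + 2 * j) * of_real (CARD('n) * unit_ball_vol (CARD('n)) / (CARD('n) + 2 * l + 2 * j)) * H l j b)"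
proof -
  let ?c = "\<lambda>j. of_real (CARD('n) * unit_ball_vol (CARD('n)) / (CARD('n) + 2 * l + 2 * j)) :: complex"
  let ?G = "\<lambda>\<rho>. LINT y:ball 0 1|lborel. zonal_harmonic l b y * u (\<rho> *\<^sub>R y)"
  let ?P = "\<lambda>z. \<Sum>j<p. z ^ (l + 2 * j) * ?c j * H l j b"
  have Z: "continuous_on UNIV (zonal_harmonic l b)" by (rule continuous_on_hp[OF hp_zonal_harmonic])
  obtain A where A: "t > 0" "\<And>m. hpb m (hom_part p H m) (A m)" "summable (\<lambda>m. A m * t ^ m)"
     and sums: "\<And>h. (\<And>i. \<bar>vec_nth h i\<bar> \<le> t) \<Longrightarrow> (\<lambda>m. hom_part p H m h) sums u (0 + h)"
    using ser unfolding aseries_def by blast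
  have "?G \<rho> - ?P (of_real \<rho>) = 0"
  proof (rule holomorphic_identity_interval[OF _ A(1) _ \<rho>])
    fix t0 :: real assume t0: "0 \<le> t0" "t0 < 1"
    obtain \<delta> F where F: "\<delta> > 0" "F holomorphic_on ball 0 \<delta>"
      "\<And>s. \<bar>s\<bar> < \<delta> \<Longrightarrow> ?G (t0 + s) = F (of_real s)"
      using holo_integral_ball[OF u Z t0] unfolding holo_integral_def by blast
    have "(\<lambda>z. F z - ?P (of_real t0 + z)) holomorphic_on ball 0 \<delta>"
      by (intro holomorphic_intros F(2))
    then show "\<exists>\<delta>>0. \<exists>F. F holomorphic_on ball 0 \<delta> \<and>
      (\<forall>s. \<bar>s\<bar> < \<delta> \<longrightarrow> 0 \<le> t0 + s \<longrightarrow> t0 + s < 1 \<longrightarrow> ?G (t0 + s) - ?P (of_real (t0 + s)) = F (of_real s))"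
      using F(1,3) by (intro exI[of _ \<delta>] conjI exI[of _ "\<lambda>z. F z - ?P (of_real t0 + z)"]) auto
  next
    fix s :: real assume s: "0 \<le> s" "s < t"
    have small: "\<bar>vec_nth (s *\<^sub>R y) i\<bar> \<le> t" if "norm y < 1" for y :: "real^'n" and i
    proof -
      have "\<bar>vec_nth (s *\<^sub>R y) i\<bar> \<le> s * norm y" using component_abs_le[of "s *\<^sub>R y" i] s by simp
      also have "\<dots> \<le> t * 1" using s that by (intro mult_mono) auto
      finally show ?thesis by simp
    qed
    have eq: "of_real s ^ m * hom_part p H m y = hom_part p H m (s *\<^sub>R y)" for m and y :: "real^'n"
      by (simp add: hp_scale[OF hp_hom_part[OF H]])
    have "(LINT y:ball 0 1|lborel. sqnorm y ^ 0 * (zonal_harmonic l b y * u (s *\<^sub>R y))) =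
      (\<Sum>j<p. of_real s ^ (l + 2 * j) * of_real (CARD('n) * unit_ball_vol (CARD('n)) / (CARD('n) + 2 * l + 2 * (0 + j))) * H l j b)"
    proof (rule moment_of_expansion(1)[OF H])
      show "summable (\<lambda>m. A m * t ^ m)" by (rule A(3))
      fix y :: "real^'n" assume y: "norm y < 1"
      show "norm (of_real s ^ m * hom_part p H m y) \<le> A m * t ^ m" for m
        unfolding eq by (rule hpb_bound[OF A(2) small[OF y]])
      show "(\<lambda>m. of_real s ^ m * hom_part p H m y) sums u (s *\<^sub>R y)"
        unfolding eq using sums[OF small[OF y]] by simp
    qed
    then show "?G s - ?P (of_real s) = 0" by simp
  qed
  then show ?thesis by simp
qed

lemma linear_times_power_bounded:
  fixes a c x :: real
  assumes "0 \<le> x" "x < 1"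
  obtains C where "C \<ge> 0" "\<And>l. \<bar>a + c * real l\<bar> * x ^ l \<le> C"
proof -
  have "(\<lambda>l. real l * x ^ l) \<longlonglongrightarrow> 0" by (rule powser_times_n_limit_0) (use assms in simp)
  moreover have "(\<lambda>l. x ^ l) \<longlonglongrightarrow> 0" by (intro LIMSEQ_power_zero) (use assms in simp)
  ultimately have "(\<lambda>l. \<bar>a * x ^ l + c * (real l * x ^ l)\<bar>) \<longlonglongrightarrow> \<bar>a * 0 + c * 0\<bar>"
    by (intro tendsto_rabs tendsto_add tendsto_mult_left)
  then have "Bseq (\<lambda>l. \<bar>a * x ^ l + c * (real l * x ^ l)\<bar>)"
    by (rule convergent_imp_Bseq[OF convergentI])
  then obtain C where C: "C > 0" "\<And>l. norm \<bar>a * x ^ l + c * (real l * x ^ l)\<bar> \<le> C" by (auto elim: BseqE)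
  have "\<bar>a + c * real l\<bar> * x ^ l \<le> C" for l
  proof -
    have "\<bar>a + c * real l\<bar> * x ^ l = \<bar>(a + c * real l) * x ^ l\<bar>" using assms by (simp add: abs_mult)
    also have "\<dots> \<le> C" using C(2)[of l] by (simp add: algebra_simps)
    finally show ?thesis .
  qed
  then show ?thesis using that C(1) by (meson less_imp_le)
qed

text \<open>Divided by \<open>\<rho>\<^sup>l\<close>, the moment in \<open>radial_moment\<close> is
  a polynomial in \<open>\<sigma> = \<rho>\<^sup>2\<close> of degree below \<open>p\<close> whose
  coefficients are multiples of the values \<open>H l j b\<close>. The moment is bounded in terms of
  the maximum of \<open>u\<close> on a smaller ball and of the zonal harmonic, and
  \<open>polynomial_coeff_bound\<close> separates the coefficients.\<close>

lemma hom_part_growth: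
  fixes u :: "real^'n::finite \<Rightarrow> complex"
  assumes u: "real_analytic_on u (ball 0 1)" and H: "\<And>l j. harm l (H l j)"
    and ser: "aseries (hom_part p H) t 0 u" and \<kappa>: "0 < \<kappa>" "\<kappa> < (1::real)"
  shows "\<exists>C. \<forall>m x. norm x \<le> 1 \<longrightarrow> norm (hom_part p H m x) \<le> C / \<kappa> ^ m"
proof -
  \<comment> \<open>one factor \<open>1 / r\<^sup>l\<close> comes from the zonal harmonics and
    another from dividing by the radius, so \<open>r\<^sup>2 = \<kappa>'\<close>; the gap between
    \<open>\<kappa>\<close> and \<open>\<kappa>'\<close> absorbs the factor
    \<open>n + 2l + 2j\<close>\<close>
  define \<kappa>' where "\<kappa>' = (\<kappa> + 1) / 2"
  have \<kappa>': "\<kappa> < \<kappa>'" "\<kappa>' < 1" "0 < \<kappa>'" using \<kappa> by (auto simp: \<kappa>'_def)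
  define r where "r = sqrt \<kappa>'"
  have r: "0 < r" "r < 1" "r * r = \<kappa>'" using \<kappa>' by (auto simp: r_def)
  define \<rho> where "\<rho> = (r + 1) / 2"
  have \<rho>: "r < \<rho>" "\<rho> < 1" using r by (auto simp: \<rho>_def)
  let ?N = "real CARD('n)" and ?V = "real CARD('n) * unit_ball_vol (CARD('n))"
  have N: "?N > 0" by simp
  then have V: "?V > 0" by (intro mult_pos_pos unit_ball_vol_pos) auto
  let ?c = "\<lambda>l j. ?V / (?N + 2 * real l + 2 * real j)"
  obtain Mz where Mz: "Mz > 0" "\<And>l b x. norm b \<le> 1 \<Longrightarrow> norm x \<le> 1 \<Longrightarrow>
      norm (zonal_harmonic l b (x :: real^'n)) \<le> Mz / r ^ l"
    using zonal_harmonic_bound[OF r(1,2)] by blast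
  have "compact (u ` cball 0 \<rho>)"
    by (intro compact_continuous_image continuous_on_subset[OF analytic_continuous_on[OF u]]) (use \<rho> in auto)
  from compact_imp_bounded[OF this] obtain Mu where "Mu > 0" "\<forall>z\<in>u ` cball 0 \<rho>. norm z \<le> Mu"
    unfolding bounded_pos by blast
  then have Mu: "Mu > 0" "\<And>x. norm x \<le> \<rho> \<Longrightarrow> norm (u x) \<le> Mu" by auto
  define vol where "vol = (LINT y:ball (0::real^'n) 1|lborel. (1::real))"
  have int1: "set_integrable lborel (ball (0::real^'n) 1) (\<lambda>y. c::real)" for c
    by (rule set_integrable_bounded_continuous) auto
  obtain C0 where C0: "C0 \<ge> 0" "\<And>(b::nat \<Rightarrow> complex) M j. (\<And>\<sigma>. r^2 \<le> \<sigma> \<Longrightarrow> \<sigma> \<le> \<rho>^2 \<Longrightarrow>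
      norm (\<Sum>j<p. b j * of_real \<sigma> ^ j) \<le> M) \<Longrightarrow> j < p \<Longrightarrow> norm (b j) \<le> C0 * M"
    using polynomial_coeff_bound[of "r^2" "\<rho>^2" p] r \<rho> by (auto simp: power_strict_mono)
  define W where "W = Mz * Mu * vol"
  have W: "norm (of_real (?c l j) * H l j b) \<le> C0 * (W / \<kappa>' ^ l)" if b: "norm b \<le> 1" and j: "j < p" for l j b
  proof (rule C0(2)[OF _ j])
    fix \<sigma> assume \<sigma>: "r^2 \<le> \<sigma>" "\<sigma> \<le> \<rho>^2"
    define s where "s = sqrt \<sigma>"
    have "r ^ 2 > 0" "\<rho> ^ 2 < 1" using r \<rho> by (auto simp: power_less_one_iff)
    then have "0 < \<sigma>" "\<sigma> < 1" using \<sigma> by linarith+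
    note \<sigma> = \<sigma> this
    have s: "r \<le> s" "s \<le> \<rho>" "s ^ 2 = \<sigma>" "s > 0" "s < 1"
      using \<sigma> r \<rho> real_le_rsqrt[of r \<sigma>] real_le_lsqrt[of \<rho> \<sigma>] unfolding s_def by auto
    let ?S = "\<Sum>j<p. of_real (?c l j) * H l j b * of_real \<sigma> ^ j"
    have "of_real s ^ l * ?S = (\<Sum>j<p. of_real s ^ (l + 2 * j) * of_real (?c l j) * H l j b)"
    proof -
      have "complex_of_real s ^ (l + 2 * j) = of_real s ^ l * of_real \<sigma> ^ j" for j
        by (simp add: power_add power_mult flip: s(3))
      then show ?thesis by (simp add: sum_distrib_left mult_ac)
    qed
    also have "\<dots> = (LINT y:ball 0 1|lborel. zonal_harmonic l b y * u (s *\<^sub>R y))"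
      using radial_moment[OF u H ser, of s l b] s by simp
    finally have eq: "of_real s ^ l * ?S = (LINT y:ball 0 1|lborel. zonal_harmonic l b y * u (s *\<^sub>R y))" .
    have "norm (LINT y:ball 0 1|lborel. zonal_harmonic l b y * u (s *\<^sub>R y)) \<le> (LINT y:ball (0::real^'n) 1|lborel. (Mz / r ^ l) * Mu * 1)"
    proof (rule set_integral_norm_le[OF _ int1])
      show "set_integrable lborel (ball 0 1) (\<lambda>y. zonal_harmonic l b y * u (s *\<^sub>R y))"
        using holo_integral_ball[OF u continuous_on_hp[OF hp_zonal_harmonic], of s l b] s
        unfolding holo_integral_def by (metis abs_zero add.right_neutral less_imp_le)
      fix y :: "real^'n" assume y: "y \<in> ball 0 1"
      have "norm (s *\<^sub>R y) \<le> \<rho> * 1" unfolding norm_scaleR using y s by (intro mult_mono) auto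
      then have "norm (s *\<^sub>R y) \<le> \<rho>" by simp
      then show "norm (zonal_harmonic l b y * u (s *\<^sub>R y)) \<le> Mz / r ^ l * Mu * 1"
        unfolding norm_mult mult_1_right using Mz(2)[OF b, of y l] Mu y Mz(1) r(1)
        by (intro mult_mono) auto
    qed
    also have "\<dots> = W / r ^ l" unfolding W_def vol_def by (subst set_integral_mult_right) simp
    finally have "s ^ l * norm ?S \<le> W / r ^ l" unfolding eq[symmetric] norm_mult norm_power using s by simp
    moreover have "r ^ l * norm ?S \<le> s ^ l * norm ?S" using s r by (intro mult_right_mono power_mono) auto
    ultimately have "r ^ l * norm ?S \<le> W / r ^ l" by linarith
    then show "norm ?S \<le> W / \<kappa>' ^ l"
      unfolding r(3)[symmetric] power_mult_distrib using r by (simp add: field_simps)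
  qed
  obtain C2 where C2: "C2 \<ge> 0" "\<And>l. \<bar>(?N + 2 * p) + 2 * real l\<bar> * (\<kappa> / \<kappa>') ^ l \<le> C2"
    using linear_times_power_bounded[of "\<kappa> / \<kappa>'" "?N + 2 * p" 2] \<kappa> \<kappa>' by auto
  define C1 where "C1 = C0 * W / ?V * C2"
  have W0: "C0 * W \<ge> 0"
  proof -
    have "vol \<ge> 0" unfolding vol_def set_lebesgue_integral_def by (intro integral_nonneg_AE) auto
    then show ?thesis using C0(1) Mz(1) Mu(1) by (simp add: W_def)
  qed
  have C1: "norm (H l j b) \<le> C1 / \<kappa> ^ l" if b: "norm b \<le> 1" and j: "j < p" for l j b
  proof -
    have "?c l j * norm (H l j b) \<le> C0 * W / \<kappa>' ^ l"
      using W[OF b j, of l] V N unfolding norm_mult norm_of_real by simp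
    then have "norm (H l j b) \<le> (C0 * W / \<kappa>' ^ l) * ((?N + 2 * real l + 2 * real j) / ?V)"
    proof -
      have aux: "v / d * X \<le> Y \<Longrightarrow> v > 0 \<Longrightarrow> d > 0 \<Longrightarrow> X \<le> Y * (d / v)" for v d X Y :: real
        by (simp add: field_simps)
      have "?N + 2 * real l + 2 * real j > 0" using N by (intro add_pos_nonneg) auto
      with \<open>?c l j * norm (H l j b) \<le> C0 * W / \<kappa>' ^ l\<close> V show ?thesis by (intro aux)
    qed
    also have "\<dots> \<le> (C0 * W / \<kappa>' ^ l) * (((?N + 2 * p) + 2 * real l) / ?V)"
      using W0 V j \<kappa>' by (intro mult_left_mono divide_right_mono) auto
    also have "\<dots> = C0 * W / ?V * (((?N + 2 * p) + 2 * real l) * (\<kappa> / \<kappa>') ^ l) / \<kappa> ^ l"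
      using \<kappa> \<kappa>' by (simp add: power_divide mult_ac)
    also have "\<dots> \<le> C1 / \<kappa> ^ l"
      unfolding C1_def using C2(2)[of l] W0 V \<kappa> N
      by (intro divide_right_mono mult_left_mono) (auto simp: divide_nonneg_pos)
    finally show ?thesis .
  qed
  have C1_nonneg: "C1 \<ge> 0" unfolding C1_def using W0 V C2(1) by (simp add: divide_nonneg_pos)
  have "norm (hom_part p H m x) \<le> (p * C1) / \<kappa> ^ m" if x: "norm x \<le> 1" for m x
  proof -
    have "norm (hom_part p H m x) \<le> (\<Sum>j | j < p \<and> 2 * j \<le> m. C1 / \<kappa> ^ m)"
      unfolding hom_part_def
    proof (rule sum_norm_le)
      fix j assume "j \<in> {j. j < p \<and> 2 * j \<le> m}"
      then have j: "j < p" "2 * j \<le> m" by auto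
      have "norm (sqnorm x ^ j * H (m - 2 * j) j x) \<le> 1 * (C1 / \<kappa> ^ (m - 2 * j))"
        unfolding norm_mult using x
        by (intro mult_mono C1 j x) (auto simp: sqnorm_def norm_power power_le_one)
      also have "\<dots> \<le> C1 / \<kappa> ^ m"
        using C1_nonneg \<kappa> by (auto intro!: divide_left_mono power_decreasing)
      finally show "norm (sqnorm x ^ j * H (m - 2 * j) j x) \<le> C1 / \<kappa> ^ m" .
    qed
    also have "\<dots> \<le> (\<Sum>j<p. C1 / \<kappa> ^ m)"
      using C1_nonneg \<kappa> by (intro sum_mono2) auto
    finally show ?thesis by simp
  qed
  then show ?thesis by blast
qed

lemma hom_part_scaled_bound:
  fixes H :: "nat \<Rightarrow> nat \<Rightarrow> real^'n::finite \<Rightarrow> complex"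
  assumes H: "\<And>l j. harm l (H l j)" and C: "\<And>m x. norm x \<le> 1 \<Longrightarrow> norm (hom_part p H m x) \<le> C / \<kappa> ^ m"
  shows "norm (hom_part p H m x) \<le> C * (norm x / \<kappa>) ^ m"
proof (cases "x = 0")
  case True
  have hp_zero: "hom_part p H m (0 *\<^sub>R x) = of_real 0 ^ m * hom_part p H m x"
    by (rule hp_scale[OF hp_hom_part[OF H]])
  show ?thesis
    using True C[of x m] hp_zero by (cases m) auto
next
  case False
  have "norm (hom_part p H m x) = norm (hom_part p H m (norm x *\<^sub>R (x /\<^sub>R norm x)))" using False by simp
  also have "\<dots> = norm x ^ m * norm (hom_part p H m (x /\<^sub>R norm x))"
    by (subst hp_scale[OF hp_hom_part[OF H]]) (simp add: norm_mult norm_power)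
  also have "\<dots> \<le> norm x ^ m * (C / \<kappa> ^ m)"
    using C[of "x /\<^sub>R norm x" m] False by (intro mult_left_mono) auto
  finally show ?thesis by (simp add: power_divide mult_ac)
qed

text \<open>A convergent expansion at the origin of a real analytic function need not converge on
  the whole ball; here \<open>hom_part_growth\<close> ensures that it does. On each ray its sum
  extends holomorphically beyond the point in question and agrees with \<open>u\<close> near the
  origin, hence on the ray.\<close>

theorem polyharmonic_expansion:
  fixes u :: "real^'n::finite \<Rightarrow> complex"
  assumes "u \<in> polyharmonic p"
  shows "\<exists>H. (\<forall>l j. harm l (H l j)) \<and>
    (\<forall>\<kappa>. 0 < \<kappa> \<longrightarrow> \<kappa> < 1 \<longrightarrow> (\<exists>C. \<forall>m x. norm (hom_part p H m x) \<le> C * (norm x / \<kappa>) ^ m)) \<and>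
    (\<forall>x. norm x < 1 \<longrightarrow> (\<lambda>m. hom_part p H m x) sums u x)"
proof -
  have u: "real_analytic_on u (ball 0 1)" using assms by (simp add: polyharmonic_def)
  obtain H t where H: "\<And>l j. harm l (H l j)" and ser: "aseries (hom_part p H) t 0 u"
    using polyharmonic_local_expansion[OF assms] by auto
  have t: "t > 0" using ser by (simp add: aseries_def)
  have growth: "\<exists>C. \<forall>m x. norm (hom_part p H m x) \<le> C * (norm x / \<kappa>) ^ m" if \<kappa>: "0 < \<kappa>" "\<kappa> < 1" for \<kappa>
  proof -
    obtain C where "\<And>m x. norm x \<le> 1 \<Longrightarrow> norm (hom_part p H m x) \<le> C / \<kappa> ^ m"
      using hom_part_growth[OF u H ser \<kappa>] by blast
    from hom_part_scaled_bound[OF H this] show ?thesis by blast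
  qed
  have "(\<lambda>m. hom_part p H m x) sums u x" if x: "norm x < 1" for x
  proof (cases "x = 0")
    case True
    then show ?thesis using aseries_sums[OF ser, of 0] t by simp
  next
    case False
    define \<kappa> where "\<kappa> = (1 + norm x) / 2"
    define \<kappa>' where "\<kappa>' = (1 + \<kappa>) / 2"
    have \<kappa>: "norm x < \<kappa>" "\<kappa> < \<kappa>'" "\<kappa>' < 1" "0 < \<kappa>'" using x by (auto simp: \<kappa>_def \<kappa>'_def add_pos_nonneg)
    obtain C where C: "\<And>m x. norm (hom_part p H m x) \<le> C * (norm x / \<kappa>') ^ m" using growth[OF \<kappa>(4,3)] by blast
    define F where "F = (\<lambda>z. \<Sum>m. hom_part p H m x * z ^ m)"
    define T where "T = \<kappa> / norm x"
    have T: "T * norm x = \<kappa>" "T > 1" using False \<kappa> by (auto simp: T_def)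
    have F: "(\<lambda>m. hom_part p H m x * z ^ m) sums F z" if z: "norm z < T" for z
      unfolding F_def
    proof (rule summable_sums, rule summable_comparison_test'[of "\<lambda>m. C * (norm x * norm z / \<kappa>') ^ m" 0])
      have "norm x * norm z < \<kappa>'" using mult_strict_left_mono[OF z, of "norm x"] False T \<kappa> by (simp add: mult.commute)
      then show "summable (\<lambda>m. C * (norm x * norm z / \<kappa>') ^ m)"
        using \<kappa> by (intro summable_mult summable_geometric) (simp add: abs_mult)
      show "norm (hom_part p H m x * z ^ m) \<le> C * (norm x * norm z / \<kappa>') ^ m" for m
        using mult_right_mono[OF C[of m x], of "norm z ^ m"]
        by (simp add: norm_mult norm_power power_mult_distrib power_divide mult_ac)
    qed
    have "u (1 *\<^sub>R x) = F (of_real 1)"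
    proof (rule real_analytic_ray_identity[OF u, where T = T])
      show "F holomorphic_on ball 0 T"
        using F by (intro power_series_holomorphic[of 0 T "\<lambda>m. hom_part p H m x"]) auto
      show "T * norm x \<le> 1" using T \<kappa> by simp
      show "0 < min (t / norm x) T" using t False T by simp
      fix s :: real assume s: "0 \<le> s" "s < min (t / norm x) T"
      then have "norm (s *\<^sub>R x) < t" using False by (simp add: field_simps)
      from aseries_sums[OF ser this] have "(\<lambda>m. hom_part p H m x * of_real s ^ m) sums u (s *\<^sub>R x)"
        by (simp add: hp_scale[OF hp_hom_part[OF H]] mult.commute)
      then show "u (s *\<^sub>R x) = F (of_real s)" using F[of "of_real s"] s by (simp add: sums_iff)
    qed (use T in auto)
    then show ?thesis using F[of 1] T by simp
  qed
  then show ?thesis using H growth by blast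
qed

section \<open>The kernel\<close>

subsection \<open>Closed form and expansion\<close>

text \<open>The image of \<open>zonal_gen\<close> under \<open>t \<partial>/\<partial>t\<close>,
  which multiplies the term of degree \<open>l\<close> by \<open>l\<close>.\<close>

definition zonal_euler :: "real \<Rightarrow> complex \<Rightarrow> complex \<Rightarrow> complex \<Rightarrow> complex"
  where "zonal_euler a s q t = - 2 * t ^ 2 * q * (1 - 2 * t * s + t ^ 2 * q) powr (- of_real a) +
    (1 - t ^ 2 * q) * of_real a * (2 * t * s - 2 * t ^ 2 * q) * (1 - 2 * t * s + t ^ 2 * q) powr (- of_real a - 1)"

lemma zonal_generating_euler:
  fixes s q :: real
  assumes sq: "s ^ 2 \<le> q" and t: "norm t * sqrt q < 1"
  shows "(\<lambda>l. of_nat l * (zonal a l (of_real s) (of_real q) * t ^ l)) sums zonal_euler a (of_real s) (of_real q) t"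
proof -
  have q: "q \<ge> 0" using sq by (smt (verit) zero_le_power2)
  define R where "R = (if q = 0 then norm t + 1 else 1 / sqrt q)"
  have R: "R * sqrt q \<le> 1" "norm t < R" using q t by (auto simp: R_def field_simps)
  let ?F = "zonal_gen a (of_real s) (of_real q)"
  let ?D = "1 - 2 * t * of_real s + t ^ 2 * of_real q"
  have D: "?D \<notin> \<real>\<^sub>\<le>\<^sub>0" by (rule quadratic_not_nonpos[OF sq t])
  let ?F' = "- 2 * t * of_real q * ?D powr (- of_real a) +
     (1 - t ^ 2 * of_real q) * ((- of_real a) * (?D powr (- of_real a - 1)) * (- 2 * of_real s + 2 * t * of_real q))"
  have "(?F has_field_derivative ?F') (at t)"
    unfolding zonal_gen_def
    by (rule derivative_eq_intros refl D)+ (simp add: algebra_simps power2_eq_square)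
  from termdiffs_sums_strong[where K = R, OF zonal_generating[OF sq R(1)] this R(2)]
  have "(\<lambda>l. diffs (\<lambda>l. zonal a l (of_real s) (of_real q)) l * t ^ l) sums ?F'" by simp
  from sums_mult[OF this, of t]
  have "(\<lambda>l. of_nat (Suc l) * (zonal a (Suc l) (of_real s) (of_real q) * t ^ Suc l)) sums (t * ?F')"
    by (simp add: diffs_def mult_ac)
  then have "(\<lambda>l. of_nat l * (zonal a l (of_real s) (of_real q) * t ^ l)) sums (t * ?F')"
    by (subst (asm) sums_Suc_iff) simp
  also have "t * ?F' = zonal_euler a (of_real s) (of_real q) t"
    by (simp add: zonal_euler_def algebra_simps power2_eq_square)
  finally show ?thesis .
qed

definition sphere_area :: "'n::finite itself \<Rightarrow> real"
  where "sphere_area _ = real CARD('n) * unit_ball_vol (real CARD('n))"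

lemma sphere_area_pos: "sphere_area TYPE('n::finite) > 0"
  unfolding sphere_area_def by (intro mult_pos_pos unit_ball_vol_pos) auto

definition kernel_coeff :: "'n::finite itself \<Rightarrow> nat \<Rightarrow> complex"
  where "kernel_coeff T m = of_nat (CARD('n) + 2 * m) / of_real (sphere_area T)"

definition herm_dot :: "complex^'n::finite \<Rightarrow> complex^'n \<Rightarrow> complex"
  where "herm_dot z w = bilinear_dot z (conj_vec w)"

text \<open>Only squares of the complex norm occur, so the choice of the square root does not
  matter.\<close>

definition sq_prod :: "complex^'n::finite \<Rightarrow> complex^'n \<Rightarrow> complex"
  where "sq_prod z w = complex_norm z ^ 2 * complex_norm (conj_vec w) ^ 2"

text \<open>The closed form of
  \<open>1 / (n \<Omega>) \<Sum>_(j<p) q\<^sup>j \<Sum>\<^sub>l (n + 4j + 2l) Z\<^sub>l\<close>: the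
  weight \<open>n + 4j\<close> multiplies the generating function itself, and the weight
  \<open>2l\<close> leads to its Euler derivative.\<close>

definition kernel :: "nat \<Rightarrow> complex^'n::finite \<Rightarrow> complex^'n \<Rightarrow> complex"
  where "kernel p z w = (\<Sum>j<p. sq_prod z w ^ j *
      (of_nat (CARD('n) + 4 * j) * zonal_gen (CARD('n) / 2) (herm_dot z w) (sq_prod z w) 1 +
       2 * zonal_euler (CARD('n) / 2) (herm_dot z w) (sq_prod z w) 1)) / of_real (sphere_area TYPE('n))"

text \<open>The part of the kernel that is homogeneous of degree \<open>m\<close> in each variable,
  without the coefficient \<open>kernel_coeff\<close>.\<close>

definition kernel_part :: "nat \<Rightarrow> real^'n::finite \<Rightarrow> nat \<Rightarrow> real^'n \<Rightarrow> complex"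
  where "kernel_part p b = hom_part p (\<lambda>l j x. sqnorm b ^ j * zonal_harmonic l b x)"

lemma kernel_part_eq: "kernel_part p b m a =
    (\<Sum>j | j < p \<and> 2 * j \<le> m. (sqnorm a * sqnorm b) ^ j * zonal_harmonic (m - 2 * j) b a)"
  by (simp add: kernel_part_def hom_part_def power_mult_distrib mult.assoc)

lemma kernel_part_sym: "kernel_part p b m a = kernel_part p a m b"
  unfolding kernel_part_eq by (simp add: mult.commute[of "sqnorm a"] zonal_harmonic_sym[of _ b])

lemma cnj_kernel_part [simp]: "cnj (kernel_part p b m a) = kernel_part p b m a"
  by (simp add: kernel_part_eq sqnorm_def)

lemma harm_kernel_part: "harm l (\<lambda>x. sqnorm b ^ j * zonal_harmonic l b x)"
  by (intro harm_cmult harm_zonal_harmonic)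

lemma hp_kernel_part: "hp m (kernel_part p b m)"
  unfolding kernel_part_def by (intro hp_hom_part harm_kernel_part)

lemma herm_dot_rotate: "herm_dot (rotate_vec \<phi> a) (rotate_vec \<psi> b) = cis (\<phi> - \<psi>) * cdot a b"
proof -
  have "herm_dot (rotate_vec \<phi> a) (rotate_vec \<psi> b) = (\<Sum>j\<in>UNIV. (cis \<phi> * cis (- \<psi>)) * (of_real (b $ j) * of_real (a $ j)))"
    unfolding herm_dot_def bilinear_dot_def conj_vec_def rotate_vec_def complex_vec_def
    by (simp add: cis_cnj mult_ac)
  then show ?thesis by (simp add: cdot_eq cis_mult flip: sum_distrib_left)
qed

lemma complex_norm_rotate: "complex_norm (rotate_vec \<phi> a) ^ 2 = cis \<phi> ^ 2 * sqnorm a"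
  unfolding complex_norm_def rotate_vec_def complex_vec_def
  by (simp add: sqnorm_eq power_mult_distrib power2_eq_square[of "complex_of_real _"] flip: sum_distrib_left)

lemma complex_norm_conj_rotate: "complex_norm (conj_vec (rotate_vec \<phi> a)) ^ 2 = cis (- \<phi>) ^ 2 * sqnorm a"
proof -
  have "conj_vec (rotate_vec \<phi> a) = rotate_vec (- \<phi>) a"
    by (simp add: conj_vec_def rotate_vec_def complex_vec_def vec_eq_iff cis_cnj)
  then show ?thesis by (simp add: complex_norm_rotate)
qed

lemma sq_prod_rotate: "sq_prod (rotate_vec \<phi> a) (rotate_vec \<psi> b) = cis (\<phi> - \<psi>) ^ 2 * (sqnorm a * sqnorm b)"
proof -
  have "cis (\<phi> - \<psi>) = cis \<phi> * cis (- \<psi>)" by (simp add: cis_mult)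
  then show ?thesis
    unfolding sq_prod_def complex_norm_rotate complex_norm_conj_rotate by (simp add: power_mult_distrib mult_ac)
qed

lemma zonal_gen_scale: "zonal_gen a (t * s) (t ^ 2 * q) 1 = zonal_gen a s q t"
  by (simp add: zonal_gen_def mult_ac)

lemma zonal_euler_scale: "zonal_euler a (t * s) (t ^ 2 * q) 1 = zonal_euler a s q t"
  by (simp add: zonal_euler_def mult_ac)

lemma sums_regroup_shift:
  fixes g :: "nat \<Rightarrow> nat \<Rightarrow> complex"
  assumes "\<And>j. j < p \<Longrightarrow> g j sums G j"
  shows "(\<lambda>m. \<Sum>j | j < p \<and> 2 * j \<le> m. g j (m - 2 * j)) sums (\<Sum>j<p. G j)"
proof -
  have "(\<lambda>m. \<Sum>j<p. if 2 * j \<le> m then g j (m - 2 * j) else 0) sums (\<Sum>j<p. G j)"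
  proof (rule sums_sum)
    fix j assume "j \<in> {..<p}"
    then have "(\<lambda>l. if 2 * j \<le> l + 2 * j then g j (l + 2 * j - 2 * j) else 0) sums G j" using assms by simp
    then show "(\<lambda>m. if 2 * j \<le> m then g j (m - 2 * j) else 0) sums G j"
      by (subst (asm) sums_iff_shift[where f = "\<lambda>m. if 2 * j \<le> m then g j (m - 2 * j) else 0"]) simp
  qed
  moreover have "(\<Sum>j<p. if 2 * j \<le> m then g j (m - 2 * j) else 0) = (\<Sum>j | j < p \<and> 2 * j \<le> m. g j (m - 2 * j))" for m
    by (intro sum.mono_neutral_cong_right) auto
  ultimately show ?thesis by simp
qed

lemma norm_prod_lt_1:
  fixes a b :: "'a::real_normed_vector"
  assumes "norm a < 1" "norm b < 1" shows "sqrt ((norm a)\<^sup>2 * (norm b)\<^sup>2) < 1"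
proof -
  have "norm a * norm b \<le> norm a * 1" using assms by (intro mult_left_mono) auto
  then show ?thesis using assms by (simp add: real_sqrt_mult)
qed

text \<open>The weight \<open>n + 4j + 2l\<close> and the phase of
  \<open>q\<^sup>j Z\<^sub>l\<close> depend on \<open>j\<close> and \<open>l\<close> only through
  the degree \<open>m = l + 2j\<close>, so the terms of equal degree combine into
  \<open>kernel_part\<close>.\<close>

lemma kernel_sums:
  fixes a b :: "real^'n::finite"
  assumes "norm a < 1" "norm b < 1"
  shows "(\<lambda>m. kernel_coeff TYPE('n) m * (cis (\<phi> - \<psi>) ^ m * kernel_part p b m a))
      sums kernel p (rotate_vec \<phi> a) (rotate_vec \<psi> b)"
proof -
  let ?t = "cis (\<phi> - \<psi>)" and ?n = "real CARD('n)" and ?A = "complex_of_real (sphere_area TYPE('n))"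
  define s where "s = a \<bullet> b"
  define q where "q = (norm a)\<^sup>2 * (norm b)\<^sup>2"
  have sq: "s ^ 2 \<le> q" unfolding s_def q_def by (rule cdot_sqnorm_le)
  have t: "norm ?t * sqrt q < 1" using norm_prod_lt_1[OF assms] by (simp add: q_def)
  have t': "1 * sqrt q \<le> 1" using t by simp
  let ?Z = "\<lambda>l. zonal (?n / 2) l (of_real s) (of_real q)"
  have cs: "cdot a b = of_real s" "sqnorm a * sqnorm b = of_real q"
    by (simp_all add: s_def q_def cdot_def sqnorm_def)
  have "(\<lambda>l. ?Z l * ?t ^ l) sums zonal_gen (?n / 2) (of_real s) (of_real q) ?t"
  proof (cases "q = 0")
    case True
    then show ?thesis using zonal_generating[OF sq, of 2 ?t] by simp
  next
    case False
    then have q: "q > 0" by (simp add: q_def)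
    show ?thesis
      by (rule zonal_generating[OF sq, of "1 / sqrt q"]) (use t q in \<open>auto simp: field_simps\<close>)
  qed
  note gen = this and eul = zonal_generating_euler[OF sq t, of "?n / 2"]
  let ?G = "\<lambda>j. (?t ^ 2 * of_real q) ^ j * (of_nat (CARD('n) + 4 * j) * zonal_gen (?n / 2) (of_real s) (of_real q) ?t +
        2 * zonal_euler (?n / 2) (of_real s) (of_real q) ?t)"
  have "(\<lambda>m. \<Sum>j | j < p \<and> 2 * j \<le> m. (?t ^ 2 * of_real q) ^ j * (of_nat (CARD('n) + 4 * j) * (?Z (m - 2 * j) * ?t ^ (m - 2 * j)) +
      2 * (of_nat (m - 2 * j) * (?Z (m - 2 * j) * ?t ^ (m - 2 * j))))) sums (\<Sum>j<p. ?G j)"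
    by (rule sums_regroup_shift) (intro sums_mult sums_add gen eul)
  from sums_divide[OF this, of ?A]
  have "(\<lambda>m. (\<Sum>j | j < p \<and> 2 * j \<le> m. (?t ^ 2 * of_real q) ^ j * (of_nat (CARD('n) + 4 * j) * (?Z (m - 2 * j) * ?t ^ (m - 2 * j)) +
      2 * (of_nat (m - 2 * j) * (?Z (m - 2 * j) * ?t ^ (m - 2 * j))))) / ?A) sums ((\<Sum>j<p. ?G j) / ?A)" .
  also have "(\<Sum>j<p. ?G j) / ?A = kernel p (rotate_vec \<phi> a) (rotate_vec \<psi> b)"
    unfolding kernel_def herm_dot_rotate sq_prod_rotate cs zonal_gen_scale zonal_euler_scale ..
  also have "(\<lambda>m. (\<Sum>j | j < p \<and> 2 * j \<le> m. (?t ^ 2 * of_real q) ^ j * (of_nat (CARD('n) + 4 * j) * (?Z (m - 2 * j) * ?t ^ (m - 2 * j)) +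
      2 * (of_nat (m - 2 * j) * (?Z (m - 2 * j) * ?t ^ (m - 2 * j))))) / ?A) =
      (\<lambda>m. of_nat (CARD('n) + 2 * m) / ?A * (?t ^ m * kernel_part p b m a))"
  proof
    fix m
    have "(?t ^ 2 * of_real q) ^ j * (of_nat (CARD('n) + 4 * j) * (?Z (m - 2 * j) * ?t ^ (m - 2 * j)) +
      2 * (of_nat (m - 2 * j) * (?Z (m - 2 * j) * ?t ^ (m - 2 * j)))) =
      of_nat (CARD('n) + 2 * m) * (?t ^ m * (of_real q ^ j * ?Z (m - 2 * j)))" if "2 * j \<le> m" for j
    proof -
      obtain l where m: "m = l + 2 * j" using \<open>2 * j \<le> m\<close> by (metis le_add_diff_inverse2)
      have "?t ^ m = ?t ^ l * (?t ^ 2) ^ j" unfolding m by (simp add: power_add power_mult)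
      then show ?thesis by (simp add: m power_mult_distrib algebra_simps)
    qed
    then have "(\<Sum>j | j < p \<and> 2 * j \<le> m. (?t ^ 2 * of_real q) ^ j * (of_nat (CARD('n) + 4 * j) * (?Z (m - 2 * j) * ?t ^ (m - 2 * j)) +
      2 * (of_nat (m - 2 * j) * (?Z (m - 2 * j) * ?t ^ (m - 2 * j))))) =
      of_nat (CARD('n) + 2 * m) * (?t ^ m * kernel_part p b m a)"
      unfolding kernel_part_eq zonal_harmonic_real cs s_def[symmetric] q_def[symmetric] sum_distrib_left
      by (intro sum.cong) auto
    then show "(\<Sum>j | j < p \<and> 2 * j \<le> m. (?t ^ 2 * of_real q) ^ j * (of_nat (CARD('n) + 4 * j) * (?Z (m - 2 * j) * ?t ^ (m - 2 * j)) +
      2 * (of_nat (m - 2 * j) * (?Z (m - 2 * j) * ?t ^ (m - 2 * j))))) / ?A =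
      of_nat (CARD('n) + 2 * m) / ?A * (?t ^ m * kernel_part p b m a)" by simp
  qed
  finally show ?thesis unfolding kernel_coeff_def .
qed

lemma kernel_part_bound:
  assumes "0 < r" "r < (1::real)"
  obtains C where "C \<ge> 0" "\<And>m a b. norm a \<le> 1 \<Longrightarrow> norm (b :: real^'n::finite) \<le> 1 \<Longrightarrow>
    norm (kernel_part p b m a) \<le> C * (norm b / r) ^ m"
proof -
  obtain M where M: "M > 0" "\<And>l b x. norm b \<le> 1 \<Longrightarrow> norm x \<le> 1 \<Longrightarrow>
      norm (zonal_harmonic l b (x :: real^'n)) \<le> M / r ^ l"
    using zonal_harmonic_bound[OF assms] by blast
  have 1: "norm (kernel_part p b m a) \<le> (p * M) / r ^ m" if ab: "norm a \<le> 1" "norm b \<le> 1" for m and a b :: "real^'n"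
  proof -
    have "norm (kernel_part p b m a) \<le> (\<Sum>j | j < p \<and> 2 * j \<le> m. M / r ^ m)"
      unfolding kernel_part_eq
    proof (rule sum_norm_le)
      fix j assume "j \<in> {j. j < p \<and> 2 * j \<le> m}"
      have "norm ((sqnorm a * sqnorm b) ^ j * zonal_harmonic (m - 2 * j) b a) \<le> 1 * (M / r ^ (m - 2 * j))"
        unfolding norm_mult using ab
        by (intro mult_mono M ab) (auto simp: sqnorm_def norm_power norm_mult mult_le_one power_le_one)
      also have "\<dots> \<le> M / r ^ m" using M(1) assms by (auto intro!: divide_left_mono power_decreasing)
      finally show "norm ((sqnorm a * sqnorm b) ^ j * zonal_harmonic (m - 2 * j) b a) \<le> M / r ^ m" .
    qed
    also have "\<dots> \<le> (\<Sum>j<p. M / r ^ m)" using M(1) assms by (intro sum_mono2) auto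
    finally show ?thesis by simp
  qed
  have "norm (kernel_part p b m a) \<le> (p * M) * (norm b / r) ^ m" if "norm a \<le> 1" for m and a b :: "real^'n"
    by (subst kernel_part_sym, unfold kernel_part_def, rule hom_part_scaled_bound[OF harm_kernel_part])
       (use 1[OF _ that] in \<open>simp add: kernel_part_def[symmetric]\<close>)
  then show ?thesis using that[of "p * M"] M(1) by simp
qed

lemma analytic_at_generating:
  fixes b :: "real^'n::finite"
  assumes "norm a < 1" "norm b < 1" "norm t = 1"
  shows "analytic_at a (\<lambda>x. (1 - 2 * t * cdot x b + t ^ 2 * (sqnorm x * sqnorm b)) powr c)"
proof -
  let ?D = "\<lambda>x. 1 - 2 * t * cdot x b + t ^ 2 * (sqnorm x * sqnorm b)"
  let ?L = "\<lambda>h. - 2 * t * cdot h b + t ^ 2 * sqnorm b * (2 * cdot h a)"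
  let ?M = "\<lambda>h. t ^ 2 * sqnorm b * sqnorm h"
  have "?D a = 1 - 2 * t * of_real (a \<bullet> b) + t ^ 2 * of_real ((norm a)\<^sup>2 * (norm b)\<^sup>2)"
    by (simp add: cdot_def sqnorm_def)
  also have "\<dots> \<notin> \<real>\<^sub>\<le>\<^sub>0"
    by (rule quadratic_not_nonpos[OF cdot_sqnorm_le]) (use norm_prod_lt_1[OF assms(1,2)] assms(3) in simp)
  finally have "?D a \<in> - \<real>\<^sub>\<le>\<^sub>0" by simp
  then obtain \<rho> where \<rho>: "\<rho> > 0" "ball (?D a) \<rho> \<subseteq> - \<real>\<^sub>\<le>\<^sub>0"
    using open_contains_ball[of "- \<real>\<^sub>\<le>\<^sub>0"] by (auto simp: open_Compl)
  show ?thesis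
  proof (rule analytic_at_compose_quadratic[where f = "\<lambda>z. z powr c" and D = ?D and L = ?L and M = ?M])
    show "hp 1 ?L" by (intro hp_add hp_cmult hp_cdot)
    show "hp 2 ?M" by (intro hp_cmult hp_sqnorm)
    fix h
    have "sqnorm (a + h) = sqnorm a + 2 * cdot h a + sqnorm h"
      by (simp add: sqnorm_def cdot_def power2_norm_eq_inner inner_add_left inner_add_right inner_commute)
    moreover have "cdot (a + h) b = cdot a b + cdot h b" by (simp add: cdot_def inner_add_left)
    ultimately show "?D (a + h) = ?D a + ?L h + ?M h" by (simp add: algebra_simps)
    show "(\<lambda>z. z powr c) holomorphic_on ball (?D a) \<rho>"
      using \<rho>(2) by (intro holomorphic_intros) auto
  qed (rule \<rho>)
qed

definition kernel_fun :: "nat \<Rightarrow> real \<Rightarrow> real^'n::finite \<Rightarrow> real^'n \<Rightarrow> complex"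
  where "kernel_fun p \<psi> b a = kernel p (rotate_vec 0 a) (rotate_vec \<psi> b)"

lemma kernel_fun_analytic:
  fixes b :: "real^'n::finite"
  assumes "norm b < 1" shows "real_analytic_on (kernel_fun p \<psi> b) (ball 0 1)"
proof (rule aseries_imp_real_analytic)
  fix a :: "real^'n" assume a: "a \<in> ball 0 1"
  let ?t = "cis (0 - \<psi>)"
  have P: "analytic_at a (\<lambda>x. (1 - 2 * ?t * cdot x b + ?t ^ 2 * (sqnorm x * sqnorm b)) powr c)" for c
    by (rule analytic_at_generating) (use a assms in auto)
  have "analytic_at a (kernel_fun p \<psi> b)"
    unfolding kernel_fun_def[abs_def] kernel_def herm_dot_rotate sq_prod_rotate zonal_gen_scale zonal_euler_scale
    unfolding divide_inverse zonal_gen_def zonal_euler_def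
    by (intro analytic_at_sum analytic_at_mult analytic_at_add analytic_at_diff analytic_at_power
        analytic_at_const analytic_at_cdot analytic_at_sqnorm P)
  then show "\<exists>q t. aseries q t a (kernel_fun p \<psi> b)" unfolding analytic_at_def .
qed

lemma kernel_fun_sums:
  fixes b :: "real^'n::finite"
  assumes "norm b < 1" "norm a < 1"
  shows "(\<lambda>m. kernel_coeff TYPE('n) m * (cis (0 - \<psi>) ^ m * kernel_part p b m a))
     sums kernel_fun p \<psi> b a"
  unfolding kernel_fun_def by (rule kernel_sums[OF assms(2,1)])

text \<open>Each homogeneous part of the kernel is killed by \<open>\<Delta>\<^sup>p\<close>. Hence
  \<open>\<Delta>\<^sup>p\<close> of the kernel vanishes near the origin, and on the ball because it
  is real analytic.\<close>

lemma kernel_fun_polyharmonic: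
  fixes b :: "real^'n::finite"
  assumes b: "norm b < 1" shows "kernel_fun p \<psi> b \<in> polyharmonic p"
  unfolding polyharmonic_def
proof (intro CollectI conjI ballI)
  let ?u = "kernel_fun p \<psi> b"
  show an: "real_analytic_on ?u (ball 0 1)" by (rule kernel_fun_analytic[OF b])
  let ?c = "\<lambda>m. kernel_coeff TYPE('n) m * cis (0 - \<psi>) ^ m"
  let ?q = "\<lambda>m x. ?c m * kernel_part p b m x"
  obtain q t where q: "aseries q t 0 ?u" using real_analytic_imp_aseries[OF an, of 0] by auto
  then have t: "t > 0" by (simp add: aseries_def)
  have "q m x = ?q m x" for m x
  proof (rule hp_series_unique[where \<delta> = "min t 1" and q = q and r = ?q and u = ?u])
    show "hp m (?q m)" for m by (intro hp_cmult hp_kernel_part)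
    fix x :: "real^'n" assume x: "norm x < min t 1"
    show "(\<lambda>m. q m x) sums ?u x" using aseries_sums[OF q, of x] x by simp
    show "(\<lambda>m. ?q m x) sums ?u x" using kernel_fun_sums[OF b, of x \<psi> p] x by (simp add: mult.assoc)
  qed (use t aseries_hp[OF q] in auto)
  then have qm: "q m = ?q m" for m by blast
  have lapq: "(laplacian ^^ p) (q m) = (\<lambda>x. 0)" for m
  proof -
    have "(laplacian ^^ p) (kernel_part p b m) = (\<lambda>x. 0)"
      unfolding kernel_part_def by (rule laplacian_iter_hom_part) (rule harm_kernel_part)
    then show ?thesis unfolding qm laplacian_iter_cmult[OF hp_kernel_part] by simp
  qed
  obtain t' where t': "aseries (\<lambda>m. (laplacian ^^ p) (q (m + 2 * p))) t' 0 ((laplacian ^^ p) ?u)"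
    using aseries_laplacian_iter[OF q] by blast
  then have "t' > 0" by (simp add: aseries_def)
  have an': "real_analytic_on ((laplacian ^^ p) ?u) (ball 0 1)"
    using real_analytic_imp_aseries[OF an] aseries_laplacian_iter
    by (intro aseries_imp_real_analytic) blast
  fix x :: "real^'n" assume x: "x \<in> ball 0 1"
  \<comment> \<open>the ray through \<open>x\<close> is followed up to
    \<open>2 / (1 + |x|) > 1\<close>, where it is still inside the ball\<close>
  have "(laplacian ^^ p) ?u (1 *\<^sub>R x) = (\<lambda>z. 0) (complex_of_real 1)"
  proof (rule real_analytic_ray_identity[OF an', where T = "2 / (1 + norm x)" and \<epsilon> = "t' / (1 + norm x)"])
    have n: "1 + norm x > 0" by (simp add: add_pos_nonneg)
    show "2 / (1 + norm x) * norm x \<le> 1" "1 < 2 / (1 + norm x)" using x n by (auto simp: divide_simps)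
    show "0 < t' / (1 + norm x)" using n \<open>t' > 0\<close> by simp
    fix s :: real assume s: "0 \<le> s" "s < t' / (1 + norm x)"
    have "norm (s *\<^sub>R x) \<le> s * (1 + norm x)" using s by (simp add: mult_left_mono)
    also have "\<dots> < t'" using s n by (simp add: pos_less_divide_eq)
    finally have "(\<lambda>m. (laplacian ^^ p) (q (m + 2 * p)) (s *\<^sub>R x)) sums (laplacian ^^ p) ?u (s *\<^sub>R x)"
      using aseries_sums[OF t'] by simp
    then show "(laplacian ^^ p) ?u (s *\<^sub>R x) = 0" by (simp add: lapq sums_iff)
  qed auto
  then show "(laplacian ^^ p) ?u x = 0" by simp
qed

subsection \<open>Extension to rotated balls\<close>

lemma homogeneous_components_eqI:
  fixes u :: "real^'n::finite \<Rightarrow> complex"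
  assumes "\<And>m. hp m (q m)" "\<And>x. norm x < 1 \<Longrightarrow> (\<lambda>m. q m x) sums u x"
  shows "homogeneous_components u = q"
  unfolding homogeneous_components_def
proof (rule the_equality)
  show "(\<forall>m. hp m (q m)) \<and> (\<forall>x\<in>ball 0 1. (\<lambda>m. q m x) sums u x)" using assms by auto
  fix r assume r: "(\<forall>m. hp m (r m)) \<and> (\<forall>x\<in>ball 0 1. (\<lambda>m. r m x) sums u x)"
  show "r = q"
  proof (intro ext)
    fix m x show "r m x = q m x"
      by (rule hp_series_unique[of 1 r q u]) (use r assms in auto)
  qed
qed

text \<open>This makes the extensions well defined, since a point of a rotated ball can be written
  in several ways as a rotated real vector.\<close>

lemma hp_rotate_cong:
  fixes a b :: "real^'n::finite"
  assumes "hp m q" "rotate_vec \<phi> a = rotate_vec \<psi> b"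
  shows "cis \<phi> ^ m * q a = cis \<psi> ^ m * q b"
proof -
  have eq: "cis \<phi> * of_real (a $ i) = cis \<psi> * of_real (b $ i)" for i
    using assms(2) by (simp add: rotate_vec_def complex_vec_def vec_eq_iff)
  from assms(1) show ?thesis
  proof (induction rule: hp_induct)
    case (monomial \<alpha>)
    have "cis \<phi> ^ m * multi_power x \<alpha> = (\<Prod>i\<in>UNIV. (cis \<phi> * of_real (x $ i)) ^ \<alpha> i)" for \<phi> and x :: "real^'n"
      unfolding multi_power_def monomial[symmetric] power_sum by (simp add: power_mult_distrib prod.distrib)
    then show ?case by (simp add: eq)
  qed (simp_all add: algebra_simps)
qed

lemma holomorphic_extension_eq:
  fixes u :: "real^'n::finite \<Rightarrow> complex"
  assumes q: "\<And>m. hp m (q m)" "\<And>x. norm x < 1 \<Longrightarrow> (\<lambda>m. q m x) sums u x" and x: "norm x < 1"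
  shows "holomorphic_extension u (rotate_vec \<psi> x) = (\<Sum>m. cis \<psi> ^ m * q m x)"
proof -
  have "homogeneous_components u = q" by (rule homogeneous_components_eqI) (use q in auto)
  then show ?thesis unfolding holomorphic_extension_def
  proof (elim ssubst, intro the_equality)
    show "\<exists>\<psi>'. \<exists>x'\<in>ball 0 1. rotate_vec \<psi> x = rotate_vec \<psi>' x' \<and>
        (\<Sum>m. cis \<psi> ^ m * q m x) = (\<Sum>m. cis (real m * \<psi>') * q m x')"
      using x unfolding Complex.DeMoivre by (intro exI[of _ \<psi>] bexI[of _ x]) simp_all
    fix w assume "\<exists>\<psi>'. \<exists>x'\<in>ball 0 1. rotate_vec \<psi> x = rotate_vec \<psi>' x' \<and>
        w = (\<Sum>m. cis (real m * \<psi>') * q m x')"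
    then obtain \<psi>' x' where w: "rotate_vec \<psi> x = rotate_vec \<psi>' x'" "w = (\<Sum>m. cis \<psi>' ^ m * q m x')"
      unfolding Complex.DeMoivre by blast
    show "w = (\<Sum>m. cis \<psi> ^ m * q m x)" unfolding w(2) hp_rotate_cong[OF q(1) w(1)] ..
  qed
qed

lemma antiholomorphic_extension_eq:
  fixes u :: "real^'n::finite \<Rightarrow> complex"
  assumes q: "\<And>m. hp m (q m)" "\<And>x. norm x < 1 \<Longrightarrow> (\<lambda>m. q m x) sums u x" and x: "norm x < 1"
  shows "antiholomorphic_extension u (rotate_vec \<psi> x) = (\<Sum>m. cis (- \<psi>) ^ m * q m x)"
proof -
  have "homogeneous_components u = q" by (rule homogeneous_components_eqI) (use q in auto)
  then show ?thesis unfolding antiholomorphic_extension_def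
  proof (elim ssubst, intro the_equality)
    have minus: "- (real m * \<phi>) = real m * (- \<phi>)" for m \<phi> by simp
    show "\<exists>\<psi>'. \<exists>x'\<in>ball 0 1. rotate_vec \<psi> x = rotate_vec \<psi>' x' \<and>
        (\<Sum>m. cis (- \<psi>) ^ m * q m x) = (\<Sum>m. cis (- (real m * \<psi>')) * q m x')"
      using x unfolding Complex.DeMoivre minus by (intro exI[of _ \<psi>] bexI[of _ x]) simp_all
    fix w assume "\<exists>\<psi>'. \<exists>x'\<in>ball 0 1. rotate_vec \<psi> x = rotate_vec \<psi>' x' \<and>
        w = (\<Sum>m. cis (- (real m * \<psi>')) * q m x')"
    then obtain \<psi>' x' where w: "rotate_vec \<psi> x = rotate_vec \<psi>' x'" "w = (\<Sum>m. cis (- \<psi>') ^ m * q m x')"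
      unfolding Complex.DeMoivre minus by blast
    have "rotate_vec (- \<phi>) y = conj_vec (rotate_vec \<phi> y)" for \<phi> and y :: "real^'n"
      by (simp add: conj_vec_def rotate_vec_def complex_vec_def vec_eq_iff cis_cnj)
    then have "rotate_vec (- \<psi>) x = rotate_vec (- \<psi>') x'" using w(1) by simp
    from hp_rotate_cong[OF q(1) this] show "w = (\<Sum>m. cis (- \<psi>) ^ m * q m x)" unfolding w(2) by simp
  qed
qed

lemma rotated_balls_E:
  assumes "x \<in> rotated_balls p"
  obtains k b where "k < p" "norm b < 1" "x = rotate_vec (real k * pi / real p) b"
  using assms unfolding rotated_balls_def by auto

lemma rotated_balls_I: "k < p \<Longrightarrow> norm b < 1 \<Longrightarrow> rotate_vec (real k * pi / real p) b \<in> rotated_balls p"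
  unfolding rotated_balls_def by (intro UN_I[of k] imageI) auto

lemma summable_poly_geometric:
  fixes r :: real assumes "0 \<le> r" "r < 1"
  shows "summable (\<lambda>m. (a + c * real m) * r ^ m)"
proof -
  have "summable (\<lambda>m. r ^ m)" using assms by (intro summable_geometric) simp
  moreover have "summable (\<lambda>m. real m * r ^ m)"
  proof (rule summable_comparison_test')
    have "summable (\<lambda>m. 1 * ((1 + r) / 2) ^ m)" using assms by (simp add: summable_geometric)
    from summable_termdiff[OF this, of r] assms show "summable (\<lambda>m. real (Suc m) * 1 * r ^ m)" by simp
    show "norm (real m * r ^ m) \<le> real (Suc m) * 1 * r ^ m" for m
      using assms by (simp add: mult_right_mono)
  qed
  ultimately have "summable (\<lambda>m. a * r ^ m + c * (real m * r ^ m))"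
    by (intro summable_add summable_mult)
  then show ?thesis by (simp add: algebra_simps)
qed

subsection \<open>The kernel belongs to the Bergman space\<close>

lemma kernel_terms_bound:
  fixes b :: "real^'n::finite"
  assumes b: "norm b < 1"
  obtains B where "summable B"
    "\<And>m a. norm a \<le> 1 \<Longrightarrow> norm (kernel_coeff TYPE('n) m * kernel_part p b m a) \<le> B m"
proof -
  define r where "r = (1 + norm b) / 2"
  have r: "0 < r" "r < 1" "norm b < r" using b by (auto simp: r_def add_pos_nonneg)
  obtain C where C: "C \<ge> 0" "\<And>m a b. norm a \<le> 1 \<Longrightarrow> norm (b :: real^'n) \<le> 1 \<Longrightarrow>
      norm (kernel_part p b m a) \<le> C * (norm b / r) ^ m"
    using kernel_part_bound[OF r(1,2)] by blast
  let ?A = "sphere_area TYPE('n)"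
  have A: "?A > 0" by (rule sphere_area_pos)
  let ?B = "\<lambda>m. (real CARD('n) * C / ?A + (2 * C / ?A) * real m) * (norm b / r) ^ m"
  have "norm (kernel_coeff TYPE('n) m * kernel_part p b m a) \<le> ?B m" if "norm a \<le> 1" for m a
  proof -
    have "norm (kernel_coeff TYPE('n) m) = (CARD('n) + 2 * real m) / ?A"
      unfolding kernel_coeff_def norm_divide norm_of_nat using A by simp
    then have "norm (kernel_coeff TYPE('n) m * kernel_part p b m a) \<le>
        (CARD('n) + 2 * real m) / ?A * (C * (norm b / r) ^ m)"
      unfolding norm_mult using C(2)[OF that, of b m] b A by (simp only:) (intro mult_left_mono, auto)
    also have "\<dots> = ?B m" by (simp add: add_divide_distrib distrib_right distrib_left mult_ac)
    finally show ?thesis .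
  qed
  moreover have "summable ?B" using r by (intro summable_poly_geometric) auto
  ultimately show ?thesis using that by blast
qed

lemma set_integrable_const_ball: "set_integrable lborel (ball (0::real^'n::finite) 1) (\<lambda>y. c::real)"
  by (rule set_integrable_bounded_continuous) auto

lemma kernel_slice:
  fixes b :: "real^'n::finite"
  assumes b: "norm b < 1"
  shows "set_integrable lborel (ball 0 1) (\<lambda>y. (cmod (kernel p (rotate_vec \<theta> y) (rotate_vec \<psi> b)))\<^sup>2)"
proof -
  obtain B where B: "summable B" "\<And>m a. norm a \<le> 1 \<Longrightarrow> norm (kernel_coeff TYPE('n) m * kernel_part p b m a) \<le> B m"
    using kernel_terms_bound[OF b] by metis
  let ?f = "\<lambda>m y. kernel_coeff TYPE('n) m * (cis (\<theta> - \<psi>) ^ m * kernel_part p b m y)"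
  let ?K = "\<lambda>y. kernel p (rotate_vec \<theta> y) (rotate_vec \<psi> b)"
  have bd: "norm (?f m y) \<le> B m" if "norm y < 1" for m y
    using B(2)[of y m] that by (simp add: norm_mult norm_power)
  have int: "set_integrable lborel (ball 0 1) (?f m)" for m
    by (intro set_integrable_hp[of m] hp_cmult hp_kernel_part)
  have K: "set_integrable lborel (ball 0 1) ?K"
    by (rule set_integral_sums(1)[OF int set_integrable_const_ball[of 1] _ B(1)])
      (use bd kernel_sums[OF _ b] in auto)
  have bound: "norm (?K y) \<le> suminf B" if "norm y < 1" for y
  proof -
    have "?K y = (\<Sum>m. ?f m y)" using kernel_sums[OF that b] by (simp add: sums_iff)
    also have "norm \<dots> \<le> (\<Sum>m. B m)"
      by (rule norm_suminf_le) (use bd[OF that] B(1) in auto)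
    finally show ?thesis .
  qed
  show ?thesis
  proof (rule set_integrable_bound[OF set_integrable_const_ball[of "(suminf B)\<^sup>2"]])
    have "(\<lambda>y. indicator (ball 0 1) y *\<^sub>R ?K y) \<in> borel_measurable lborel"
      using K unfolding set_integrable_def by (rule borel_measurable_integrable)
    then have "(\<lambda>y. (norm (indicator (ball 0 1) y *\<^sub>R ?K y))\<^sup>2) \<in> borel_measurable lborel" by measurable
    also have "(\<lambda>y. (norm (indicator (ball 0 1) y *\<^sub>R ?K y))\<^sup>2) = (\<lambda>y. indicator (ball 0 1) y *\<^sub>R (norm (?K y))\<^sup>2)"
      by (auto simp: indicator_def)
    finally show "set_borel_measurable lborel (ball 0 1) (\<lambda>y. (norm (?K y))\<^sup>2)"
      unfolding set_borel_measurable_def .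
    show "AE y in lborel. y \<in> ball 0 1 \<longrightarrow> norm ((norm (?K y))\<^sup>2) \<le> norm ((suminf B)\<^sup>2)"
      using bound by (auto intro!: AE_I2 power_mono)
  qed
qed

text \<open>The restriction to the domain, extended by \<open>0\<close> in accordance with the
  normalization of \<open>bergman_kernel\<close>.\<close>

definition bkernel :: "nat \<Rightarrow> complex^'n::finite \<Rightarrow> complex^'n \<Rightarrow> complex"
  where "bkernel p z w = (if z \<in> rotated_balls p \<and> w \<in> rotated_balls p then kernel p z w else 0)"

lemma bkernel_in_bergman_space:
  fixes x :: "complex^'n::finite"
  assumes "x \<in> rotated_balls p" shows "(\<lambda>z. bkernel p z x) \<in> bergman_space p"
proof -
  obtain k0 b where b: "norm b < 1" and x: "x = rotate_vec (real k0 * pi / real p) b"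
    using rotated_balls_E[OF assms] by metis
  define \<psi> where "\<psi> = real k0 * pi / real p"
  let ?u = "kernel_fun p \<psi> b"
  let ?q = "\<lambda>m a. kernel_coeff TYPE('n) m * (cis (0 - \<psi>) ^ m * kernel_part p b m a)"
  have "bkernel p z x = holomorphic_extension ?u z" if zin: "z \<in> rotated_balls p" for z
  proof -
    obtain k a where a: "norm a < 1" and z: "z = rotate_vec (real k * pi / real p) a"
      using rotated_balls_E[OF zin] by metis
    define \<theta> where "\<theta> = real k * pi / real p"
    have "holomorphic_extension ?u (rotate_vec \<theta> a) = (\<Sum>m. cis \<theta> ^ m * ?q m a)"
    proof (rule holomorphic_extension_eq[OF _ _ a])
      show "hp m (?q m)" for m by (intro hp_cmult hp_kernel_part)
      show "(\<lambda>m. ?q m x) sums ?u x" if "norm x < 1" for x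
        using kernel_sums[OF that b, of 0 \<psi> p] by (simp add: kernel_fun_def)
    qed
    also have "(\<lambda>m. cis \<theta> ^ m * ?q m a) = (\<lambda>m. kernel_coeff TYPE('n) m * (cis (\<theta> - \<psi>) ^ m * kernel_part p b m a))"
    proof
      fix m
      have "cis (\<theta> - \<psi>) = cis \<theta> * cis (0 - \<psi>)" by (simp add: cis_mult)
      then show "cis \<theta> ^ m * ?q m a = kernel_coeff TYPE('n) m * (cis (\<theta> - \<psi>) ^ m * kernel_part p b m a)"
        by (simp add: power_mult_distrib mult_ac)
    qed
    also have "suminf \<dots> = kernel p (rotate_vec \<theta> a) (rotate_vec \<psi> b)"
      using kernel_sums[OF a b] by (simp add: sums_iff)
    finally show ?thesis using zin assms by (simp add: bkernel_def z x \<theta>_def \<psi>_def)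
  qed
  moreover have "set_integrable lborel (ball 0 1) (\<lambda>y. (cmod (bkernel p (rotate_vec (real k * pi / real p) y) x))\<^sup>2)" if "k < p" for k
  proof -
    have "set_integrable lborel (ball 0 1) (\<lambda>y. (cmod (kernel p (rotate_vec (real k * pi / real p) y) x))\<^sup>2)"
      unfolding x by (rule kernel_slice[OF b])
    also have "?this \<longleftrightarrow> ?thesis"
      by (rule set_integrable_cong) (use that assms rotated_balls_I in \<open>auto simp: bkernel_def\<close>)
    finally show ?thesis .
  qed
  ultimately show ?thesis
    unfolding bergman_space_def using kernel_fun_polyharmonic[OF b, of p \<psi>] by blast
qed

subsection \<open>The reproducing property\<close>

text \<open>The function \<open>V\<close> is merely integrable, and its expansion need not converge
  uniformly up to the boundary. On a ball of radius \<open>\<rho> < 1\<close> it does, and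
  \<open>moment_of_expansion\<close> applies after rescaling; then \<open>\<rho>\<close> tends to
  \<open>1\<close>.\<close>

lemma bergman_moment:
  fixes V :: "real^'n::finite \<Rightarrow> complex"
  assumes H: "\<And>l j. harm l (H l j)"
    and growth: "\<And>\<kappa>. 0 < \<kappa> \<Longrightarrow> \<kappa> < 1 \<Longrightarrow> \<exists>C. \<forall>m x. norm (hom_part p H m x) \<le> C * (norm x / \<kappa>) ^ m"
    and V: "set_integrable lborel (ball 0 1) V"
    and sums: "\<And>y. norm y < 1 \<Longrightarrow> (\<lambda>m. cis \<theta> ^ m * hom_part p H m y) sums V y"
  shows "(LINT y:ball 0 1|lborel. sqnorm y ^ a * (zonal_harmonic l b y * V y)) =
    (\<Sum>i<p. cis \<theta> ^ (l + 2 * i) * of_real (sphere_area TYPE('n) / (CARD('n) + 2 * l + 2 * (a + i))) * H l i b)"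
    and "set_integrable lborel (ball 0 1) (\<lambda>y. sqnorm y ^ a * (zonal_harmonic l b y * V y))"
proof -
  let ?w = "\<lambda>y. sqnorm y ^ a * zonal_harmonic l b y"
  let ?f = "\<lambda>y. sqnorm y ^ a * (zonal_harmonic l b y * V y)"
  let ?c = "\<lambda>i. of_real (sphere_area TYPE('n) / (CARD('n) + 2 * l + 2 * (a + i))) * H l i b"
  have hpw: "hp (l + 2 * a) ?w" by (rule hp_sqnorm_power[OF hp_zonal_harmonic])
  have cont: "continuous_on UNIV ?w" by (rule continuous_on_hp[OF hpw])
  have "compact (?w ` cball 0 1)"
    by (intro compact_continuous_image continuous_on_subset[OF cont]) auto
  from compact_imp_bounded[OF this] obtain M where "M > 0" "\<forall>z\<in>?w ` cball 0 1. norm z \<le> M"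
    unfolding bounded_pos by blast
  then have M: "M > 0" "\<And>y. norm y \<le> 1 \<Longrightarrow> norm (?w y) \<le> M" by auto
  have f: "set_integrable lborel (ball 0 1) ?f"
  proof (rule set_integrable_bound)
    show "set_integrable lborel (ball 0 1) (\<lambda>y. of_real M * V y)" using V by simp
    have [measurable]: "?w \<in> borel_measurable borel" using cont by (rule borel_measurable_continuous_onI)
    have [measurable]: "(\<lambda>y. indicator (ball 0 1) y *\<^sub>R V y) \<in> borel_measurable borel"
      using V unfolding set_integrable_def by simp
    have "(\<lambda>y. ?w y * (indicator (ball 0 1) y *\<^sub>R V y)) \<in> borel_measurable borel" by measurable
    then show "set_borel_measurable lborel (ball 0 1) ?f"
      unfolding set_borel_measurable_def by (simp add: mult.assoc)
    show "AE y in lborel. y \<in> ball 0 1 \<longrightarrow> norm (?f y) \<le> norm (of_real M * V y)"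
    proof (rule AE_I2, rule impI)
      fix y :: "real^'n" assume "y \<in> ball 0 1"
      then have "norm (?w y) * norm (V y) \<le> M * norm (V y)" using M(2)[of y] by (intro mult_right_mono) auto
      then show "norm (?f y) \<le> norm (of_real M * V y)" using M(1) by (simp add: norm_mult mult.assoc)
    qed
  qed
  define \<rho> where "\<rho> = (\<lambda>k::nat. real (Suc k) / real (Suc (Suc k)))"
  have \<rho>: "0 < \<rho> k" "\<rho> k < 1" for k by (auto simp: \<rho>_def divide_simps)
  have lim: "\<rho> \<longlonglongrightarrow> 1" unfolding \<rho>_def by real_asymp
  have scaled: "(LINT y:ball 0 (\<rho> k)|lborel. ?f y) =
      of_real (\<rho> k) ^ (CARD('n) + (l + 2 * a)) * (\<Sum>i<p. (cis \<theta> * of_real (\<rho> k)) ^ (l + 2 * i) * ?c i)" for k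
  proof -
    let ?r = "\<rho> k"
    have [measurable]: "(\<lambda>y. indicat_real (ball 0 ?r) y *\<^sub>R ?f y) \<in> borel_measurable borel"
    proof -
      have "set_integrable lborel (ball 0 ?r) ?f"
        by (rule set_integrable_subset[OF f]) (use \<rho>[of k] in auto)
      then show ?thesis unfolding set_integrable_def by simp
    qed
    have "(LINT y:ball 0 ?r|lborel. ?f y) =
       of_real (?r ^ CARD('n)) * (LINT y|lborel. indicat_real (ball 0 ?r) (?r *\<^sub>R y) *\<^sub>R ?f (?r *\<^sub>R y))"
      unfolding set_lebesgue_integral_def using \<rho>[of k] by (subst lborel_integral_scale[of _ ?r]) auto
    also have "(LINT y|lborel. indicat_real (ball 0 ?r) (?r *\<^sub>R y) *\<^sub>R ?f (?r *\<^sub>R y)) =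
       (LINT y:ball 0 1|lborel. of_real ?r ^ (l + 2 * a) * (sqnorm y ^ a * (zonal_harmonic l b y * V (?r *\<^sub>R y))))"
      unfolding set_lebesgue_integral_def
    proof (rule Bochner_Integration.integral_cong)
      fix y :: "real^'n"
      have "?w (?r *\<^sub>R y) = of_real ?r ^ (l + 2 * a) * ?w y" by (rule hp_scale[OF hpw])
      then have "?f (?r *\<^sub>R y) = of_real ?r ^ (l + 2 * a) * (sqnorm y ^ a * (zonal_harmonic l b y * V (?r *\<^sub>R y)))"
        by (simp add: mult.assoc[symmetric])
      moreover have "indicat_real (ball 0 ?r) (?r *\<^sub>R y) = indicat_real (ball 0 1) y"
        using \<rho>[of k] by (simp add: indicator_def)
      ultimately show "indicat_real (ball 0 ?r) (?r *\<^sub>R y) *\<^sub>R ?f (?r *\<^sub>R y) =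
        indicat_real (ball 0 1) y *\<^sub>R (of_real ?r ^ (l + 2 * a) * (sqnorm y ^ a * (zonal_harmonic l b y * V (?r *\<^sub>R y))))"
        by simp
    qed simp
    also have "\<dots> = of_real ?r ^ (l + 2 * a) * (LINT y:ball 0 1|lborel. sqnorm y ^ a * (zonal_harmonic l b y * V (?r *\<^sub>R y)))"
      by simp
    also have "(LINT y:ball 0 1|lborel. sqnorm y ^ a * (zonal_harmonic l b y * V (?r *\<^sub>R y))) =
       (\<Sum>j<p. (cis \<theta> * of_real ?r) ^ (l + 2 * j) *
          of_real (CARD('n) * unit_ball_vol (CARD('n)) / (CARD('n) + 2 * l + 2 * (a + j))) * H l j b)"
    proof -
      obtain \<kappa> where \<kappa>: "?r < \<kappa>" "\<kappa> < 1" using \<rho>(2)[of k] dense by blast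
      have \<kappa>0: "0 < \<kappa>" using \<rho>(1)[of k] \<kappa> by linarith
      obtain C where C: "\<And>m x. norm (hom_part p H m x) \<le> C * (norm x / \<kappa>) ^ m" using growth[OF \<kappa>0 \<kappa>(2)] by blast
      have eq: "(cis \<theta> * of_real ?r) ^ m * hom_part p H m y = cis \<theta> ^ m * hom_part p H m (?r *\<^sub>R y)" for m and y :: "real^'n"
        by (simp add: hp_scale[OF hp_hom_part[OF H]] power_mult_distrib)
      show ?thesis
      proof (rule moment_of_expansion(1)[OF H])
        have "C \<ge> 0" using order_trans[OF norm_ge_zero C[of 0 0]] by simp
        show "summable (\<lambda>m. C * (?r / \<kappa>) ^ m)"
          using \<kappa> \<kappa>0 \<rho>(1)[of k] by (intro summable_mult summable_geometric) simp
        fix y :: "real^'n" assume y: "norm y < 1"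
        have ry: "norm (?r *\<^sub>R y) \<le> ?r" using y \<rho>[of k] by (simp add: mult_left_le)
        show "norm ((cis \<theta> * of_real ?r) ^ m * hom_part p H m y) \<le> C * (?r / \<kappa>) ^ m" for m
        proof -
          have "norm (cis \<theta> ^ m * hom_part p H m (?r *\<^sub>R y)) \<le> C * (norm (?r *\<^sub>R y) / \<kappa>) ^ m"
            using C[of m "?r *\<^sub>R y"] by (simp add: norm_mult norm_power)
          also have "\<dots> \<le> C * (?r / \<kappa>) ^ m"
            using \<open>C \<ge> 0\<close> ry \<kappa>0 by (intro mult_left_mono power_mono divide_right_mono) auto
          finally show ?thesis unfolding eq .
        qed
        show "(\<lambda>m. (cis \<theta> * of_real ?r) ^ m * hom_part p H m y) sums V (?r *\<^sub>R y)"
          unfolding eq by (rule sums) (use ry \<rho>(2)[of k] in linarith)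
      qed
    qed
    finally show ?thesis
      by (simp add: sphere_area_def power_add mult.assoc)
  qed
  have "(\<lambda>k. LINT y:ball 0 (\<rho> k)|lborel. ?f y) \<longlonglongrightarrow> (LINT y:(\<Union>k. ball 0 (\<rho> k))|lborel. ?f y)"
  proof (rule set_integral_cont_up)
    show "incseq (\<lambda>k. ball (0::real^'n) (\<rho> k))"
      by (intro incseq_SucI subset_ball) (simp add: \<rho>_def field_simps)
    show "set_integrable lborel (\<Union>k. ball 0 (\<rho> k)) ?f"
    proof (rule set_integrable_subset[OF f])
      show "(\<Union>k. ball 0 (\<rho> k)) \<subseteq> ball (0::real^'n) 1"
        using \<rho>(2) by (intro UN_least subset_ball less_imp_le)
    qed auto
  qed auto
  also have "(\<Union>k. ball (0::real^'n) (\<rho> k)) = ball 0 1"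
  proof (intro equalityI subsetI)
    fix y :: "real^'n" assume "y \<in> ball 0 1"
    then have "norm y < 1" by simp
    then have "\<forall>\<^sub>F k in sequentially. norm y < \<rho> k" by (rule order_tendstoD(1)[OF lim])
    then obtain k where "norm y < \<rho> k" by (auto simp: eventually_sequentially)
    then show "y \<in> (\<Union>k. ball 0 (\<rho> k))" by auto
  next
    fix y :: "real^'n" assume "y \<in> (\<Union>k. ball 0 (\<rho> k))"
    then obtain k where "norm y < \<rho> k" by auto
    then show "y \<in> ball 0 1" using \<rho>(2)[of k] by simp
  qed
  finally have 1: "(\<lambda>k. LINT y:ball 0 (\<rho> k)|lborel. ?f y) \<longlonglongrightarrow> (LINT y:ball 0 1|lborel. ?f y)" .
  have "(\<lambda>k. of_real (\<rho> k) ^ (CARD('n) + (l + 2 * a)) * (\<Sum>i<p. (cis \<theta> * of_real (\<rho> k)) ^ (l + 2 * i) * ?c i))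
     \<longlonglongrightarrow> of_real 1 ^ (CARD('n) + (l + 2 * a)) * (\<Sum>i<p. (cis \<theta> * of_real 1) ^ (l + 2 * i) * ?c i)"
    by (intro tendsto_intros lim)
  with 1 show "(LINT y:ball 0 1|lborel. ?f y) = (\<Sum>i<p. cis \<theta> ^ (l + 2 * i) *
      of_real (sphere_area TYPE('n) / (CARD('n) + 2 * l + 2 * (a + i))) * H l i b)"
    unfolding scaled by (simp add: LIMSEQ_unique mult.assoc)
  show "set_integrable lborel (ball 0 1) ?f" by (rule f)
qed

text \<open>The summands are the powers of \<open>cis (2\<pi>(i - j) / p)\<close>, a
  \<open>p\<close>-th root of unity that equals \<open>1\<close> only for \<open>i = j\<close>, as
  \<open>|i - j| < p\<close>. This is where averaging over the rotated balls enters.\<close>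

lemma roots_of_unity_sum:
  assumes "i < p" "j < p" "2 * j \<le> m"
  shows "(\<Sum>k<p. cis (- (real k * pi / real p)) ^ m * cis (real k * pi / real p) ^ (m - 2 * j + 2 * i)) =
     (if i = j then of_nat p else 0)"
proof -
  define \<omega> where "\<omega> = cis (2 * pi * ((real i - real j) / real p))"
  have trm: "cis (- (real k * pi / real p)) ^ m * cis (real k * pi / real p) ^ (m - 2 * j + 2 * i) = \<omega> ^ k" for k
    using assms(3) unfolding Complex.DeMoivre cis_mult \<omega>_def
    by (intro arg_cong[of _ _ cis]) (simp add: algebra_simps of_nat_diff add_divide_distrib diff_divide_distrib)
  show ?thesis
  proof (cases "i = j")
    case True
    then show ?thesis unfolding trm by (simp add: \<omega>_def)
  next
    case False
    have "\<omega> ^ p = cis (2 * pi * of_int (int i - int j))"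
      using assms unfolding \<omega>_def Complex.DeMoivre by (intro arg_cong[of _ _ cis]) simp
    also have "\<dots> = 1" by (rule cis_multiple_2pi) simp
    finally have p: "\<omega> ^ p = 1" .
    have "\<omega> \<noteq> 1"
    proof
      assume "\<omega> = 1"
      then have "cos (2 * pi * ((real i - real j) / real p)) = 1" by (simp add: \<omega>_def complex_eq_iff)
      then obtain n :: int where "2 * pi * ((real i - real j) / real p) = of_int n * 2 * pi"
        unfolding cos_one_2pi_int by auto
      then have "2 * pi * ((real i - real j) / real p) = 2 * pi * of_int n" by (simp only: mult_ac)
      moreover have "2 * pi \<noteq> 0" by simp
      ultimately have "(real i - real j) / real p = of_int n" using mult_left_cancel by blast
      then have "real i - real j = of_int n * real p" using assms by (simp add: divide_eq_eq)
      then have n: "int i - int j = n * int p"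
        by (metis of_int_diff of_int_eq_iff of_int_mult of_int_of_nat_eq)
      then have "\<bar>n * int p\<bar> < 1 * int p" using assms by linarith
      then have "\<bar>n\<bar> < 1" using assms unfolding abs_mult by (simp add: mult_less_cancel_right)
      then show False using n False by simp
    qed
    then show ?thesis unfolding trm using False p by (simp add: geometric_sum)
  qed
qed

lemma bergman_space_slice:
  fixes U :: "complex^'n::finite \<Rightarrow> complex"
  assumes "U \<in> bergman_space p"
  shows "\<exists>H. (\<forall>l j. harm l (H l j)) \<and>
    (\<forall>\<kappa>. 0 < \<kappa> \<longrightarrow> \<kappa> < 1 \<longrightarrow> (\<exists>C. \<forall>m x. norm (hom_part p H m x) \<le> C * (norm x / \<kappa>) ^ m)) \<and>
    (\<forall>k<p. \<forall>y. norm y < 1 \<longrightarrow> (\<lambda>m. cis (real k * pi / real p) ^ m * hom_part p H m y)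
        sums U (rotate_vec (real k * pi / real p) y)) \<and>
    (\<forall>k<p. set_integrable lborel (ball 0 1) (\<lambda>y. U (rotate_vec (real k * pi / real p) y)))"
proof -
  obtain u where u: "u \<in> polyharmonic p" "\<And>z. z \<in> rotated_balls p \<Longrightarrow> U z = holomorphic_extension u z"
    and L2: "\<And>k. k < p \<Longrightarrow> set_integrable lborel (ball 0 1) (\<lambda>y. (cmod (U (rotate_vec (real k * pi / real p) y)))\<^sup>2)"
    using assms unfolding bergman_space_def by blast
  obtain H where H: "\<And>l j. harm l (H l j)"
    and growth: "\<And>\<kappa>. 0 < \<kappa> \<Longrightarrow> \<kappa> < 1 \<Longrightarrow> \<exists>C. \<forall>m x. norm (hom_part p H m x) \<le> C * (norm x / \<kappa>) ^ m"
    and sums: "\<And>x. norm x < 1 \<Longrightarrow> (\<lambda>m. hom_part p H m x) sums u x"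
    using polyharmonic_expansion[OF u(1)] by blast
  have ext: "(\<lambda>m. cis (real k * pi / real p) ^ m * hom_part p H m y) sums U (rotate_vec (real k * pi / real p) y)"
    if k: "k < p" and y: "norm y < 1" for k y
  proof -
    obtain \<kappa> where \<kappa>: "norm y < \<kappa>" "\<kappa> < 1" using y dense by blast
    have \<kappa>0: "0 < \<kappa>" using \<kappa>(1) norm_ge_zero[of y] by linarith
    obtain C where C: "\<And>m x. norm (hom_part p H m x) \<le> C * (norm x / \<kappa>) ^ m" using growth[OF \<kappa>0 \<kappa>(2)] by blast
    have "summable (\<lambda>m. cis (real k * pi / real p) ^ m * hom_part p H m y)"
    proof (rule summable_comparison_test'[of "\<lambda>m. C * (norm y / \<kappa>) ^ m" 0])
      show "summable (\<lambda>m. C * (norm y / \<kappa>) ^ m)" using \<kappa> \<kappa>0 by (intro summable_mult summable_geometric) simp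
      show "norm (cis (real k * pi / real p) ^ m * hom_part p H m y) \<le> C * (norm y / \<kappa>) ^ m" for m
        using C[of m y] by (simp add: norm_mult norm_power)
    qed
    moreover have "U (rotate_vec (real k * pi / real p) y) = (\<Sum>m. cis (real k * pi / real p) ^ m * hom_part p H m y)"
      unfolding u(2)[OF rotated_balls_I[OF k y]]
      by (rule holomorphic_extension_eq[OF hp_hom_part[OF H] sums y])
    ultimately show ?thesis using summable_sums by simp
  qed
  have "set_integrable lborel (ball 0 1) (\<lambda>y. U (rotate_vec (real k * pi / real p) y))" if k: "k < p" for k
  proof (rule set_integrable_bound)
    let ?V = "\<lambda>y. U (rotate_vec (real k * pi / real p) y)"
    show "set_integrable lborel (ball 0 1) (\<lambda>y. 1 + (cmod (?V y))\<^sup>2)"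
      using set_integral_add(1)[OF set_integrable_const_ball[of 1] L2[OF k]] .
    have [measurable]: "hom_part p H m \<in> borel_measurable borel" for m
      using continuous_on_hp[OF hp_hom_part[OF H]] by (rule borel_measurable_continuous_onI)
    have ind: "indicator (ball 0 1) y *\<^sub>R ?V y =
        (\<Sum>m. indicator (ball 0 1) y *\<^sub>R (cis (real k * pi / real p) ^ m * hom_part p H m y))" for y
      using ext[OF k, of y] by (cases "y \<in> ball 0 1") (auto simp: sums_iff)
    have "(\<lambda>y. \<Sum>m. indicat_real (ball 0 1) y *\<^sub>R (cis (real k * pi / real p) ^ m * hom_part p H m y)) \<in> borel_measurable borel"
      by (intro borel_measurable_suminf borel_measurable_scaleR borel_measurable_indicator borel_measurable_times) auto
    then show "set_borel_measurable lborel (ball 0 1) ?V"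
      unfolding set_borel_measurable_def ind by simp
    have le: "r \<le> 1 + r\<^sup>2" for r :: real
    proof (cases "r \<le> 1")
      case True then show ?thesis using zero_le_power2[of r] by linarith
    next
      case False then show ?thesis using self_le_power[of r 2] by simp
    qed
    show "AE y in lborel. y \<in> ball 0 1 \<longrightarrow> norm (?V y) \<le> norm (1 + (cmod (?V y))\<^sup>2)"
    proof (rule AE_I2, rule impI)
      fix y show "norm (?V y) \<le> norm (1 + (cmod (?V y))\<^sup>2)" using le[of "cmod (?V y)"] by simp
    qed
  qed
  with H growth ext show ?thesis by blast
qed

text \<open>On each rotated ball the kernel series is integrated termwise against \<open>U\<close>.
  Its part of degree \<open>m\<close> contributes pairings of \<open>|y|^(2j) Z_(m-2j)\<close> with
  \<open>|y|^(2i) H\<close> for \<open>i, j < p\<close>. Averaging over the rotations leaves those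
  with \<open>i = j\<close>, where the factor \<open>n \<Omega> / (n + 2m)\<close> of the moment
  cancels \<open>kernel_coeff\<close>, and what remains is the expansion of \<open>U\<close> at
  \<open>x\<close>.\<close>

theorem bkernel_reproducing:
  fixes U :: "complex^'n::finite \<Rightarrow> complex"
  assumes U: "U \<in> bergman_space p" and x: "x \<in> rotated_balls p"
  shows "U x = bergman_inner p U (\<lambda>z. bkernel p z x)"
proof -
  define \<theta> where "\<theta> = (\<lambda>k::nat. real k * pi / real p)"
  let ?A = "sphere_area TYPE('n)"
  have A: "?A > 0" by (rule sphere_area_pos)
  obtain H where H: "\<And>l j. harm l (H l j)"
    and growth: "\<And>\<kappa>. 0 < \<kappa> \<Longrightarrow> \<kappa> < 1 \<Longrightarrow> \<exists>C. \<forall>m x. norm (hom_part p H m x) \<le> C * (norm x / \<kappa>) ^ m"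
    and ext: "\<And>k y. k < p \<Longrightarrow> norm y < 1 \<Longrightarrow> (\<lambda>m. cis (\<theta> k) ^ m * hom_part p H m y) sums U (rotate_vec (\<theta> k) y)"
    and int: "\<And>k. k < p \<Longrightarrow> set_integrable lborel (ball 0 1) (\<lambda>y. U (rotate_vec (\<theta> k) y))"
    using bergman_space_slice[OF U] unfolding \<theta>_def by blast
  obtain k0 b where k0: "k0 < p" and b: "norm b < 1" and x_eq: "x = rotate_vec (\<theta> k0) b"
    using rotated_balls_E[OF x] unfolding \<theta>_def by metis
  define \<psi> where "\<psi> = \<theta> k0"
  have p: "p > 0" using k0 by simp
  obtain B where B: "summable B" "\<And>m a. norm a \<le> 1 \<Longrightarrow> norm (kernel_coeff TYPE('n) m * kernel_part p b m a) \<le> B m"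
    using kernel_terms_bound[OF b] by metis
  let ?V = "\<lambda>k y. U (rotate_vec (\<theta> k) y)"
  let ?I = "\<lambda>k. LINT y:ball 0 1|lborel. ?V k y * cnj (bkernel p (rotate_vec (\<theta> k) y) x)"
  let ?J = "\<lambda>m k. LINT y:ball 0 1|lborel. ?V k y * kernel_part p b m y"
  let ?c = "kernel_coeff TYPE('n)"
  have cnj_c: "cnj (?c m) = ?c m" for m by (simp add: kernel_coeff_def)
  have I: "(\<lambda>m. ?c m * cis (\<psi> - \<theta> k) ^ m * ?J m k) sums ?I k" if k: "k < p" for k
  proof -
    let ?f = "\<lambda>m y. ?V k y * (?c m * (cis (\<psi> - \<theta> k) ^ m * kernel_part p b m y))"
    have sm: "(\<lambda>m. ?f m y) sums (?V k y * cnj (bkernel p (rotate_vec (\<theta> k) y) x))" if "y \<in> ball 0 1" for y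
    proof -
      have y: "norm y < 1" using that by simp
      have "bkernel p (rotate_vec (\<theta> k) y) x = kernel p (rotate_vec (\<theta> k) y) (rotate_vec \<psi> b)"
        using rotated_balls_I[OF k y] x by (simp add: bkernel_def x_eq \<psi>_def \<theta>_def)
      moreover have "(\<lambda>m. cnj (?c m * (cis (\<theta> k - \<psi>) ^ m * kernel_part p b m y))) sums
          cnj (kernel p (rotate_vec (\<theta> k) y) (rotate_vec \<psi> b))"
        unfolding sums_cnj by (rule kernel_sums[OF y b])
      moreover have "cnj (cis (\<theta> k - \<psi>)) = cis (\<psi> - \<theta> k)" by (simp add: cis_cnj)
      ultimately show ?thesis by (intro sums_mult) (simp add: cnj_c)
    qed
    have mb: "norm (?f m y) \<le> B m * norm (?V k y)" if "y \<in> ball 0 1" for m y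
      using mult_right_mono[OF B(2)[of y m], of "norm (?V k y)"] that
      by (simp add: norm_mult norm_power mult_ac)
    have fi: "set_integrable lborel (ball 0 1) (?f m)" for m
    proof (rule set_integrable_bound)
      show "set_integrable lborel (ball 0 1) (\<lambda>y. of_real (B m) * ?V k y)" using int[OF k] by simp
      have [measurable]: "kernel_part p b m \<in> borel_measurable borel"
        using continuous_on_hp[OF hp_kernel_part] by (rule borel_measurable_continuous_onI)
      have [measurable]: "(\<lambda>y. indicator (ball 0 1) y *\<^sub>R ?V k y) \<in> borel_measurable borel"
        using int[OF k] unfolding set_integrable_def by simp
      have "(\<lambda>y. (indicator (ball 0 1) y *\<^sub>R ?V k y) * (?c m * (cis (\<psi> - \<theta> k) ^ m * kernel_part p b m y))) \<in> borel_measurable borel"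
        by measurable
      then show "set_borel_measurable lborel (ball 0 1) (?f m)" unfolding set_borel_measurable_def by simp
      show "AE y in lborel. y \<in> ball 0 1 \<longrightarrow> norm (?f m y) \<le> norm (of_real (B m) * ?V k y)"
      proof (rule AE_I2, rule impI)
        fix y :: "real^'n" assume y: "y \<in> ball 0 1"
        have "norm (?f m y) \<le> \<bar>B m\<bar> * norm (?V k y)"
          using mb[OF y, of m] by (rule order_trans) (intro mult_right_mono, auto)
        then show "norm (?f m y) \<le> norm (of_real (B m) * ?V k y)" by (simp add: norm_mult)
      qed
    qed
    have wi: "set_integrable lborel (ball 0 1) (\<lambda>y. norm (?V k y))"
      using int[OF k] by (rule set_integrable_norm)
    have "(\<lambda>m. LINT y:ball 0 1|lborel. ?f m y) sums ?I k"
      by (rule set_integral_sums(2)[OF fi wi mb B(1) sm])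
    moreover have "(LINT y:ball 0 1|lborel. ?f m y) = ?c m * cis (\<psi> - \<theta> k) ^ m * ?J m k" for m
    proof -
      have "(LINT y:ball 0 1|lborel. ?f m y) =
          (LINT y:ball 0 1|lborel. (?c m * cis (\<psi> - \<theta> k) ^ m) * (?V k y * kernel_part p b m y))"
        by (simp add: mult_ac)
      then show ?thesis by simp
    qed
    ultimately show ?thesis by simp
  qed
  have J: "?J m k = (\<Sum>j | j < p \<and> 2 * j \<le> m. sqnorm b ^ j * (\<Sum>i<p. cis (\<theta> k) ^ (m - 2 * j + 2 * i) *
      of_real (?A / real (CARD('n) + 2 * (m - 2 * j) + 2 * (j + i))) * H (m - 2 * j) i b))" if k: "k < p" for m k
  proof -
    have mom: "(LINT y:ball 0 1|lborel. sqnorm y ^ j * (zonal_harmonic l b y * ?V k y)) =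
        (\<Sum>i<p. cis (\<theta> k) ^ (l + 2 * i) * of_real (?A / (CARD('n) + 2 * l + 2 * (j + i))) * H l i b)" for j l
      by (rule bergman_moment(1)[OF H growth int[OF k] ext[OF k]])
    have fin: "set_integrable lborel (ball 0 1) (\<lambda>y. sqnorm b ^ j * (sqnorm y ^ j * (zonal_harmonic l b y * ?V k y)))" for j l
      using bergman_moment(2)[OF H growth int[OF k] ext[OF k]] by simp
    have "?J m k = (LINT y:ball 0 1|lborel. \<Sum>j | j < p \<and> 2 * j \<le> m. sqnorm b ^ j * (sqnorm y ^ j * (zonal_harmonic (m - 2 * j) b y * ?V k y)))"
      unfolding kernel_part_eq sum_distrib_left by (simp add: power_mult_distrib mult_ac)
    also have "\<dots> = (\<Sum>j | j < p \<and> 2 * j \<le> m. LINT y:ball 0 1|lborel. sqnorm b ^ j * (sqnorm y ^ j * (zonal_harmonic (m - 2 * j) b y * ?V k y)))"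
      unfolding set_lebesgue_integral_def scaleR_sum_right
      by (rule Bochner_Integration.integral_sum) (use fin in \<open>simp add: set_integrable_def\<close>)
    also have "\<dots> = (\<Sum>j | j < p \<and> 2 * j \<le> m. sqnorm b ^ j * (\<Sum>i<p. cis (\<theta> k) ^ (m - 2 * j + 2 * i) *
      of_real (?A / real (CARD('n) + 2 * (m - 2 * j) + 2 * (j + i))) * H (m - 2 * j) i b))"
      by (intro sum.cong refl) (simp only: set_integral_mult_right mom)
    finally show ?thesis .
  qed
  have avg: "(\<Sum>k<p. ?c m * cis (\<psi> - \<theta> k) ^ m * ?J m k) = of_nat p * (cis \<psi> ^ m * hom_part p H m b)" for m
  proof -
    define D where "D j i = of_real (?A / real (CARD('n) + 2 * (m - 2 * j) + 2 * (j + i))) * H (m - 2 * j) i b" for j i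
    have J': "?J m k = (\<Sum>j | j < p \<and> 2 * j \<le> m. \<Sum>i<p. sqnorm b ^ j * (cis (\<theta> k) ^ (m - 2 * j + 2 * i) * D j i))"
      if "k < p" for k
      unfolding J[OF that] D_def sum_distrib_left mult.assoc ..
    have split: "cis (\<psi> - \<theta> k) ^ m = cis \<psi> ^ m * cis (- \<theta> k) ^ m" for k
      by (simp add: cis_mult flip: power_mult_distrib)
    have "(\<Sum>k<p. ?c m * cis (\<psi> - \<theta> k) ^ m * ?J m k) =
      (\<Sum>k<p. \<Sum>j | j < p \<and> 2 * j \<le> m. \<Sum>i<p. (?c m * cis \<psi> ^ m * sqnorm b ^ j * D j i) *
         (cis (- \<theta> k) ^ m * cis (\<theta> k) ^ (m - 2 * j + 2 * i)))"
    proof (intro sum.cong refl)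
      fix k assume "k \<in> {..<p}"
      then have k: "k < p" by simp
      show "?c m * cis (\<psi> - \<theta> k) ^ m * ?J m k =
        (\<Sum>j | j < p \<and> 2 * j \<le> m. \<Sum>i<p. (?c m * cis \<psi> ^ m * sqnorm b ^ j * D j i) *
         (cis (- \<theta> k) ^ m * cis (\<theta> k) ^ (m - 2 * j + 2 * i)))"
        unfolding J'[OF k] split sum_distrib_left by (intro sum.cong refl) (simp only: mult_ac)
    qed
    also have "\<dots> = (\<Sum>j | j < p \<and> 2 * j \<le> m. \<Sum>i<p. (?c m * cis \<psi> ^ m * sqnorm b ^ j * D j i) *
         (\<Sum>k<p. cis (- \<theta> k) ^ m * cis (\<theta> k) ^ (m - 2 * j + 2 * i)))"
      unfolding sum_distrib_left by (rule trans[OF sum.swap], rule sum.cong[OF refl], rule sum.swap)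
    also have "\<dots> = (\<Sum>j | j < p \<and> 2 * j \<le> m. of_nat p * (cis \<psi> ^ m * (sqnorm b ^ j * H (m - 2 * j) j b)))"
    proof (intro sum.cong refl)
      fix j assume "j \<in> {j. j < p \<and> 2 * j \<le> m}"
      then have j: "j < p" "2 * j \<le> m" by auto
      have "(\<Sum>i<p. (?c m * cis \<psi> ^ m * sqnorm b ^ j * D j i) * (\<Sum>k<p. cis (- \<theta> k) ^ m * cis (\<theta> k) ^ (m - 2 * j + 2 * i))) =
        (\<Sum>i<p. if i = j then (?c m * cis \<psi> ^ m * sqnorm b ^ j * D j i) * of_nat p else 0)"
      proof (intro sum.cong refl)
        fix i assume "i \<in> {..<p}"
        then have i: "i < p" by simp
        show "(?c m * cis \<psi> ^ m * sqnorm b ^ j * D j i) * (\<Sum>k<p. cis (- \<theta> k) ^ m * cis (\<theta> k) ^ (m - 2 * j + 2 * i)) =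
          (if i = j then (?c m * cis \<psi> ^ m * sqnorm b ^ j * D j i) * of_nat p else 0)"
          unfolding \<theta>_def roots_of_unity_sum[OF i j] by simp
      qed
      also have "\<dots> = (?c m * cis \<psi> ^ m * sqnorm b ^ j * D j j) * of_nat p" using j by simp
      also have "D j j = of_real (?A / (CARD('n) + 2 * m)) * H (m - 2 * j) j b"
        using j by (simp add: D_def of_nat_diff)
      also have "?c m * cis \<psi> ^ m * sqnorm b ^ j * (of_real (?A / (CARD('n) + 2 * m)) * H (m - 2 * j) j b) * of_nat p =
         (?c m * of_real (?A / (CARD('n) + 2 * m))) * (of_nat p * (cis \<psi> ^ m * (sqnorm b ^ j * H (m - 2 * j) j b)))"
        by (simp only: mult_ac)
      also have "?c m * of_real (?A / (CARD('n) + 2 * m)) = 1"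
      proof -
        have "?c m = of_real ((CARD('n) + 2 * m) / ?A)" by (simp add: kernel_coeff_def)
        then have "?c m * of_real (?A / (CARD('n) + 2 * m)) = of_real ((CARD('n) + 2 * m) / ?A * (?A / (CARD('n) + 2 * m)))"
          by (simp only: of_real_mult)
        also have "(CARD('n) + 2 * m) / ?A * (?A / (CARD('n) + 2 * m)) = 1" using A by (simp add: add_nonneg_eq_0_iff)
        finally show ?thesis by simp
      qed
      finally show "(\<Sum>i<p. (?c m * cis \<psi> ^ m * sqnorm b ^ j * D j i) * (\<Sum>k<p. cis (- \<theta> k) ^ m * cis (\<theta> k) ^ (m - 2 * j + 2 * i))) =
        of_nat p * (cis \<psi> ^ m * (sqnorm b ^ j * H (m - 2 * j) j b))" by simp
    qed
    finally show ?thesis by (simp add: hom_part_def sum_distrib_left)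
  qed
  have "(\<lambda>m. \<Sum>k<p. ?c m * cis (\<psi> - \<theta> k) ^ m * ?J m k) sums (\<Sum>k<p. ?I k)"
    by (rule sums_sum) (use I in auto)
  moreover have "(\<lambda>m. of_nat p * (cis \<psi> ^ m * hom_part p H m b)) sums (of_nat p * U x)"
    unfolding x_eq \<psi>_def by (intro sums_mult ext k0 b)
  ultimately have "(\<Sum>k<p. ?I k) = of_nat p * U x" unfolding avg by (rule sums_unique2)
  then show ?thesis unfolding bergman_inner_def \<theta>_def using p by simp
qed

subsection \<open>Uniqueness\<close>

lemma cnj_bergman_inner:
  fixes u v :: "complex^'n::finite \<Rightarrow> complex"
  shows "cnj (bergman_inner p u v) = bergman_inner p v u"
proof -
  have "cnj (LINT y:ball 0 1|lborel. f y * cnj (g y)) = (LINT y:ball 0 1|lborel. g y * cnj (f y))"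
    for f g :: "real^'n \<Rightarrow> complex"
    unfolding set_lebesgue_integral_def by (subst Bochner_Integration.integral_cnj[symmetric]) (simp add: mult.commute)
  then show ?thesis by (simp add: bergman_inner_def)
qed

text \<open>Two reproducing kernels agree: each of them reproduces the other, and the inner product
  is conjugate symmetric.\<close>

theorem bergman_kernel_eq: "bergman_kernel p = (bkernel p :: complex^'n::finite \<Rightarrow> _)"
  unfolding bergman_kernel_def
proof (rule the_equality)
  show "(\<forall>x\<in>rotated_balls p. (\<lambda>y. bkernel p y x) \<in> bergman_space p \<and>
      (\<forall>u\<in>bergman_space p. u x = bergman_inner p u (\<lambda>y. bkernel p y x))) \<and>
    (\<forall>x y. x \<notin> rotated_balls p \<or> y \<notin> rotated_balls p \<longrightarrow> bkernel p x y = 0)"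
    (is "?A \<and> ?B")
  proof
    show ?A using bkernel_in_bergman_space bkernel_reproducing by blast
    show ?B by (auto simp: bkernel_def)
  qed
  fix K :: "complex^'n \<Rightarrow> complex^'n \<Rightarrow> complex"
  assume K: "(\<forall>x\<in>rotated_balls p. (\<lambda>y. K y x) \<in> bergman_space p \<and>
      (\<forall>u\<in>bergman_space p. u x = bergman_inner p u (\<lambda>y. K y x))) \<and>
    (\<forall>x y. x \<notin> rotated_balls p \<or> y \<notin> rotated_balls p \<longrightarrow> K x y = 0)"
  show "K = bkernel p"
  proof (intro ext)
    fix z x
    show "K z x = bkernel p z x"
    proof (cases "z \<in> rotated_balls p \<and> x \<in> rotated_balls p")
      case True
      have "K z x = bergman_inner p (\<lambda>y. K y x) (\<lambda>y. bkernel p y z)"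
        using bkernel_reproducing[of "\<lambda>y. K y x" p z] K True by blast
      also have "\<dots> = cnj (bergman_inner p (\<lambda>y. bkernel p y z) (\<lambda>y. K y x))" by (simp add: cnj_bergman_inner)
      also have "bergman_inner p (\<lambda>y. bkernel p y z) (\<lambda>y. K y x) = bkernel p x z"
      proof (rule sym)
        have "\<forall>u\<in>bergman_space p. u x = bergman_inner p u (\<lambda>y. K y x)" using K True by blast
        from bspec[OF this bkernel_in_bergman_space[of z p]] True
        show "bkernel p x z = bergman_inner p (\<lambda>y. bkernel p y z) (\<lambda>y. K y x)" by simp
      qed
      also have "bkernel p x z = bergman_inner p (\<lambda>y. bkernel p y z) (\<lambda>y. bkernel p y x)"
        using bkernel_reproducing[OF bkernel_in_bergman_space[of z p], of x] True by blast
      also have "cnj \<dots> = bkernel p z x"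
        using bkernel_reproducing[OF bkernel_in_bergman_space[of x p], of z] True by (simp add: cnj_bergman_inner)
      finally show ?thesis .
    next
      case False
      then show ?thesis using K by (auto simp: bkernel_def)
    qed
  qed
qed

subsection \<open>The extended harmonic kernel\<close>

text \<open>Extending the harmonic kernel in both variables multiplies its part of degree
  \<open>m\<close> by the phase \<open>e^(im(\<phi>-\<psi>))\<close>, and so does evaluating the
  closed form at the rotated points.\<close>

lemma extended_harmonic_kernel_eq:
  fixes a b :: "real^'n::finite"
  assumes a: "norm a < 1" and b: "norm b < 1"
  shows "extended_harmonic_bergman_kernel (rotate_vec \<phi> a) (rotate_vec \<psi> b) =
    kernel 1 (rotate_vec \<phi> a) (rotate_vec \<psi> b)"
proof -
  let ?c = "kernel_coeff TYPE('n)"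
  have real_ball: "complex_vec y = rotate_vec 0 y" for y :: "real^'n"
    by (simp add: rotate_vec_def vec_eq_iff)
  have harm_eq: "harmonic_bergman_kernel x y = kernel 1 (rotate_vec 0 x) (rotate_vec 0 y)"
    if "norm x < 1" "norm y < 1" for x y :: "real^'n"
    using rotated_balls_I[of 0 1 x] rotated_balls_I[of 0 1 y] that
    by (simp add: harmonic_bergman_kernel_def bergman_kernel_eq bkernel_def real_ball)
  have inner: "holomorphic_extension (\<lambda>x. harmonic_bergman_kernel x y) (rotate_vec \<phi> a) =
      kernel 1 (rotate_vec \<phi> a) (rotate_vec 0 y)" if y: "norm y < 1" for y
  proof -
    have "holomorphic_extension (\<lambda>x. harmonic_bergman_kernel x y) (rotate_vec \<phi> a) =
       (\<Sum>m. cis \<phi> ^ m * (?c m * kernel_part 1 y m a))"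
    proof (rule holomorphic_extension_eq[OF _ _ a])
      show "hp m (\<lambda>a. ?c m * kernel_part 1 y m a)" for m by (intro hp_cmult hp_kernel_part)
      show "(\<lambda>m. ?c m * kernel_part 1 y m x) sums harmonic_bergman_kernel x y" if "norm x < 1" for x
        using kernel_sums[OF that y, of 0 0 1] by (simp add: harm_eq[OF that y])
    qed
    also have "\<dots> = kernel 1 (rotate_vec \<phi> a) (rotate_vec 0 y)"
      using kernel_sums[OF a y, of \<phi> 0 1] by (simp add: sums_iff mult.left_commute)
    finally show ?thesis .
  qed
  have "extended_harmonic_bergman_kernel (rotate_vec \<phi> a) (rotate_vec \<psi> b) =
     (\<Sum>m. cis (- \<psi>) ^ m * (?c m * cis \<phi> ^ m * kernel_part 1 a m b))"
    unfolding extended_harmonic_bergman_kernel_def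
  proof (rule antiholomorphic_extension_eq[OF _ _ b])
    show "hp m (\<lambda>b. ?c m * cis \<phi> ^ m * kernel_part 1 a m b)" for m by (intro hp_cmult hp_kernel_part)
    show "(\<lambda>m. ?c m * cis \<phi> ^ m * kernel_part 1 a m y) sums
        holomorphic_extension (\<lambda>x. harmonic_bergman_kernel x y) (rotate_vec \<phi> a)" if y: "norm y < 1" for y
      using kernel_sums[OF a y, of \<phi> 0 1] unfolding inner[OF y] kernel_part_sym[of 1 a _ y] by (simp add: mult.assoc)
  qed
  also have "(\<lambda>m. cis (- \<psi>) ^ m * (?c m * cis \<phi> ^ m * kernel_part 1 a m b)) =
      (\<lambda>m. ?c m * (cis (\<phi> - \<psi>) ^ m * kernel_part 1 b m a))"
  proof
    fix m
    have "cis (\<phi> - \<psi>) ^ m = cis \<phi> ^ m * cis (- \<psi>) ^ m" by (simp add: cis_mult flip: power_mult_distrib)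
    then show "cis (- \<psi>) ^ m * (?c m * cis \<phi> ^ m * kernel_part 1 a m b) = ?c m * (cis (\<phi> - \<psi>) ^ m * kernel_part 1 b m a)"
      unfolding kernel_part_sym[of 1 a _ b] by (simp add: mult_ac)
  qed
  also have "suminf \<dots> = kernel 1 (rotate_vec \<phi> a) (rotate_vec \<psi> b)"
    using kernel_sums[OF a b] by (simp add: sums_iff)
  finally show ?thesis .
qed

theorem theorem3:
  fixes p :: nat and x y :: "complex^'n::finite"
  assumes "p \<ge> 1"
    and "x \<in> rotated_balls p" and "y \<in> rotated_balls p"
  shows "bergman_kernel p x y =
    (1 - complex_norm x ^ (2 * p) * complex_norm (conj_vec y) ^ (2 * p)) /
    (1 - complex_norm x ^ 2 * complex_norm (conj_vec y) ^ 2)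
      * extended_harmonic_bergman_kernel x y
    + 1 / complex_of_real (real CARD('n) * unit_ball_vol (real CARD('n)))
      * (\<Sum>k<p. 4 * of_nat k * complex_norm x ^ (2 * k) * complex_norm (conj_vec y) ^ (2 * k)
                 * poisson_kernel x y)"
proof -
  obtain k a where a: "norm a < 1" and x: "x = rotate_vec (real k * pi / real p) a"
    using rotated_balls_E[OF assms(2)] by metis
  obtain l b where b: "norm b < 1" and y: "y = rotate_vec (real l * pi / real p) b"
    using rotated_balls_E[OF assms(3)] by metis
  let ?q = "sq_prod x y" and ?A = "complex_of_real (sphere_area TYPE('n))"
  let ?Z = "zonal_gen (CARD('n) / 2) (herm_dot x y) ?q 1"
  let ?E = "zonal_euler (CARD('n) / 2) (herm_dot x y) ?q 1"
  have pw: "complex_norm x ^ (2 * k) * complex_norm (conj_vec y) ^ (2 * k) = ?q ^ k" for k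
    by (simp add: sq_prod_def power_mult power_mult_distrib)
  have "norm ?q < 1"
  proof -
    have "norm a ^ 2 * norm b ^ 2 < 1"
      using norm_prod_lt_1[OF a b] real_sqrt_lt_1_iff[of "norm a ^ 2 * norm b ^ 2"] by blast
    then show ?thesis unfolding x y sq_prod_rotate by (simp add: norm_mult norm_power sqnorm_def)
  qed
  then have q1: "?q \<noteq> 1" by auto
  have one: "1 - 2 * herm_dot x y + ?q = 1 - 2 * 1 * herm_dot x y + 1\<^sup>2 * ?q" "1 - ?q = 1 - 1\<^sup>2 * ?q"
    by simp_all
  have geo: "(1 - ?q ^ p) / (1 - ?q) = (\<Sum>j<p. ?q ^ j)"
    using geometric_sum[OF q1, of p] q1 by (simp add: divide_simps) (simp add: algebra_simps)
  have harmonic: "extended_harmonic_bergman_kernel x y = (of_nat CARD('n) * ?Z + 2 * ?E) / ?A"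
    unfolding x y extended_harmonic_kernel_eq[OF a b] by (simp add: kernel_def)
  have poisson: "poisson_kernel x y = ?Z"
  proof -
    have "poisson_kernel x y = (1 - ?q) / (1 - 2 * herm_dot x y + ?q) powr of_real (real CARD('n) / 2)"
      unfolding poisson_kernel_def herm_dot_def sq_prod_def of_real_divide of_real_of_nat_eq of_real_numeral ..
    then show ?thesis unfolding one zonal_gen_def powr_minus divide_inverse .
  qed
  have "bergman_kernel p x y = kernel p x y"
    using assms by (simp add: bergman_kernel_eq bkernel_def)
  \<comment> \<open>splitting the weight \<open>n + 4j + 2l\<close> into \<open>n + 2l\<close> and
    \<open>4j\<close> separates the harmonic Bergman kernel from the Poisson kernel\<close>
  also have "\<dots> = (\<Sum>j<p. ?q ^ j * ((of_nat CARD('n) * ?Z + 2 * ?E) / ?A) + 1 / ?A * (4 * of_nat j * ?q ^ j * ?Z))"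
    unfolding kernel_def sum_divide_distrib by (intro sum.cong refl) (simp add: add_divide_distrib algebra_simps)
  also have "\<dots> = (\<Sum>j<p. ?q ^ j) * ((of_nat CARD('n) * ?Z + 2 * ?E) / ?A) + 1 / ?A * (\<Sum>j<p. 4 * of_nat j * ?q ^ j * ?Z)"
    unfolding sum.distrib sum_distrib_left sum_distrib_right ..
  finally show ?thesis
    unfolding harmonic poisson geo[symmetric] using pw[of p] pw[of 1]
    by (simp add: sphere_area_def mult.assoc pw)
qed

end
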